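(* For every $n=1,2,\dots,\infty$, the morphism $TR:\mathcal{E}\to\mathcal{X}$ defined in the context induces a quasi-isomorphism of operads $F_nTR:F_n\mathcal{E}\to F_n\mathcal{X}$.
   Context: All modules are over $\mathbf{Z}$; arities are $r\geq 1$. A permutation $w\in\Sigma_r$ is written as the sequence $(w(1),\dots,w(r))$. A quasi-isomorphism of operads is a morphism of differential graded operads which is a quasi-isomorphism of chain complexes in each arity. **Barratt-Eccles operad.** $\mathcal{W}(r)$ is the simplicial set with $\mathcal{W}(r)_n=\Sigma_r^{n+1}$, $d_i(w_0,\dots,w_n)=(w_0,\dots,\widehat{w_i},\dots,w_n)$, $s_j(w_0,\dots,w_n)=(w_0,\dots,w_j,w_j,\dots,w_n)$. $\mathcal{E}(r)$ is its normalized chain complex (tuples with $w_i=w_{i+1}$ for some $i$ are set to $0$; $\delta=\sum_i(-1)^i d_i$). $\Sigma_r$ acts by $\sigma\cdot(w_0,\dots,w_n)=(\sigma w_0,\dots,\sigma w_n)$. For $u\in\Sigma_r$, $v\in\Sigma_s$, $u\circ_k v\in\Sigma_{r+s-1}$ is obtained from the sequence $u$ by increasing the values $>k$ by $s-1$ and replacing the value $k$ by the sequence $(v(1)+k-1,\dots,v(s)+k-1)$. Applied levelwise, this makes $\mathcal{W}$ a simplicial operad. On $\mathcal{E}$ the composite is induced through the Eilenberg-Zilber map: $(u_0,\dots,u_d)\circ_k(v_0,\dots,v_e)=\sum\pm(u_{x_0}\circ_k v_{y_0},\dots,u_{x_{d+e}}\circ_k v_{y_{d+e}})$, the sum running over lattice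 paths $(x_*,y_* )$ from $(0,0)$ to $(d,e)$ with unit steps, $\pm$ being the signature of the corresponding shuffle (positive when all $x$-steps precede all $y$-steps). **Surjection operad.** $\mathcal{X}(r)_d$ is the free module on the non-degenerate surjections $u:\{1,\dots,r+d\}\to\{1,\dots,r\}$, i.e. those with $u(i)\neq u(i+1)$ for all $i$; degenerate surjections and non-surjective maps represent $0$. A surjection is written as the sequence $(u(1),\dots,u(r+d))$. $\Sigma_r$ acts by composition on values. A term $u(i)$ is a *caesura* if it is not the last occurrence of its value; there are $d$ caesuras. The differential is $\delta u=\sum_i\pm(u(1),\dots,\widehat{u(i)},\dots,u(r+d))$, where the caesuras, in order, have the signs $+,-,+,\dots$, and the last occurrence of a value that occurs at least twice has the sign opposite to that of the previous occurrence of the same value. For $u\in\mathcal{X}(r)_d$ and $v\in\mathcal{X}(s)_e$, suppose $k$ has $n$ occurrences in $u$. Then $u\circ_k v=\sum\pm c_j$, the sum over $1=j_0\leq j_1\leq\dots\leq j_{n-1}\leq j_n=s+e$, where $c_j$ is obtained by replacing, for $m=1,\dots,n$, the $m$-th occurrence of $k$ in $u$ by $(v(j_{m-1}),\dots,v(j_m))$, with the terms from $v$ increased by $k-1$ and the terms of $u$ greater than $k$ increased by $s-1$. Sign: each of the $d+e$ caesuras of $c_j$ is of type $u$ or $v$; it has type $u$ if it comes from a term $\neq k$ of $u$ or is the end term of the segment inserted for the $m$-th occurrence of $k$ with $m<n$, and type $v$ otherwise; $\pm$ is the signature of the shuffle moving all type-$u$ caesuras before all type-$v$ caesuras, preserving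 the order within each type. **The morphism $TR$.** $TR(w_0,\dots,w_d)=\sum u_{r_0,\dots,r_d}$, the sum over integers $r_0,\dots,r_d\geq1$ with $r_0+\dots+r_d=r+d$, where $u_{r_0,\dots,r_d}$ is the concatenation of rows $0,\dots,d$; row $i$ consists of the first $r_i$ terms of the sequence obtained from $(w_i(1),\dots,w_i(r))$ by deleting the values that appear in a non-final position of one of the rows $0,\dots,i-1$. (Degenerate surjections count as $0$.) **Filtrations.** For a sequence $w$, $w|_{ij}$ denotes its subsequence of terms in $\{i,j\}$. For $n=1,2,\dots$, $F_n\mathcal{E}(r)\subset\mathcal{E}(r)$ is generated by the simplices $(w_0,\dots,w_d)$ such that for all $i<j$ the sequence $(w_0|_{ij},\dots,w_d|_{ij})$ has fewer than $n$ variations (indices $l$ with $w_l|_{ij}\neq w_{l+1}|_{ij}$). $F_n\mathcal{X}(r)\subset\mathcal{X}(r)$ is generated by the surjections $u$ such that for all $i<j$ the subsequence $u|_{ij}$ has at most $n$ pairs of unequal consecutive terms. $F_\infty\mathcal{E}=\mathcal{E}$ and $F_\infty\mathcal{X}=\mathcal{X}$. These are suboperads. *)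

theory Defs
  imports
    "HOL-Algebra.Coset"
    "HOL-Combinatorics.Permutations"
    "HOL-Combinatorics.Multiset_Permutations"
    "HOL-Library.Poly_Mapping"
    "HOL-Library.Extended_Nat"
begin

section \<open>Differential graded operads over the integers\<close>

text \<open>
  Operads have arities \<open>r \<ge> 1\<close> and are non-negatively graded.  \<open>chains P r d\<close> is the degree \<open>d\<close>
  part of arity \<open>r\<close>, a subgroup of the ambient abelian group \<open>'a\<close>; the other fields matter only on
  these subgroups.  \<open>bdry P r\<close> is the differential in arity \<open>r\<close>, \<open>act P r \<sigma>\<close> the action of
  \<open>\<sigma> permutes {1..r}\<close>, and \<open>pcomp P r s k x y\<close> is \<open>x \<circ>\<^sub>k y\<close> for \<open>x\<close> of arity \<open>r\<close> and \<open>y\<close> of arity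
  \<open>s\<close>.
\<close>

record 'a operad_data =
  chains :: "nat \<Rightarrow> nat \<Rightarrow> 'a set"
  bdry :: "nat \<Rightarrow> 'a \<Rightarrow> 'a"
  act :: "nat \<Rightarrow> (nat \<Rightarrow> nat) \<Rightarrow> 'a \<Rightarrow> 'a"
  pcomp :: "nat \<Rightarrow> nat \<Rightarrow> nat \<Rightarrow> 'a \<Rightarrow> 'a \<Rightarrow> 'a"
  opunit :: 'a

definition signed :: "nat \<Rightarrow> 'a::ab_group_add \<Rightarrow> 'a" where
  "signed m x = (if even m then x else - x)"

text \<open>
  The composite \<open>\<sigma> \<circ> \<tau>\<close> at position \<open>k\<close>: \<open>\<tau>\<close> permutes the block \<open>{k..<k+s}\<close>, \<open>\<sigma>\<close> permutes this
  block and the remaining points, the block being moved to where \<open>\<sigma>\<close> sends \<open>k\<close>.  In one-line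
  notation this is the sequence of \<open>\<sigma>\<close> with the value \<open>\<sigma> k\<close> replaced by the shifted sequence of
  \<open>\<tau>\<close>.
\<close>

definition block_perm :: "nat \<Rightarrow> nat \<Rightarrow> (nat \<Rightarrow> nat) \<Rightarrow> (nat \<Rightarrow> nat) \<Rightarrow> nat \<Rightarrow> nat" where
  "block_perm s k \<sigma> \<tau> m =
    (let shift = (\<lambda>x. if x > \<sigma> k then x + s - 1 else x) in
     if m < k then shift (\<sigma> m)
     else if m < k + s then \<tau> (m - k + 1) + \<sigma> k - 1
     else shift (\<sigma> (m - s + 1)))"

locale dg_operad =
  fixes P :: "'a::ab_group_add operad_data"
  assumes zero_chain: "1 \<le> r \<Longrightarrow> 0 \<in> chains P r d"
    and add_chain: "\<lbrakk>1 \<le> r; x \<in> chains P r d; y \<in> chains P r d\<rbrakk> \<Longrightarrow> x + y \<in> chains P r d"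
    and minus_chain: "\<lbrakk>1 \<le> r; x \<in> chains P r d\<rbrakk> \<Longrightarrow> - x \<in> chains P r d"
    and bdry_chain: "\<lbrakk>1 \<le> r; x \<in> chains P r (Suc d)\<rbrakk> \<Longrightarrow> bdry P r x \<in> chains P r d"
    and bdry_degree_0: "\<lbrakk>1 \<le> r; x \<in> chains P r 0\<rbrakk> \<Longrightarrow> bdry P r x = 0"
    and bdry_add: "\<lbrakk>1 \<le> r; x \<in> chains P r d; y \<in> chains P r d\<rbrakk>
      \<Longrightarrow> bdry P r (x + y) = bdry P r x + bdry P r y"
    and bdry_bdry: "\<lbrakk>1 \<le> r; x \<in> chains P r d\<rbrakk> \<Longrightarrow> bdry P r (bdry P r x) = 0"
    and act_chain: "\<lbrakk>1 \<le> r; \<sigma> permutes {1..r}; x \<in> chains P r d\<rbrakk> \<Longrightarrow> act P r \<sigma> x \<in> chains P r d"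
    and act_add: "\<lbrakk>1 \<le> r; \<sigma> permutes {1..r}; x \<in> chains P r d; y \<in> chains P r d\<rbrakk>
      \<Longrightarrow> act P r \<sigma> (x + y) = act P r \<sigma> x + act P r \<sigma> y"
    and act_id: "\<lbrakk>1 \<le> r; x \<in> chains P r d\<rbrakk> \<Longrightarrow> act P r id x = x"
    and act_act: "\<lbrakk>1 \<le> r; \<sigma> permutes {1..r}; \<tau> permutes {1..r}; x \<in> chains P r d\<rbrakk>
      \<Longrightarrow> act P r \<sigma> (act P r \<tau> x) = act P r (\<sigma> \<circ> \<tau>) x"
    and act_bdry: "\<lbrakk>1 \<le> r; \<sigma> permutes {1..r}; x \<in> chains P r d\<rbrakk>
      \<Longrightarrow> bdry P r (act P r \<sigma> x) = act P r \<sigma> (bdry P r x)"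
    and pcomp_chain: "\<lbrakk>1 \<le> k; k \<le> r; 1 \<le> s; x \<in> chains P r d; y \<in> chains P s e\<rbrakk>
      \<Longrightarrow> pcomp P r s k x y \<in> chains P (r + s - 1) (d + e)"
    and pcomp_add_left:
      "\<lbrakk>1 \<le> k; k \<le> r; 1 \<le> s; x \<in> chains P r d; x' \<in> chains P r d; y \<in> chains P s e\<rbrakk>
      \<Longrightarrow> pcomp P r s k (x + x') y = pcomp P r s k x y + pcomp P r s k x' y"
    and pcomp_add_right:
      "\<lbrakk>1 \<le> k; k \<le> r; 1 \<le> s; x \<in> chains P r d; y \<in> chains P s e; y' \<in> chains P s e\<rbrakk>
      \<Longrightarrow> pcomp P r s k x (y + y') = pcomp P r s k x y + pcomp P r s k x y'"
    and bdry_pcomp: "\<lbrakk>1 \<le> k; k \<le> r; 1 \<le> s; x \<in> chains P r d; y \<in> chains P s e\<rbrakk>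
      \<Longrightarrow> bdry P (r + s - 1) (pcomp P r s k x y)
          = pcomp P r s k (bdry P r x) y + signed d (pcomp P r s k x (bdry P s y))"
    and act_pcomp: "\<lbrakk>1 \<le> k; k \<le> r; 1 \<le> s; \<sigma> permutes {1..r}; \<tau> permutes {1..s};
        x \<in> chains P r d; y \<in> chains P s e\<rbrakk>
      \<Longrightarrow> pcomp P r s (\<sigma> k) (act P r \<sigma> x) (act P s \<tau> y)
          = act P (r + s - 1) (block_perm s k \<sigma> \<tau>) (pcomp P r s k x y)"
    and pcomp_sequential: "\<lbrakk>1 \<le> k; k \<le> r; 1 \<le> l; l \<le> s; 1 \<le> t;
        x \<in> chains P r d; y \<in> chains P s e; z \<in> chains P t f\<rbrakk>
      \<Longrightarrow> pcomp P (r + s - 1) t (k + l - 1) (pcomp P r s k x y) z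
          = pcomp P r (s + t - 1) k x (pcomp P s t l y z)"
    and pcomp_parallel: "\<lbrakk>1 \<le> i; i < k; k \<le> r; 1 \<le> s; 1 \<le> t;
        x \<in> chains P r d; y \<in> chains P s e; z \<in> chains P t f\<rbrakk>
      \<Longrightarrow> pcomp P (r + s - 1) t i (pcomp P r s k x y) z
          = signed (e * f) (pcomp P (r + t - 1) s (k + t - 1) (pcomp P r t i x z) y)"
    and unit_chain: "opunit P \<in> chains P 1 0"
    and unit_left: "\<lbrakk>1 \<le> s; y \<in> chains P s e\<rbrakk> \<Longrightarrow> pcomp P 1 s 1 (opunit P) y = y"
    and unit_right: "\<lbrakk>1 \<le> k; k \<le> r; x \<in> chains P r d\<rbrakk> \<Longrightarrow> pcomp P r 1 k x (opunit P) = x"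

locale dg_operad_morphism =
  source: dg_operad P + target: dg_operad Q
  for P :: "'a::ab_group_add operad_data" and Q :: "'b::ab_group_add operad_data" +
  fixes f :: "nat \<Rightarrow> 'a \<Rightarrow> 'b"
  assumes map_chain: "\<lbrakk>1 \<le> r; x \<in> chains P r d\<rbrakk> \<Longrightarrow> f r x \<in> chains Q r d"
    and map_add: "\<lbrakk>1 \<le> r; x \<in> chains P r d; y \<in> chains P r d\<rbrakk> \<Longrightarrow> f r (x + y) = f r x + f r y"
    and map_bdry: "\<lbrakk>1 \<le> r; x \<in> chains P r d\<rbrakk> \<Longrightarrow> f r (bdry P r x) = bdry Q r (f r x)"
    and map_act: "\<lbrakk>1 \<le> r; \<sigma> permutes {1..r}; x \<in> chains P r d\<rbrakk>
      \<Longrightarrow> f r (act P r \<sigma> x) = act Q r \<sigma> (f r x)"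
    and map_pcomp: "\<lbrakk>1 \<le> k; k \<le> r; 1 \<le> s; x \<in> chains P r d; y \<in> chains P s e\<rbrakk>
      \<Longrightarrow> f (r + s - 1) (pcomp P r s k x y) = pcomp Q r s k (f r x) (f s y)"
    and map_unit: "f 1 (opunit P) = opunit Q"

definition cycle_group :: "'a::ab_group_add operad_data \<Rightarrow> nat \<Rightarrow> nat \<Rightarrow> 'a monoid" where
  "cycle_group P r d = \<lparr>carrier = {x \<in> chains P r d. bdry P r x = 0}, monoid.mult = (+), monoid.one = 0\<rparr>"

definition boundaries :: "'a::ab_group_add operad_data \<Rightarrow> nat \<Rightarrow> nat \<Rightarrow> 'a set" where
  "boundaries P r d = bdry P r ` chains P r (Suc d)"

definition homology :: "'a::ab_group_add operad_data \<Rightarrow> nat \<Rightarrow> nat \<Rightarrow> 'a set monoid" where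
  "homology P r d = cycle_group P r d Mod boundaries P r d"

text \<open>
  The class \<open>C\<close> of a cycle \<open>z\<close> is sent to the class of \<open>f r z\<close>; for a chain map the union is over
  copies of one and the same coset.
\<close>

definition homology_map ::
  "'b::ab_group_add operad_data \<Rightarrow> (nat \<Rightarrow> 'a \<Rightarrow> 'b) \<Rightarrow> nat \<Rightarrow> nat \<Rightarrow> 'a set \<Rightarrow> 'b set" where
  "homology_map Q f r d C = (\<Union>z\<in>C. boundaries Q r d #>\<^bsub>cycle_group Q r d\<^esub> f r z)"

locale operad_quasi_isomorphism = dg_operad_morphism +
  assumes homology_iso:
    "1 \<le> r \<Longrightarrow> homology_map Q f r d \<in> iso (homology P r d) (homology Q r d)"


section \<open>Shuffles\<close>

text \<open>
  A word in \<open>True\<close> and \<open>False\<close> is unshuffled by moving all letters \<open>True\<close> before all letters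
  \<open>False\<close>, keeping the order within each type; \<open>unshuffle bs i\<close> is the new (0-based) position of
  the letter at position \<open>i\<close>.
\<close>

definition unshuffle :: "bool list \<Rightarrow> nat \<Rightarrow> nat" where
  "unshuffle bs i =
    (if i < length bs
     then if bs ! i then count_list (take i bs) True
          else count_list bs True + count_list (take i bs) False
     else i)"

definition shuffle_sign :: "bool list \<Rightarrow> int" where
  "shuffle_sign bs = sign (unshuffle bs)"


section \<open>The Barratt-Eccles operad\<close>

text \<open>
  Vertices are permutations in one-line notation, elements of \<open>permutations_of_set {1..r}\<close>; a
  simplex is the non-empty list of its vertices.  The normalized chain complex is the free abelian
  group on the non-degenerate simplices, and \<open>be_class\<close> is the class of an arbitrary simplex.  The
  empty list, which arises as the formal face of a 0-simplex, also has class \<open>0\<close>.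
\<close>

type_synonym simplex = "nat list list"

definition be_simplices :: "nat \<Rightarrow> nat \<Rightarrow> simplex set" where
  "be_simplices r d =
    {W. length W = Suc d \<and> set W \<subseteq> permutations_of_set {1..r} \<and> distinct_adj W}"

definition be_class :: "simplex \<Rightarrow> simplex \<Rightarrow>\<^sub>0 int" where
  "be_class W = (if W \<noteq> [] \<and> distinct_adj W then frag_of W else 0)"

definition delete_nth :: "nat \<Rightarrow> 'a list \<Rightarrow> 'a list" where
  "delete_nth i xs = take i xs @ drop (Suc i) xs"

definition be_bdry :: "simplex \<Rightarrow> simplex \<Rightarrow>\<^sub>0 int" where
  "be_bdry W = (\<Sum>i<length W. frag_cmul ((-1) ^ i) (be_class (delete_nth i W)))"

definition perm_comp :: "nat \<Rightarrow> nat list \<Rightarrow> nat list \<Rightarrow> nat list" where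
  "perm_comp k u v =
    concat (map (\<lambda>x. if x = k then map (\<lambda>y. y + k - 1) v
                     else if x > k then [x + length v - 1] else [x]) u)"

text \<open>
  A lattice path is given by its list of steps, \<open>True\<close> for an \<open>x\<close>-step and \<open>False\<close> for a
  \<open>y\<close>-step; after \<open>i\<close> steps it has reached the point whose coordinates are the numbers of \<open>True\<close>
  and \<open>False\<close> among the first \<open>i\<close> steps.
\<close>

definition lattice_paths :: "nat \<Rightarrow> nat \<Rightarrow> bool list set" where
  "lattice_paths d e = {p. count_list p True = d \<and> count_list p False = e}"

definition path_simplex :: "nat \<Rightarrow> simplex \<Rightarrow> simplex \<Rightarrow> bool list \<Rightarrow> simplex" where
  "path_simplex k U V p =
    map (\<lambda>i. perm_comp k (U ! count_list (take i p) True) (V ! count_list (take i p) False))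
      [0..<Suc (length p)]"

definition be_pcomp :: "nat \<Rightarrow> simplex \<Rightarrow> simplex \<Rightarrow> simplex \<Rightarrow>\<^sub>0 int" where
  "be_pcomp k U V =
    (\<Sum>p\<in>lattice_paths (length U - 1) (length V - 1).
       frag_cmul (shuffle_sign p) (be_class (path_simplex k U V p)))"

definition barratt_eccles :: "(simplex \<Rightarrow>\<^sub>0 int) operad_data" where
  "barratt_eccles =
    \<lparr>chains = \<lambda>r d. {c. Poly_Mapping.keys c \<subseteq> be_simplices r d},
     bdry = \<lambda>r. frag_extend be_bdry,
     act = \<lambda>r \<sigma>. frag_extend (\<lambda>W. be_class (map (map \<sigma>) W)),
     pcomp = \<lambda>r s k x y. frag_extend (\<lambda>U. frag_extend (\<lambda>V. be_pcomp k U V) y) x,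
     opunit = frag_of [[1]]\<rparr>"


section \<open>The surjection operad\<close>

text \<open>
  A map \<open>u : {1..m} \<rightarrow> {1..r}\<close> is the list of its values.  \<open>sj_class r u\<close> is the element it
  represents.  List positions are 0-based.
\<close>

definition surjections :: "nat \<Rightarrow> nat \<Rightarrow> nat list set" where
  "surjections r d = {u. length u = r + d \<and> set u = {1..r} \<and> distinct_adj u}"

definition sj_class :: "nat \<Rightarrow> nat list \<Rightarrow> nat list \<Rightarrow>\<^sub>0 int" where
  "sj_class r u = (if set u = {1..r} \<and> distinct_adj u then frag_of u else 0)"

definition caesura :: "nat list \<Rightarrow> nat \<Rightarrow> bool" where
  "caesura u i \<longleftrightarrow> i < length u \<and> (\<exists>j. i < j \<and> j < length u \<and> u ! j = u ! i)"

definition caesura_sign :: "nat list \<Rightarrow> nat \<Rightarrow> int" where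
  "caesura_sign u i = (-1) ^ card {j. j < i \<and> caesura u j}"

text \<open>Deleting the only occurrence of a value gives a non-surjective map, so the sign \<open>0\<close> used in
  that case is immaterial.\<close>

definition sj_sign :: "nat list \<Rightarrow> nat \<Rightarrow> int" where
  "sj_sign u i =
    (if caesura u i then caesura_sign u i
     else if \<exists>j<i. u ! j = u ! i then - caesura_sign u (Max {j. j < i \<and> u ! j = u ! i})
     else 0)"

definition sj_bdry :: "nat \<Rightarrow> nat list \<Rightarrow> nat list \<Rightarrow>\<^sub>0 int" where
  "sj_bdry r u = (\<Sum>i<length u. frag_cmul (sj_sign u i) (sj_class r (delete_nth i u)))"

text \<open>
  \<open>js = [j\<^sub>0, \<dots>, j\<^sub>n]\<close> is a sequence as in the sum defining \<open>u \<circ>\<^sub>k v\<close>, with \<open>n\<close> the number of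
  occurrences of \<open>k\<close> in \<open>u\<close>; the entries are 1-based positions in \<open>v\<close>.  Each term of the resulting
  sequence carries a flag, which for caesuras is \<open>True\<close> if the type is \<open>u\<close> and \<open>False\<close> if it is
  \<open>v\<close>.
\<close>

definition cut_sequences :: "nat \<Rightarrow> nat \<Rightarrow> nat list set" where
  "cut_sequences n m =
    {js. length js = Suc n \<and> sorted js \<and> js ! 0 = 1 \<and> js ! n = m}"

definition sj_insert :: "nat \<Rightarrow> nat \<Rightarrow> nat list \<Rightarrow> nat list \<Rightarrow> nat list \<Rightarrow> (nat \<times> bool) list" where
  "sj_insert s k u v js =
    concat (map (\<lambda>p.
      if u ! p = k
      then let m = Suc (count_list (take p u) k)
           in map (\<lambda>i. (v ! (i - 1) + k - 1, i = js ! m \<and> m < count_list u k))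
                [js ! (m - 1)..<Suc (js ! m)]
      else [(if u ! p > k then u ! p + s - 1 else u ! p, True)])
      [0..<length u])"

definition sj_pcomp :: "nat \<Rightarrow> nat \<Rightarrow> nat \<Rightarrow> nat list \<Rightarrow> nat list \<Rightarrow> nat list \<Rightarrow>\<^sub>0 int" where
  "sj_pcomp r s k u v =
    (\<Sum>js\<in>cut_sequences (count_list u k) (length v).
       let c = sj_insert s k u v js;
           w = map fst c;
           types = map (\<lambda>i. snd (c ! i)) (filter (caesura w) [0..<length c])
       in frag_cmul (shuffle_sign types) (sj_class (r + s - 1) w))"

definition surjection_operad :: "(nat list \<Rightarrow>\<^sub>0 int) operad_data" where
  "surjection_operad =
    \<lparr>chains = \<lambda>r d. {c. Poly_Mapping.keys c \<subseteq> surjections r d},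
     bdry = \<lambda>r. frag_extend (sj_bdry r),
     act = \<lambda>r \<sigma>. frag_extend (\<lambda>u. sj_class r (map \<sigma> u)),
     pcomp = \<lambda>r s k x y. frag_extend (\<lambda>u. frag_extend (\<lambda>v. sj_pcomp r s k u v) y) x,
     opunit = frag_of [1]\<rparr>"


section \<open>Table reduction\<close>

text \<open>\<open>D\<close> is the set of values appearing in a non-final position of an earlier row.\<close>

fun table_rows :: "nat set \<Rightarrow> nat list \<Rightarrow> simplex \<Rightarrow> nat list" where
  "table_rows D (l # ls) (w # ws) =
    (let row = take l (filter (\<lambda>x. x \<notin> D) w)
     in row @ table_rows (D \<union> set (butlast row)) ls ws)"
| "table_rows D _ _ = []"

definition row_lengths :: "nat \<Rightarrow> nat \<Rightarrow> nat list set" where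
  "row_lengths r d = {ls. length ls = Suc d \<and> (\<forall>l\<in>set ls. 1 \<le> l) \<and> sum_list ls = r + d}"

definition table_reduction :: "nat \<Rightarrow> (simplex \<Rightarrow>\<^sub>0 int) \<Rightarrow> (nat list \<Rightarrow>\<^sub>0 int)" where
  "table_reduction r =
    frag_extend (\<lambda>W. \<Sum>ls\<in>row_lengths r (length W - 1). sj_class r (table_rows {} ls W))"


section \<open>The filtrations\<close>

definition restrict_word :: "nat \<Rightarrow> nat \<Rightarrow> nat list \<Rightarrow> nat list" where
  "restrict_word i j = filter (\<lambda>x. x = i \<or> x = j)"

definition variations :: "'a list \<Rightarrow> nat" where
  "variations xs = card {l. Suc l < length xs \<and> xs ! l \<noteq> xs ! Suc l}"

definition be_filtration :: "enat \<Rightarrow> (simplex \<Rightarrow>\<^sub>0 int) operad_data" where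
  "be_filtration n =
    barratt_eccles\<lparr>chains := \<lambda>r d. {c. Poly_Mapping.keys c \<subseteq> {W \<in> be_simplices r d.
      \<forall>i j. 1 \<le> i \<and> i < j \<and> j \<le> r \<longrightarrow> enat (variations (map (restrict_word i j) W)) < n}}\<rparr>"

definition sj_filtration :: "enat \<Rightarrow> (nat list \<Rightarrow>\<^sub>0 int) operad_data" where
  "sj_filtration n =
    surjection_operad\<lparr>chains := \<lambda>r d. {c. Poly_Mapping.keys c \<subseteq> {u \<in> surjections r d.
      \<forall>i j. 1 \<le> i \<and> i < j \<and> j \<le> r \<longrightarrow> enat (variations (restrict_word i j u)) \<le> n}}\<rparr>"

lemma be_filtration_infinity: "be_filtration \<infinity> = barratt_eccles"
  by (simp add: be_filtration_def barratt_eccles_def)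

lemma sj_filtration_infinity: "sj_filtration \<infinity> = surjection_operad"
  by (simp add: sj_filtration_def surjection_operad_def)

end

theory Submission
  imports Defs "HOL-Library.Sublist"
begin

text \<open>
  Prepending a vertex, \<open>W \<mapsto> s # W\<close>, is a contraction of the Barratt-Eccles chains, and a chain all of
  whose simplices start with \<open>s\<close> is the cone on its own boundary.  So the Eilenberg-Zilber composite
  satisfies \<open>U \<circ>\<^sub>k V = cone (\<partial>U \<circ>\<^sub>k V \<plusminus> U \<circ>\<^sub>k \<partial>V)\<close>, which gives the Leibniz rule by induction on the
  degree, and two composites with the same first vertex agree as soon as their boundaries do, which
  gives the associativity laws without any computation with shuffles.

  Table reduction obeys a recursion that produces one letter at a time.  Its compatibility with the
  boundary and with composition follows by induction along this recursion, on formal sums of words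
  and modulo degenerate words.

  It has the section \<open>S u = cone \<sigma> (S (\<partial>u))\<close>, where \<open>\<sigma>\<close> lists the values of \<open>u\<close> in the order of
  their first occurrences.  Being onto, it carries the operad axioms over to surjections.  The section
  and a homotopy from \<open>S TR\<close> to the identity are built from cones over the first vertex; such cones do
  not increase the number of variations counted with that vertex put in front, so both preserve
  every stage of the filtrations.
\<close>

section \<open>Free abelian groups\<close>

text \<open>A cone from one fixed vertex contracts all chains, but it creates variations and so
  leaves the stages of the filtration. The vertex therefore has to depend on the generator. The
  price is that the resulting map is not a contraction of the whole complex: in positive degree the
  chain that is coned must already be a cycle, and verifying this is the content of the inductions
  for the section S and the homotopy H. The outcome is TR S = id and dH + Hd = S TR - id at every
  stage at once, so \<infinity> is not a separate case. The bounds \<open>< n\<close> on simplices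
  and \<open>\<le> n\<close> on surjections fit together because a single permutation, read as a
  word, already changes once between two letters, whereas as a single vertex it has no variation.
  The signs of the surjection operad enter only through two recursions on the first letter, one for
  the boundary and one for insertion. That the boundary squares to zero is read off from preimages
  under TR, as are the other axioms. This is possible because TR S = id is obtained before S is
  known to be a chain map.\<close>

abbreviation keys where "keys \<equiv> Poly_Mapping.keys"

definition bilin :: "('a \<Rightarrow> 'b \<Rightarrow> 'c \<Rightarrow>\<^sub>0 int) \<Rightarrow> ('a \<Rightarrow>\<^sub>0 int) \<Rightarrow> ('b \<Rightarrow>\<^sub>0 int) \<Rightarrow> 'c \<Rightarrow>\<^sub>0 int" where
  "bilin f x y = frag_extend (\<lambda>a. frag_extend (f a) y) x"

lemma frag_extend_fun_add:
  "frag_extend (\<lambda>a. f a + g a) x = frag_extend f x + frag_extend g x"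
  unfolding frag_extend_def by (simp add: frag_cmul_distrib2 sum.distrib)

lemma frag_extend_fun_cmul:
  "frag_extend (\<lambda>a. frag_cmul m (f a)) x = frag_cmul m (frag_extend f x)"
  unfolding frag_extend_def by (simp add: frag_cmul_sum mult.commute)

lemma frag_extend_fun_minus:
  "frag_extend (\<lambda>a. - f a) x = - frag_extend f x"
  using frag_extend_fun_cmul[of "-1" f x] by simp

lemma frag_extend_fun_diff:
  "frag_extend (\<lambda>a. f a - g a) x = frag_extend f x - frag_extend g x"
  using frag_extend_fun_add[of f "\<lambda>a. - g a" x] by (simp add: frag_extend_fun_minus)

lemma frag_extend_fun_zero [simp]: "frag_extend (\<lambda>a. 0) x = 0"
  by (simp add: frag_extend_def)

lemma frag_extend_extend:
  "frag_extend f (frag_extend g x) = frag_extend (\<lambda>a. frag_extend f (g a)) x"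
proof (rule frag_induction[where c = x and S = UNIV])
  show "frag_extend f (frag_extend g (a - b)) = frag_extend (\<lambda>a. frag_extend f (g a)) (a - b)"
    if "frag_extend f (frag_extend g a) = frag_extend (\<lambda>a. frag_extend f (g a)) a"
      "frag_extend f (frag_extend g b) = frag_extend (\<lambda>a. frag_extend f (g a)) b" for a b
    using that by (simp add: frag_extend_diff)
qed auto

lemma frag_extend_id [simp]: "frag_extend frag_of x = x"
  using frag_expansion[of x] by simp

lemma bilin_of [simp]: "bilin f (frag_of a) (frag_of b) = f a b"
  by (simp add: bilin_def)

lemma bilin_0_left [simp]: "bilin f 0 y = 0"
  and bilin_0_right [simp]: "bilin f x 0 = 0"
  by (simp_all add: bilin_def)

lemma bilin_add_left: "bilin f (x + x') y = bilin f x y + bilin f x' y"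
  and bilin_add_right: "bilin f x (y + y') = bilin f x y + bilin f x y'"
  and bilin_diff_left: "bilin f (x - x') y = bilin f x y - bilin f x' y"
  and bilin_diff_right: "bilin f x (y - y') = bilin f x y - bilin f x y'"
  and bilin_cmul_left: "bilin f (frag_cmul m x) y = frag_cmul m (bilin f x y)"
  and bilin_cmul_right: "bilin f x (frag_cmul m y) = frag_cmul m (bilin f x y)"
  by (simp_all add: bilin_def frag_extend_add frag_extend_diff frag_extend_minus frag_extend_cmul
      frag_extend_fun_add frag_extend_fun_diff frag_extend_fun_minus frag_extend_fun_cmul)

lemma keys_bilin: "keys (bilin f x y) \<subseteq> (\<Union>a\<in>keys x. \<Union>b\<in>keys y. keys (f a b))"
  unfolding bilin_def
  by (intro order_trans[OF keys_frag_extend] UN_mono order_refl)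

lemma bilin_cong:
  assumes "\<And>a b. a \<in> keys x \<Longrightarrow> b \<in> keys y \<Longrightarrow> f a b = g a b"
  shows "bilin f x y = bilin g x y"
  unfolding bilin_def by (intro frag_extend_eq) (simp add: assms)

lemma bilin_extend_left: "bilin f (frag_extend g x) y = bilin (\<lambda>a b. bilin f (g a) (frag_of b)) x y"
proof (rule frag_induction[where c = x and S = UNIV])
  fix a show "bilin f (frag_extend g (frag_of a)) y = bilin (\<lambda>a b. bilin f (g a) (frag_of b)) (frag_of a) y"
  proof (rule frag_induction[where c = y and S = UNIV])
    show "bilin f (frag_extend g (frag_of a)) (b - c) = bilin (\<lambda>a b. bilin f (g a) (frag_of b)) (frag_of a) (b - c)"
      if "bilin f (frag_extend g (frag_of a)) b = bilin (\<lambda>a b. bilin f (g a) (frag_of b)) (frag_of a) b"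
        "bilin f (frag_extend g (frag_of a)) c = bilin (\<lambda>a b. bilin f (g a) (frag_of b)) (frag_of a) c"
      for b c using that by (simp add: bilin_diff_right)
  qed auto
next
  show "bilin f (frag_extend g (a - b)) y = bilin (\<lambda>a b. bilin f (g a) (frag_of b)) (a - b) y"
    if "bilin f (frag_extend g a) y = bilin (\<lambda>a b. bilin f (g a) (frag_of b)) a y"
      "bilin f (frag_extend g b) y = bilin (\<lambda>a b. bilin f (g a) (frag_of b)) b y"
    for a b using that by (simp add: bilin_diff_left frag_extend_diff)
qed auto

lemma bilin_extend_right: "bilin f x (frag_extend g y) = bilin (\<lambda>a b. frag_extend (f a) (g b)) x y"
  by (simp add: bilin_def frag_extend_extend)

lemma extend_bilin: "frag_extend h (bilin f x y) = bilin (\<lambda>a b. frag_extend h (f a b)) x y"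
  by (simp add: bilin_def frag_extend_extend)

text \<open>\<open>frag_induction\<close> builds \<open>x\<close> from generators by differences, so
  compatibility with differences is all that is asked of \<open>F\<close> and \<open>G\<close>.
  Agreement is tested on generators in \<open>keys x\<close> only; a condition on a chain thereby
  becomes a condition on single simplices or words.\<close>

lemma linear_eq_on_keys:
  assumes "\<And>a. a \<in> keys x \<Longrightarrow> F (frag_of a) = G (frag_of a)"
    and "\<And>a b. F (a - b) = F a - F b" "\<And>a b. G (a - b) = G a - G b"
  shows "F x = (G x :: 'b::ab_group_add)"
proof -
  have "F 0 = 0"
    using assms(2)[of 0 0] by (metis diff_self)
  have "G 0 = 0"
    using assms(3)[of 0 0] by (metis diff_self)
  show ?thesis
  proof (rule frag_induction[where c = x and S = "keys x"])
    show "F (a - b) = G (a - b)" if "F a = G a" "F b = G b" for a b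
      unfolding assms(2,3) that ..
    show "F 0 = G 0"
      unfolding \<open>F 0 = 0\<close> \<open>G 0 = 0\<close> ..
    show "F (frag_of a) = G (frag_of a)" if "a \<in> keys x" for a
      by (rule assms(1)[OF that])
  qed (rule subset_refl)
qed

lemma keys_extend_subset:
  assumes "\<And>a. a \<in> keys x \<Longrightarrow> keys (f a) \<subseteq> S"
  shows "keys (frag_extend f x) \<subseteq> S"
  using keys_frag_extend[of f x] assms by blast

lemma keys_add_subset: "keys x \<subseteq> S \<Longrightarrow> keys y \<subseteq> S \<Longrightarrow> keys (x + y) \<subseteq> S"
  using keys_add[of x y] by blast

lemma keys_diff_subset: "keys x \<subseteq> S \<Longrightarrow> keys y \<subseteq> S \<Longrightarrow> keys (x - y) \<subseteq> S"
  using keys_diff[of x y] by blast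

lemma keys_sum_subset: "(\<And>i. i \<in> I \<Longrightarrow> keys (f i) \<subseteq> S) \<Longrightarrow> keys (\<Sum>i\<in>I. f i) \<subseteq> S"
proof (induction I rule: infinite_finite_induct)
  case (insert i I)
  then show ?case by (simp add: keys_add_subset)
qed auto

lemma keys_of_subset: "keys (frag_of a) \<subseteq> S \<longleftrightarrow> a \<in> S"
  by simp

lemma keys_cmul_subset: "keys x \<subseteq> S \<Longrightarrow> keys (frag_cmul m x) \<subseteq> S"
  by auto

lemma signed_cmul: "signed m x = frag_cmul ((-1) ^ m) x"
  by (simp add: signed_def uminus_power_if)

section \<open>Shuffles\<close>

text \<open>The permutation \<open>f\<close> moved up by one position, with 0 fixed: what one more
  letter in front does to an unshuffling.\<close>

definition lift_fun :: "(nat \<Rightarrow> nat) \<Rightarrow> nat \<Rightarrow> nat" where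
  "lift_fun f i = (case i of 0 \<Rightarrow> 0 | Suc j \<Rightarrow> Suc (f j))"

lemma lift_fun_transpose: "lift_fun (transpose a b) = transpose (Suc a) (Suc b)"
  by (auto simp: fun_eq_iff lift_fun_def transpose_def split: nat.splits)

lemma lift_fun_comp: "lift_fun (f \<circ> g) = lift_fun f \<circ> lift_fun g"
  by (auto simp: fun_eq_iff lift_fun_def split: nat.splits)

lemma lift_fun_id: "lift_fun id = id"
  by (auto simp: fun_eq_iff lift_fun_def split: nat.splits)

lemma swapidseq_lift_fun: "swapidseq n f \<Longrightarrow> swapidseq n (lift_fun f)"
proof (induction rule: swapidseq.induct)
  case id
  show ?case unfolding lift_fun_id by (rule swapidseq.id)
next
  case (comp_Suc n p a b)
  then show ?case
    unfolding lift_fun_comp lift_fun_transpose by (intro swapidseq.comp_Suc) auto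
qed

lemma permutation_lift_fun: "permutation f \<Longrightarrow> permutation (lift_fun f)"
  unfolding permutation_def using swapidseq_lift_fun by blast

lemma sign_lift_fun:
  assumes "permutation f" shows "sign (lift_fun f) = sign f"
proof -
  obtain n where n: "swapidseq n f"
    using assms unfolding permutation_def by blast
  show ?thesis
    using evenperm_unique[OF n refl] evenperm_unique[OF swapidseq_lift_fun[OF n] refl]
    by (simp add: sign_def)
qed

text \<open>The cycle that moves position 0 to \<open>m\<close> and closes the gap, a product of
  \<open>m\<close> adjacent transpositions. It carries a leading \<open>False\<close> past
  \<open>m\<close> letters \<open>True\<close>.\<close>

definition rot :: "nat \<Rightarrow> nat \<Rightarrow> nat" where
  "rot m i = (if i = 0 then m else if i \<le> m then i - 1 else i)"

lemma rot_Suc: "rot (Suc m) = transpose m (Suc m) \<circ> rot m"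
  by (auto simp: fun_eq_iff rot_def transpose_def)

lemma swapidseq_rot: "swapidseq m (rot m)"
proof (induction m)
  case 0
  have "rot 0 = id" by (auto simp: rot_def)
  then show ?case by simp
next
  case (Suc m)
  then show ?case unfolding rot_Suc by (intro swapidseq.comp_Suc) auto
qed

lemma permutation_rot: "permutation (rot m)"
  unfolding permutation_def using swapidseq_rot by blast

lemma sign_rot: "sign (rot m) = (-1) ^ m"
  using evenperm_unique[OF swapidseq_rot refl, of m] by (simp add: sign_def uminus_power_if)

lemma unshuffle_True: "unshuffle (True # p) = lift_fun (unshuffle p)"
  by (auto simp: fun_eq_iff unshuffle_def lift_fun_def split: nat.splits)

lemma unshuffle_False: "unshuffle (False # p) = rot (count_list p True) \<circ> lift_fun (unshuffle p)"
proof
  fix i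
  \<comment> \<open>A \<open>True\<close> of \<open>p\<close> lands among the first
    \<open>count_list p True\<close> positions, so \<open>rot\<close> lowers its lifted position by
    one again; a \<open>False\<close> lies beyond them and is left alone by
    \<open>rot\<close>.\<close>
  have le: "count_list (take j p) True < count_list p True" if "j < length p" "p ! j" for j
  proof -
    have "count_list p True = count_list (take j p) True + count_list (drop j p) True"
      by (metis append_take_drop_id count_list_append)
    moreover have "count_list (drop j p) True > 0"
      using that by (simp add: Cons_nth_drop_Suc[symmetric])
    ultimately show ?thesis by simp
  qed
  have len: "count_list p True \<le> length p" by (rule count_le_length)
  show "unshuffle (False # p) i = (rot (count_list p True) \<circ> lift_fun (unshuffle p)) i"
  proof (cases i)
    case 0 then show ?thesis by (simp add: unshuffle_def lift_fun_def rot_def)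
  next
    case (Suc j)
    then show ?thesis using le[of j] len
      by (auto simp: unshuffle_def lift_fun_def rot_def)
  qed
qed

lemma permutation_unshuffle: "permutation (unshuffle p)"
proof (induction p)
  case Nil
  have "unshuffle [] = id" by (auto simp: unshuffle_def)
  then show ?case by simp
next
  case (Cons b p)
  then show ?case
    by (cases b) (simp_all add: unshuffle_True unshuffle_False permutation_compose
        permutation_rot permutation_lift_fun del: o_apply)
qed

lemma shuffle_sign_Nil [simp]: "shuffle_sign [] = 1"
proof -
  have "unshuffle [] = id" by (auto simp: unshuffle_def)
  then show ?thesis by (simp add: shuffle_sign_def)
qed

lemma shuffle_sign_True [simp]: "shuffle_sign (True # p) = shuffle_sign p"
  by (simp add: shuffle_sign_def unshuffle_True sign_lift_fun permutation_unshuffle)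

lemma shuffle_sign_False [simp]:
  "shuffle_sign (False # p) = (-1) ^ count_list p True * shuffle_sign p"
  by (simp add: shuffle_sign_def unshuffle_False sign_lift_fun permutation_unshuffle
      sign_compose permutation_rot permutation_lift_fun sign_rot)

section \<open>Cones on normalized chains\<close>

definition nd_simplices :: "nat \<Rightarrow> 'a list set" where
  "nd_simplices d = {W. length W = Suc d \<and> distinct_adj W}"

definition cone :: "nat list \<Rightarrow> (simplex \<Rightarrow>\<^sub>0 int) \<Rightarrow> simplex \<Rightarrow>\<^sub>0 int" where
  "cone s = frag_extend (\<lambda>W. be_class (s # W))"

text \<open>The augmentation followed by the inclusion of the vertex \<open>s\<close>. It is the
  defect of \<open>cone s\<close> as a contraction and lives in degree 0 only.\<close>

definition aug :: "nat list \<Rightarrow> (simplex \<Rightarrow>\<^sub>0 int) \<Rightarrow> simplex \<Rightarrow>\<^sub>0 int" where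
  "aug s = frag_extend (\<lambda>W. if length W = 1 then frag_of [s] else 0)"

lemma delete_nth_0 [simp]: "delete_nth 0 (a # xs) = xs"
  and delete_nth_Suc [simp]: "delete_nth (Suc i) (a # xs) = a # delete_nth i xs"
  by (simp_all add: delete_nth_def)

lemma length_delete_nth [simp]: "i < length xs \<Longrightarrow> length (delete_nth i xs) = length xs - 1"
  by (simp add: delete_nth_def)

lemma set_delete_nth: "set (delete_nth i xs) \<subseteq> set xs"
  unfolding delete_nth_def using set_take_subset[of i xs] set_drop_subset[of "Suc i" xs] by auto

lemma map_delete_nth: "map f (delete_nth i xs) = delete_nth i (map f xs)"
  by (simp add: delete_nth_def take_map drop_map)

lemma be_class_Nil [simp]: "be_class [] = 0"
  by (simp add: be_class_def)

lemma be_class_singleton [simp]: "be_class [w] = frag_of [w]"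
  by (simp add: be_class_def)

lemma be_class_nd: "W \<in> nd_simplices d \<Longrightarrow> be_class W = frag_of W"
  by (auto simp: be_class_def nd_simplices_def)

lemma keys_be_class: "keys (be_class W) \<subseteq> {W' . W' = W \<and> W \<noteq> [] \<and> distinct_adj W}"
  by (auto simp: be_class_def)

lemma cone_class: "W \<noteq> [] \<Longrightarrow> cone s (be_class W) = be_class (s # W)"
  by (auto simp: cone_def be_class_def dest: distinct_adj_ConsD)

lemma cone_0 [simp]: "cone s 0 = 0"
  and cone_add: "cone s (x + y) = cone s x + cone s y"
  and cone_diff: "cone s (x - y) = cone s x - cone s y"
  and cone_cmul: "cone s (frag_cmul m x) = frag_cmul m (cone s x)"
  and cone_sum: "finite I \<Longrightarrow> cone s (sum f I) = (\<Sum>i\<in>I. cone s (f i))"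
  by (simp_all add: cone_def frag_extend_add frag_extend_diff frag_extend_cmul frag_extend_sum o_def)

lemma be_class_double [simp]: "be_class (s # s # W) = 0"
  by (simp add: be_class_def)

lemma cone_class_headed: "cone s (be_class (s # W)) = 0"
  by (simp add: cone_class)

lemma cone_cone: "cone s (cone s x) = 0"
  unfolding cone_def frag_extend_extend cone_class_headed[unfolded cone_def] by simp

lemma be_bdry_Cons_sum:
  "be_bdry (s # W) = be_class W
    - (\<Sum>i<length W. frag_cmul ((-1) ^ i) (be_class (s # delete_nth i W)))"
  unfolding be_bdry_def
  by (simp add: sum.lessThan_Suc_shift sum_negf[symmetric] del: sum.lessThan_Suc)

lemma be_bdry_Nil [simp]: "be_bdry [] = 0"
  by (simp add: be_bdry_def)

lemma be_bdry_singleton [simp]: "be_bdry [w] = 0"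
  by (simp add: be_bdry_def)

lemma be_bdry_pair: "be_bdry [s, w] = frag_of [w] - frag_of [s]"
  by (simp add: be_bdry_Cons_sum)

text \<open>For a single vertex \<open>W\<close> the formula would fail: its face is the empty list,
  of class 0, so the cone on the boundary misses the face \<open>[s]\<close>. This missing face is
  the origin of \<open>aug\<close>.\<close>

lemma be_bdry_Cons:
  assumes "length W \<ge> 2"
  shows "be_bdry (s # W) = be_class W - cone s (be_bdry W)"
proof -
  have "cone s (be_class (delete_nth i W)) = be_class (s # delete_nth i W)" if "i < length W" for i
    using assms length_delete_nth[OF that] by (intro cone_class) (auto simp del: length_delete_nth)
  then show ?thesis
    unfolding be_bdry_Cons_sum by (simp add: be_bdry_def cone_sum cone_cmul)
qed

text \<open>The two faces that delete one of two equal neighbours cancel, and every other face is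
  still degenerate. This makes \<open>be_bdry\<close> well defined on the normalized
  complex.\<close>

lemma be_bdry_degenerate: "\<not> distinct_adj W \<Longrightarrow> be_bdry W = 0"
proof (induction W)
  case (Cons s W)
  show ?case
  proof (cases "length W \<ge> 2")
    case False
    with Cons.prems obtain w where "W = [w]"
      by (cases W; cases "tl W") (auto simp: distinct_adj_Cons)
    with Cons.prems show ?thesis by (simp add: be_bdry_pair)
  next
    case True
    show ?thesis
    proof (cases "distinct_adj W")
      case False
      with Cons.IH True show ?thesis by (simp add: be_bdry_Cons be_class_def)
    next
      case nd: True
      with Cons.prems True obtain W' where W: "W = s # W'"
        by (cases W) auto
      with True have "W' \<noteq> []" by auto
      \<comment> \<open>All faces of \<open>s # W'\<close> except \<open>W'\<close> still begin with
        \<open>s\<close> and are killed by \<open>cone s\<close>.\<close>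
      then have "cone s (be_bdry W) = be_class W"
        unfolding W be_bdry_Cons_sum
        by (simp add: cone_diff cone_sum cone_cmul cone_class)
      with True show ?thesis by (simp add: be_bdry_Cons)
    qed
  qed
qed simp

lemma bd_class: "frag_extend be_bdry (be_class W) = be_bdry W"
  by (auto simp: be_class_def be_bdry_degenerate)

lemma keys_be_bdry: "W \<in> nd_simplices (Suc d) \<Longrightarrow> keys (be_bdry W) \<subseteq> nd_simplices d"
  unfolding be_bdry_def
  by (intro keys_sum_subset keys_cmul_subset)
     (auto simp: be_class_def nd_simplices_def)

lemma keys_bd:
  "keys c \<subseteq> nd_simplices (Suc d) \<Longrightarrow> keys (frag_extend be_bdry c) \<subseteq> nd_simplices d"
  by (intro keys_extend_subset keys_be_bdry) auto

lemma bd_degree_0: "keys c \<subseteq> nd_simplices 0 \<Longrightarrow> frag_extend be_bdry c = 0"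
proof (rule frag_extend_eq_0)
  fix W assume "keys c \<subseteq> nd_simplices 0" "W \<in> keys c"
  then have "length W = 1" by (auto simp: nd_simplices_def)
  then show "be_bdry W = 0" by (cases W) auto
qed

lemma homotopy_basis:
  assumes "W \<in> nd_simplices d"
  shows "frag_extend be_bdry (be_class (s # W)) + cone s (be_bdry W)
    = frag_of W - aug s (frag_of W)"
proof (cases d)
  case 0
  with assms obtain w where "W = [w]"
    by (cases W) (auto simp: nd_simplices_def)
  then show ?thesis by (simp add: bd_class be_bdry_pair aug_def)
next
  case (Suc d')
  then have "length W \<ge> 2" "length W \<noteq> 1" using assms by (auto simp: nd_simplices_def)
  then show ?thesis
    by (simp add: bd_class be_bdry_Cons be_class_nd[OF assms] aug_def)
qed

text \<open>The contraction identity, solved for the boundary of the cone. For a cycle on which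
  \<open>aug\<close> vanishes it says that the cone bounds exactly that cycle; the Leibniz rule, the
  section and the homotopy are all obtained from it in this form.\<close>

lemma homotopy:
  assumes "keys c \<subseteq> nd_simplices d"
  shows "frag_extend be_bdry (cone s c) = c - aug s c - cone s (frag_extend be_bdry c)"
proof -
  have "frag_extend be_bdry (cone s c) + cone s (frag_extend be_bdry c) = c - aug s c"
  proof (rule linear_eq_on_keys[where x = c])
    show "frag_extend be_bdry (cone s (frag_of W)) + cone s (frag_extend be_bdry (frag_of W))
        = frag_of W - aug s (frag_of W)" if "W \<in> keys c" for W
      using homotopy_basis[of W d s] that assms by (auto simp: cone_def)
  qed (simp_all add: cone_diff frag_extend_diff aug_def)
  then show ?thesis by (simp add: algebra_simps)
qed

lemma aug_degree_pos: "keys c \<subseteq> nd_simplices (Suc d) \<Longrightarrow> aug s c = 0"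
  unfolding aug_def by (rule frag_extend_eq_0) (auto simp: nd_simplices_def)

text \<open>Writing the boundary of \<open>s # W\<close> as \<open>W\<close> minus a cone and
  applying \<open>homotopy\<close> to that cone reduces the claim to \<open>W\<close>, provided
  \<open>aug\<close> vanishes on the boundary of \<open>W\<close>. That needs checking only for an
  edge, whose boundary is a difference of two vertices.\<close>

lemma bd_bd_basis: "frag_extend be_bdry (be_bdry W) = 0"
proof (induction W)
  case (Cons s W)
  consider "W = []" | w where "W = [w]" | "length W \<ge> 2"
    by (cases W; cases "tl W") auto
  then show ?case
  proof cases
    case 3
    then obtain d where d: "length W = Suc (Suc d)"
      by (metis Suc_le_D Suc_le_mono numeral_2_eq_2)
    show ?thesis
    proof (cases "distinct_adj W")
      case True
      then have k: "keys (be_bdry W) \<subseteq> nd_simplices d"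
        using d by (intro keys_be_bdry) (auto simp: nd_simplices_def)
      have "aug s (be_bdry W) = 0"
      proof (cases d)
        case 0
        then obtain a b where "W = [a, b]"
          using d by (cases W; cases "tl W") auto
        then show ?thesis by (simp add: be_bdry_pair aug_def frag_extend_diff)
      qed (use k aug_degree_pos in auto)
      then show ?thesis
        using 3 by (simp add: be_bdry_Cons frag_extend_diff bd_class homotopy[OF k] Cons.IH)
    next
      case False
      then show ?thesis using 3 by (simp add: be_bdry_Cons be_bdry_degenerate be_class_def)
    qed
  qed (auto simp: be_bdry_pair frag_extend_diff)
qed simp

lemma bd_bd: "frag_extend be_bdry (frag_extend be_bdry c) = 0"
  by (simp add: frag_extend_extend bd_bd_basis)

text \<open>\<open>cone s x\<close> vanishes when all simplices of \<open>x\<close> start with \<open>s\<close>, and then \<open>x\<close> is the cone on its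
  boundary.\<close>

lemma headed_eqI:
  assumes "keys x \<subseteq> nd_simplices (Suc d)" "keys y \<subseteq> nd_simplices (Suc d)"
    and "cone s x = 0" "cone s y = 0"
    and "frag_extend be_bdry x = frag_extend be_bdry y"
  shows "x = y"
  using homotopy[OF assms(1), of s] homotopy[OF assms(2), of s] assms
  by (simp add: aug_degree_pos)

section \<open>Lattice paths\<close>

definition gpath :: "('a \<Rightarrow> 'b \<Rightarrow> 'c) \<Rightarrow> 'a list \<Rightarrow> 'b list \<Rightarrow> bool list \<Rightarrow> 'c list" where
  "gpath f U V p =
    map (\<lambda>i. f (U ! count_list (take i p) True) (V ! count_list (take i p) False))
      [0..<Suc (length p)]"

definition path_sum ::
  "('a \<Rightarrow> 'b \<Rightarrow> 'c) \<Rightarrow> ('c list \<Rightarrow> 'd \<Rightarrow>\<^sub>0 int) \<Rightarrow> 'a list \<Rightarrow> 'b list \<Rightarrow> 'd \<Rightarrow>\<^sub>0 int" where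
  "path_sum f F U V = (if U = [] \<or> V = [] then 0 else
    (\<Sum>p\<in>lattice_paths (length U - 1) (length V - 1).
       frag_cmul (shuffle_sign p) (F (gpath f U V p))))"

lemma path_simplex_gpath: "path_simplex k U V p = gpath (perm_comp k) U V p"
  by (simp add: path_simplex_def gpath_def)

lemma be_pcomp_path_sum:
  "U \<noteq> [] \<Longrightarrow> V \<noteq> [] \<Longrightarrow> be_pcomp k U V = path_sum (perm_comp k) be_class U V"
  by (simp add: be_pcomp_def path_sum_def path_simplex_gpath)

lemma gpath_True: "gpath f (u # U) (v # V) (True # p) = f u v # gpath f U (v # V) p"
  unfolding gpath_def
  by (subst upt_conv_Cons) (simp_all add: map_Suc_upt[symmetric] del: upt_Suc)

lemma gpath_False: "gpath f (u # U) (v # V) (False # p) = f u v # gpath f (u # U) V p"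
  unfolding gpath_def
  by (subst upt_conv_Cons) (simp_all add: map_Suc_upt[symmetric] del: upt_Suc)

lemma gpath_Nil [simp]: "gpath f (u # U) (v # V) [] = [f u v]"
  by (simp add: gpath_def)

lemma length_gpath [simp]: "length (gpath f U V p) = Suc (length p)"
  by (simp add: gpath_def)

lemma gpath_nonempty [simp]: "gpath f U V p \<noteq> []"
  by (metis length_gpath list.size(3) nat.distinct(1))

lemma length_lattice_path: "p \<in> lattice_paths d e \<Longrightarrow> length p = d + e"
proof (induction p arbitrary: d e)
  case (Cons b p)
  then show ?case
    by (cases b; cases d; cases e) (auto simp: lattice_paths_def)
qed (auto simp: lattice_paths_def)

lemma finite_lattice_paths [simp]: "finite (lattice_paths d e)"
proof (rule finite_subset)
  show "lattice_paths d e \<subseteq> {p. set p \<subseteq> UNIV \<and> length p = d + e}"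
    using length_lattice_path by auto
  show "finite {p. set p \<subseteq> (UNIV :: bool set) \<and> length p = d + e}"
    by (rule finite_lists_length_eq) simp
qed

lemma lattice_paths_0_0: "lattice_paths 0 0 = {[]}"
  using length_lattice_path[of _ 0 0] by (auto simp: lattice_paths_def)

lemma lattice_paths_split:
  "d + e > 0 \<Longrightarrow> lattice_paths d e =
    (if d = 0 then {} else (#) True ` lattice_paths (d - 1) e)
    \<union> (if e = 0 then {} else (#) False ` lattice_paths d (e - 1))"
  (is "_ \<Longrightarrow> ?L = ?R")
proof
  assume de: "d + e > 0"
  show "?L \<subseteq> ?R"
  proof
    fix p assume p: "p \<in> ?L"
    with de obtain b q where "p = b # q" by (cases p) (auto simp: lattice_paths_def)
    with p show "p \<in> ?R" by (cases b) (auto simp: lattice_paths_def)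
  qed
  show "?R \<subseteq> ?L" by (auto simp: lattice_paths_def)
qed

text \<open>Split by the first step. A leading y-step has to be moved past all
  \<open>length U\<close> x-steps, whence the sign. The first vertex is absorbed into the evaluation
  \<open>F\<close>.\<close>

lemma path_sum_Cons:
  "path_sum f F (u # U) (v # V) =
    (if U = [] \<and> V = [] then F [f u v]
     else path_sum f (\<lambda>X. F (f u v # X)) U (v # V)
       + frag_cmul ((-1) ^ length U) (path_sum f (\<lambda>X. F (f u v # X)) (u # U) V))"
proof -
  have T: "(\<Sum>p\<in>(#) True ` lattice_paths d e. frag_cmul (shuffle_sign p) (F (gpath f (u # U) (v # V) p)))
     = (\<Sum>p\<in>lattice_paths d e. frag_cmul (shuffle_sign p) (F (f u v # gpath f U (v # V) p)))" for d e
    by (subst sum.reindex) (simp_all add: gpath_True)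
  have S: "(\<Sum>p\<in>(#) False ` lattice_paths d e. frag_cmul (shuffle_sign p) (F (gpath f (u # U) (v # V) p)))
     = frag_cmul ((-1) ^ d) (\<Sum>p\<in>lattice_paths d e. frag_cmul (shuffle_sign p) (F (f u v # gpath f (u # U) V p)))" for d e
    by (subst sum.reindex) (auto simp: gpath_False frag_cmul_sum lattice_paths_def intro!: sum.cong)
  show ?thesis
  proof (cases U)
    case U: Nil
    show ?thesis
    proof (cases V)
      case Nil
      then show ?thesis using U by (simp add: path_sum_def lattice_paths_0_0)
    next
      case (Cons v' V')
      then show ?thesis using U S[of 0 "length V'"]
        by (simp add: path_sum_def lattice_paths_split)
    qed
  next
    case U: (Cons u' U')
    show ?thesis
    proof (cases V)
      case Nil
      then show ?thesis using U T[of "length U'" 0]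
        by (simp add: path_sum_def lattice_paths_split)
    next
      case (Cons v' V')
      have "(#) True ` lattice_paths (length U') (Suc (length V')) \<inter>
          (#) False ` lattice_paths (Suc (length U')) (length V') = {}" by auto
      then show ?thesis using U Cons T[of "length U'" "Suc (length V')"] S[of "Suc (length U')" "length V'"]
        by (simp add: path_sum_def lattice_paths_split[of "Suc (length U')" "Suc (length V')"] sum.union_disjoint)
    qed
  qed
qed

lemma path_sum_Nil [simp]: "path_sum f F [] V = 0" "path_sum f F U [] = 0"
  by (simp_all add: path_sum_def)

lemma path_sum_linear:
  assumes "\<And>x y. L (x + y) = L x + L y" "\<And>m x. L (frag_cmul m x) = frag_cmul m (L x)"
  shows "L (path_sum f F U V) = path_sum f (\<lambda>X. L (F X)) U V"
proof -
  have "L 0 = 0" using assms(2)[of 0 0] by simp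
  moreover have "L (sum g I) = (\<Sum>i\<in>I. L (g i))" if "finite I" for g :: "bool list \<Rightarrow> _" and I
    using that \<open>L 0 = 0\<close> by induction (simp_all add: assms)
  ultimately show ?thesis by (auto simp: path_sum_def assms(2))
qed

lemma path_sum_cong:
  assumes "\<And>X. X \<noteq> [] \<Longrightarrow> F X = G X"
  shows "path_sum f F U V = path_sum f G U V"
  unfolding path_sum_def by (simp add: assms)

section \<open>The Eilenberg-Zilber composite\<close>

definition ez :: "nat \<Rightarrow> (simplex \<Rightarrow>\<^sub>0 int) \<Rightarrow> (simplex \<Rightarrow>\<^sub>0 int) \<Rightarrow> simplex \<Rightarrow>\<^sub>0 int" where
  "ez k = bilin (be_pcomp k)"

text \<open>All lattice paths leave from the same vertex, so the whole composite is a cone from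
  it.\<close>

lemma be_pcomp_rec:
  assumes "us \<noteq> [] \<or> vs \<noteq> []"
  shows "be_pcomp k (u # us) (v # vs) = cone (perm_comp k u v)
    (path_sum (perm_comp k) be_class us (v # vs)
     + frag_cmul ((-1) ^ length us) (path_sum (perm_comp k) be_class (u # us) vs))"
proof -
  have "path_sum (perm_comp k) (\<lambda>X. be_class (s # X)) U V = cone s (path_sum (perm_comp k) be_class U V)"
    for s U V
    unfolding path_sum_linear[of "cone s", OF cone_add cone_cmul]
    by (intro path_sum_cong) (simp add: cone_class)
  then show ?thesis
    using assms by (auto simp: be_pcomp_path_sum path_sum_Cons cone_add cone_cmul)
qed

lemma be_pcomp_degree_0: "be_pcomp k [u] [v] = frag_of [perm_comp k u v]"
  by (simp add: be_pcomp_path_sum path_sum_Cons)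

lemma be_pcomp_headed: "cone (perm_comp k u v) (be_pcomp k (u # us) (v # vs)) = 0"
proof (cases "us = [] \<and> vs = []")
  case True
  then show ?thesis by (simp add: be_pcomp_degree_0 cone_def)
next
  case False
  then show ?thesis by (simp add: be_pcomp_rec cone_cone)
qed

lemma keys_be_pcomp:
  assumes "U \<in> nd_simplices d" "V \<in> nd_simplices e"
  shows "keys (be_pcomp k U V) \<subseteq> nd_simplices (d + e)"
  unfolding be_pcomp_def
  using assms
  by (intro keys_sum_subset keys_cmul_subset)
     (auto simp: be_class_def nd_simplices_def path_simplex_gpath length_lattice_path split: if_splits)

lemma keys_ez:
  assumes "keys x \<subseteq> nd_simplices d" "keys y \<subseteq> nd_simplices e"
  shows "keys (ez k x y) \<subseteq> nd_simplices (d + e)"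
  unfolding ez_def
  by (rule order_trans[OF keys_bilin]) (use assms keys_be_pcomp in blast)

lemma nd_simplices_Cons: "us \<noteq> [] \<Longrightarrow> u # us \<in> nd_simplices d \<Longrightarrow> us \<in> nd_simplices (d - 1)"
  by (auto simp: nd_simplices_def dest: distinct_adj_ConsD)

text \<open>Every face of \<open>u # us\<close> other than \<open>us\<close> keeps the first vertex
  \<open>u\<close>, so its composite starts with \<open>perm_comp k u v\<close> and is killed by the
  cone. In \<open>be_pcomp_rec\<close> the tail \<open>us\<close> may therefore be replaced by the
  full boundary.\<close>

lemma cone_ez_bdry_left:
  assumes "u # us \<in> nd_simplices d"
  shows "cone (perm_comp k u v) (ez k (be_bdry (u # us)) (frag_of (v # vs)))
    = cone (perm_comp k u v) (path_sum (perm_comp k) be_class us (v # vs))"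
proof (cases "us = []")
  case False
  have *: "cone (perm_comp k u v) (ez k (be_class (u # X)) (frag_of (v # vs))) = 0" for X
    by (simp add: be_class_def ez_def be_pcomp_headed)
  have "cone (perm_comp k u v) (ez k (\<Sum>i\<in>I. frag_cmul (c i) (be_class (u # D i))) (frag_of (v # vs))) = 0"
    if "finite I" for c D and I :: "nat set"
    using that * by induction (simp_all add: ez_def bilin_add_left bilin_cmul_left cone_add cone_cmul)
  then show ?thesis
    using False assms be_class_nd[OF nd_simplices_Cons[OF False assms]]
    by (simp add: be_bdry_Cons_sum ez_def bilin_diff_left cone_diff be_pcomp_path_sum)
qed (simp add: ez_def)

lemma cone_ez_bdry_right:
  assumes "v # vs \<in> nd_simplices e"
  shows "cone (perm_comp k u v) (ez k (frag_of (u # us)) (be_bdry (v # vs)))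
    = cone (perm_comp k u v) (path_sum (perm_comp k) be_class (u # us) vs)"
proof (cases "vs = []")
  case False
  have *: "cone (perm_comp k u v) (ez k (frag_of (u # us)) (be_class (v # X))) = 0" for X
    by (simp add: be_class_def ez_def be_pcomp_headed)
  have "cone (perm_comp k u v) (ez k (frag_of (u # us)) (\<Sum>i\<in>I. frag_cmul (c i) (be_class (v # D i)))) = 0"
    if "finite I" for c D and I :: "nat set"
    using that * by induction (simp_all add: ez_def bilin_add_right bilin_cmul_right cone_add cone_cmul)
  then show ?thesis
    using False assms be_class_nd[OF nd_simplices_Cons[OF False assms]]
    by (simp add: be_bdry_Cons_sum ez_def bilin_diff_right cone_diff be_pcomp_path_sum)
qed (simp add: ez_def)

lemma frag_cmul_diff_right: "frag_cmul m (a - b) = frag_cmul m a - frag_cmul m b"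
  by (rule poly_mapping_eqI) (simp add: lookup_minus right_diff_distrib)

lemma leibniz_linear:
  assumes "\<And>U V. U \<in> keys x \<Longrightarrow> V \<in> keys y \<Longrightarrow>
      frag_extend be_bdry (be_pcomp k U V)
        = ez k (be_bdry U) (frag_of V) + frag_cmul ((-1) ^ d) (ez k (frag_of U) (be_bdry V))"
  shows "frag_extend be_bdry (ez k x y)
    = ez k (frag_extend be_bdry x) y + frag_cmul ((-1) ^ d) (ez k x (frag_extend be_bdry y))"
proof (rule linear_eq_on_keys[where x = x])
  fix U assume U: "U \<in> keys x"
  show "frag_extend be_bdry (ez k (frag_of U) y) = ez k (frag_extend be_bdry (frag_of U)) y
      + frag_cmul ((-1) ^ d) (ez k (frag_of U) (frag_extend be_bdry y))"
  proof (rule linear_eq_on_keys[where x = y])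
    fix V assume "V \<in> keys y"
    with assms[OF U this] show "frag_extend be_bdry (ez k (frag_of U) (frag_of V)) =
        ez k (frag_extend be_bdry (frag_of U)) (frag_of V)
        + frag_cmul ((-1) ^ d) (ez k (frag_of U) (frag_extend be_bdry (frag_of V)))"
      by (simp add: ez_def)
  qed (simp_all add: ez_def bilin_diff_right frag_extend_diff frag_cmul_diff_right)
qed (simp_all add: ez_def bilin_diff_left frag_extend_diff frag_cmul_diff_right)

lemma aug_degree_1:
  assumes "U \<in> nd_simplices d" "V \<in> nd_simplices e" "d + e = 1"
  shows "aug s (ez k (be_bdry U) (frag_of V) + frag_cmul ((-1) ^ d) (ez k (frag_of U) (be_bdry V))) = 0"
proof (cases "d = 0")
  case True
  with assms obtain u a b where "U = [u]" "V = [a, b]"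
    by (cases U; cases V; cases "tl V") (auto simp: nd_simplices_def)
  then show ?thesis using True
    by (simp add: be_bdry_pair ez_def bilin_diff_right be_pcomp_degree_0 aug_def frag_extend_diff)
next
  case False
  with assms obtain v a b where "V = [v]" "U = [a, b]"
    by (cases V; cases U; cases "tl U") (auto simp: nd_simplices_def)
  then show ?thesis
    by (simp add: be_bdry_pair ez_def bilin_diff_left be_pcomp_degree_0 aug_def frag_extend_diff)
qed

lemma keys_leibniz:
  assumes "keys x \<subseteq> nd_simplices d" "keys y \<subseteq> nd_simplices e" "d + e = Suc m"
  shows "keys (ez k (frag_extend be_bdry x) y + frag_cmul c (ez k x (frag_extend be_bdry y)))
    \<subseteq> nd_simplices m"
proof (intro keys_add_subset keys_cmul_subset)
  show "keys (ez k (frag_extend be_bdry x) y) \<subseteq> nd_simplices m"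
  proof (cases d)
    case 0
    then show ?thesis using bd_degree_0[of x] assms by (simp add: ez_def)
  next
    case (Suc d')
    then show ?thesis using keys_ez[OF keys_bd assms(2), of x d'] assms by simp
  qed
  show "keys (ez k x (frag_extend be_bdry y)) \<subseteq> nd_simplices m"
  proof (cases e)
    case 0
    then show ?thesis using bd_degree_0[of y] assms by (simp add: ez_def)
  next
    case (Suc e')
    then show ?thesis using keys_ez[OF assms(1) keys_bd, of y e'] assms by simp
  qed
qed

text \<open>The composite is \<open>cone s Y\<close> with \<open>Y\<close> the right-hand side of
  the claim, so by \<open>homotopy\<close> it suffices that \<open>Y\<close> is a cycle on which
  \<open>aug\<close> vanishes. That \<open>Y\<close> is a cycle follows from the rule in lower
  degree.\<close>

lemma leibniz_basis:
  assumes "U \<in> nd_simplices d" "V \<in> nd_simplices e"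
  shows "frag_extend be_bdry (be_pcomp k U V)
    = ez k (be_bdry U) (frag_of V) + frag_cmul ((-1) ^ d) (ez k (frag_of U) (be_bdry V))"
  using assms
proof (induction "d + e" arbitrary: d e U V rule: less_induct)
  case less
  obtain u us v vs where UV: "U = u # us" "V = v # vs"
    using less.prems by (cases U; cases V) (auto simp: nd_simplices_def)
  have len: "length us = d" "length vs = e"
    using less.prems UV by (auto simp: nd_simplices_def)
  show ?case
  proof (cases "d + e = 0")
    case True
    then have "us = []" "vs = []" using len by auto
    then show ?thesis by (simp add: UV be_pcomp_degree_0 ez_def)
  next
    case False
    then obtain m where m: "d + e = Suc m" by (cases "d + e") auto
    define s where "s = perm_comp k u v"
    define Y where "Y = ez k (be_bdry U) (frag_of V) + frag_cmul ((-1) ^ d) (ez k (frag_of U) (be_bdry V))"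
    have "us \<noteq> [] \<or> vs \<noteq> []" using False len by auto
    then have eq: "be_pcomp k U V = cone s Y"
      unfolding UV Y_def s_def be_pcomp_rec[OF \<open>us \<noteq> [] \<or> vs \<noteq> []\<close>] cone_add cone_cmul
      using less.prems
      by (subst cone_ez_bdry_left cone_ez_bdry_right, simp add: UV)+ (simp add: len)
    have kY: "keys Y \<subseteq> nd_simplices m"
      using keys_leibniz[of "frag_of U" d "frag_of V" e m k "(-1) ^ d"] less.prems m
      by (simp add: Y_def)
    \<comment> \<open>The boundary of \<open>Y\<close> consists of two copies of the composite of
      both boundaries. This one has the sign of degree \<open>d - 1\<close>, the one from
      \<open>right\<close> gets the factor \<open>(-1) ^ d\<close> in \<open>Y\<close>, so they
      cancel.\<close>
    have left: "frag_extend be_bdry (ez k (be_bdry U) (frag_of V)) =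
        frag_cmul ((-1) ^ (d - 1)) (ez k (be_bdry U) (be_bdry V))"
    proof (cases d)
      case 0
      then show ?thesis using UV len by (simp add: ez_def)
    next
      case (Suc d')
      have "frag_extend be_bdry (ez k (be_bdry U) (frag_of V))
        = ez k (frag_extend be_bdry (be_bdry U)) (frag_of V)
          + frag_cmul ((-1) ^ d') (ez k (be_bdry U) (frag_extend be_bdry (frag_of V)))"
        using less.hyps[of d' e] keys_be_bdry[of U d'] less.prems Suc
        by (intro leibniz_linear) (auto simp: subset_iff)
      then show ?thesis using Suc by (simp add: bd_bd_basis ez_def)
    qed
    have right: "frag_extend be_bdry (ez k (frag_of U) (be_bdry V)) =
        ez k (be_bdry U) (be_bdry V)"
    proof (cases e)
      case 0
      then show ?thesis using UV len by (simp add: ez_def)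
    next
      case (Suc e')
      have "frag_extend be_bdry (ez k (frag_of U) (be_bdry V))
        = ez k (frag_extend be_bdry (frag_of U)) (be_bdry V)
          + frag_cmul ((-1) ^ d) (ez k (frag_of U) (frag_extend be_bdry (be_bdry V)))"
        using less.hyps[of d e'] keys_be_bdry[of V e'] less.prems Suc
        by (intro leibniz_linear) (auto simp: subset_iff)
      then show ?thesis using Suc by (simp add: bd_bd_basis ez_def)
    qed
    have "frag_extend be_bdry Y = 0"
    proof (cases d)
      case 0
      then have "be_bdry U = 0" using UV len by simp
      then show ?thesis by (simp add: Y_def right frag_extend_add frag_extend_cmul) (simp add: ez_def)
    next
      case (Suc d')
      then show ?thesis
        by (simp add: Y_def left right frag_extend_add frag_extend_cmul frag_cmul_distrib[symmetric])
    qed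
    moreover have "aug s Y = 0"
    proof (cases m)
      case 0
      then show ?thesis using aug_degree_1[OF less.prems] m by (simp add: Y_def)
    qed (use kY aug_degree_pos in auto)
    ultimately have "frag_extend be_bdry (cone s Y) = Y"
      using homotopy[OF kY, of s] by simp
    then show ?thesis unfolding eq Y_def .
  qed
qed

lemma leibniz:
  assumes "keys x \<subseteq> nd_simplices d" "keys y \<subseteq> nd_simplices e"
  shows "frag_extend be_bdry (ez k x y)
    = ez k (frag_extend be_bdry x) y + frag_cmul ((-1) ^ d) (ez k x (frag_extend be_bdry y))"
  using assms by (intro leibniz_linear leibniz_basis) auto

section \<open>Composition of permutations\<close>

definition perms :: "nat \<Rightarrow> nat list set" where
  "perms r = permutations_of_set {1..r}"

lemma perms_iff: "u \<in> perms r \<longleftrightarrow> set u = {1..r} \<and> distinct u"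
  by (simp add: perms_def permutations_of_set_def)

lemma be_simplices_iff:
  "W \<in> be_simplices r d \<longleftrightarrow> length W = Suc d \<and> set W \<subseteq> perms r \<and> distinct_adj W"
  by (simp add: be_simplices_def perms_def)

lemma length_perms: "u \<in> perms r \<Longrightarrow> length u = r"
  using distinct_card[of u] by (simp add: perms_iff)

lemma perm_comp_Nil [simp]: "perm_comp k [] v = []"
  by (simp add: perm_comp_def)

lemma perm_comp_Cons: "perm_comp k (x # u) v =
    (if x = k then map (\<lambda>y. y + k - 1) v
     else if x > k then [x + length v - 1] else [x]) @ perm_comp k u v"
  by (simp add: perm_comp_def)

lemma perm_comp_append: "perm_comp k (u @ u') v = perm_comp k u v @ perm_comp k u' v"
  by (simp add: perm_comp_def)

lemma perm_comp_notin:
  "k \<notin> set u \<Longrightarrow> perm_comp k u v = map (\<lambda>x. if x > k then x + length v - 1 else x) u"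
  by (induction u) (auto simp: perm_comp_Cons)

lemma perm_comp_split:
  assumes "k \<notin> set A" "k \<notin> set B"
  shows "perm_comp k (A @ k # B) v =
    map (\<lambda>x. if x > k then x + length v - 1 else x) A @ map (\<lambda>y. y + k - 1) v
    @ map (\<lambda>x. if x > k then x + length v - 1 else x) B"
  using assms by (simp add: perm_comp_append perm_comp_Cons perm_comp_notin)

lemma set_perm_comp:
  "set (perm_comp k u v) = (\<lambda>x. if x > k then x + length v - 1 else x) ` (set u - {k})
    \<union> (if k \<in> set u then (\<lambda>y. y + k - 1) ` set v else {})"
  by (induction u) (auto simp: perm_comp_Cons)

text \<open>Length and value set both have size \<open>r + s - 1\<close>, so distinctness follows by
  counting.\<close>

lemma perm_comp_perms:
  assumes "1 \<le> k" "k \<le> r" "1 \<le> s" "u \<in> perms r" "v \<in> perms s"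
  shows "perm_comp k u v \<in> perms (r + s - 1)"
proof -
  have k: "k \<in> set u" using assms by (simp add: perms_iff)
  then obtain A B where AB: "u = A @ k # B" by (meson split_list)
  have "distinct u" using assms by (simp add: perms_iff)
  then have "k \<notin> set A" "k \<notin> set B" by (auto simp: AB)
  then have len: "length (perm_comp k u v) = r + s - 1"
    using length_perms[OF assms(4)] length_perms[OF assms(5)] unfolding AB
    by (simp add: perm_comp_split)
  have "set (perm_comp k u v) = {1..r + s - 1}"
  proof -
    have "x \<in> set (perm_comp k u v)" if x: "x \<in> {1..r + s - 1}" for x
    proof -
      consider "x < k" | "k \<le> x" "x < k + s" | "x \<ge> k + s" by linarith
      then show ?thesis
      proof cases
        case 1
        then show ?thesis using assms k x unfolding set_perm_comp perms_iff
          by (intro UnI1 image_eqI[of _ _ x]) auto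
      next
        case 2
        then have "x = (x - k + 1) + k - 1" "x - k + 1 \<in> set v"
          using assms by (auto simp: perms_iff)
        then show ?thesis using k unfolding set_perm_comp by (simp only: if_True) blast
      next
        case 3
        then have "x = (x - s + 1) + length v - 1" "x - s + 1 \<in> set u - {k}" "x - s + 1 > k"
          using assms x length_perms[OF assms(5)] by (auto simp: perms_iff)
        then show ?thesis unfolding set_perm_comp
          by (intro UnI1 image_eqI[of _ _ "x - s + 1"]) auto
      qed
    qed
    moreover have "set (perm_comp k u v) \<subseteq> {1..r + s - 1}"
      using assms length_perms[OF assms(5)] unfolding set_perm_comp perms_iff by auto
    ultimately show ?thesis by blast
  qed
  then show ?thesis using len by (simp add: perms_iff card_distinct)
qed

lemma perm_comp_equivariant:
  assumes "length v = s" "set v = {1..s}" "inj \<sigma>"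
  shows "perm_comp (\<sigma> k) (map \<sigma> u) (map \<tau> v) = map (block_perm s k \<sigma> \<tau>) (perm_comp k u v)"
proof (induction u)
  case (Cons x u)
  have "map (\<lambda>y. y + \<sigma> k - 1) (map \<tau> v) = map (block_perm s k \<sigma> \<tau>) (map (\<lambda>y. y + k - 1) v)"
    using assms(2) by (auto simp: block_perm_def Let_def)
  moreover have "(if \<sigma> x > \<sigma> k then \<sigma> x + s - 1 else \<sigma> x) =
      block_perm s k \<sigma> \<tau> (if x > k then x + s - 1 else x)" if "x \<noteq> k"
    using that assms by (cases "s = 0") (auto simp: block_perm_def Let_def)
  ultimately show ?case
    using Cons assms(1) by (auto simp: perm_comp_Cons inj_eq[OF assms(3)] split: if_splits)
qed simp

lemma perm_comp_map_shift:
  assumes "1 \<le> k" "1 \<le> l"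
  shows "perm_comp (k + l - 1) (map (\<lambda>y. y + k - 1) v) w = map (\<lambda>y. y + k - 1) (perm_comp l v w)"
proof (induction v)
  case (Cons y v)
  have "(y + k - 1 = k + l - 1) = (y = l)" "(y + k - 1 > k + l - 1) = (y > l)"
    using assms by auto
  then show ?case using Cons assms by (auto simp: perm_comp_Cons)
qed simp

lemma perm_comp_sequential:
  assumes "1 \<le> k" "1 \<le> l" "l \<in> set v" "distinct v" "length v = s" "l \<le> s"
  shows "perm_comp (k + l - 1) (perm_comp k u v) w = perm_comp k u (perm_comp l v w)"
proof -
  obtain A B where v: "v = A @ l # B" using assms by (meson split_list)
  have len: "length (perm_comp l v w) = s + length w - 1"
    using assms unfolding v by (simp add: perm_comp_split)
  show ?thesis
  proof (induction u)
    case (Cons x u)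
    have "perm_comp (k + l - 1) [if x > k then x + s - 1 else x] w
       = [if x > k then x + (s + length w - 1) - 1 else x]" if "x \<noteq> k"
      using that assms by (auto simp: perm_comp_Cons)
    then show ?case
      using Cons assms perm_comp_map_shift[OF assms(1,2)] len
      by (auto simp: perm_comp_Cons[of k] perm_comp_append split: if_splits)
  qed simp
qed

lemma perm_comp_parallel:
  assumes "1 \<le> i" "i < k" "set v \<subseteq> {1..length v}" "set w \<subseteq> {1..length w}" "length w \<ge> 1" "length v \<ge> 1"
  shows "perm_comp i (perm_comp k u v) w = perm_comp (k + length w - 1) (perm_comp i u w) v"
proof (induction u)
  case (Cons x u)
  have 1: "perm_comp i (map (\<lambda>y. y + k - 1) v) w = map (\<lambda>y. y + (k + length w - 1) - 1) v"
    using assms(1,2,3,5) by (subst perm_comp_notin) (fastforce simp: Suc_le_eq)+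
  have 2: "perm_comp (k + length w - 1) (map (\<lambda>y. y + i - 1) w) v = map (\<lambda>y. y + i - 1) w"
    using assms(1,2,4,5) by (subst perm_comp_notin) (fastforce intro!: map_idI)+
  consider "x = k" | "x = i" | "x > k" | "x < k" "x > i" | "x < i" using assms by linarith
  then show ?case
  proof cases
    case 1
    then show ?thesis using Cons assms \<open>perm_comp i (map _ v) w = _\<close>
      by (auto simp: perm_comp_Cons perm_comp_append)
  next
    case 2
    then show ?thesis using Cons assms \<open>perm_comp _ (map _ w) v = _\<close>
      by (auto simp: perm_comp_Cons perm_comp_append)
  qed (use Cons assms in \<open>auto simp: perm_comp_Cons perm_comp_append\<close>)
qed simp

lemma perm_comp_unit_left:
  "perm_comp 1 [1] v = v"
  by (simp add: perm_comp_Cons)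

lemma perm_comp_unit_right: "1 \<le> k \<Longrightarrow> perm_comp k u [1] = u"
  by (induction u) (auto simp: perm_comp_Cons)

section \<open>Naturality of sums over lattice paths\<close>

lemma count_take_le:
  assumes "p \<in> lattice_paths d e"
  shows "count_list (take i p) True \<le> d" "count_list (take i p) False \<le> e"
proof -
  have "count_list p b = count_list (take i p) b + count_list (drop i p) b" for b
    by (metis append_take_drop_id count_list_append)
  from this[of True] this[of False] show "count_list (take i p) True \<le> d" "count_list (take i p) False \<le> e"
    using assms by (auto simp: lattice_paths_def)
qed

lemma gpath_map:
  assumes "p \<in> lattice_paths (length U - 1) (length V - 1)" "U \<noteq> []" "V \<noteq> []"
    and "\<And>u v. u \<in> set U \<Longrightarrow> v \<in> set V \<Longrightarrow> f (g u) (h v) = q (f' u v)"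
  shows "gpath f (map g U) (map h V) p = map q (gpath f' U V p)"
proof -
  have "count_list (take i p) True < length U" "count_list (take i p) False < length V" for i
    using count_take_le[OF assms(1), of i] assms(2,3)
    by (cases U; cases V; force)+
  then show ?thesis using assms(4) by (auto simp: gpath_def)
qed

lemma path_sum_map:
  assumes "\<And>u v. u \<in> set U \<Longrightarrow> v \<in> set V \<Longrightarrow> f (g u) (h v) = q (f' u v)"
  shows "path_sum f F (map g U) (map h V) = path_sum f' (\<lambda>X. F (map q X)) U V"
  unfolding path_sum_def using assms
  by (auto intro!: sum.cong simp: gpath_map[where q = q and f' = f'])

lemma set_gpath:
  assumes "p \<in> lattice_paths (length U - 1) (length V - 1)" "U \<noteq> []" "V \<noteq> []"
    and "\<And>u v. u \<in> set U \<Longrightarrow> v \<in> set V \<Longrightarrow> f u v \<in> S"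
  shows "set (gpath f U V p) \<subseteq> S"
proof -
  have "count_list (take i p) True < length U" "count_list (take i p) False < length V" for i
    using count_take_le[OF assms(1), of i] assms(2,3)
    by (cases U; cases V; force)+
  then show ?thesis using assms(4) by (force simp: gpath_def simp del: upt_Suc)
qed

lemma hd_gpath: "U \<noteq> [] \<Longrightarrow> V \<noteq> [] \<Longrightarrow> hd (gpath f U V p) = f (hd U) (hd V)"
  by (simp add: gpath_def hd_map hd_conv_nth del: upt_Suc)

lemma path_sum_singleton_left: "V \<noteq> [] \<Longrightarrow> path_sum f F [u] V = F (map (f u) V)"
  by (induction V arbitrary: F) (auto simp: path_sum_Cons)

lemma path_sum_singleton_right: "U \<noteq> [] \<Longrightarrow> path_sum f F U [v] = F (map (\<lambda>u. f u v) U)"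
  by (induction U arbitrary: F) (auto simp: path_sum_Cons)

section \<open>The Barratt-Eccles operad axioms\<close>

definition headed :: "'a \<Rightarrow> 'a list set" where
  "headed s = {X. X \<noteq> [] \<and> hd X = s}"

lemma cone_headed: "keys c \<subseteq> headed s \<Longrightarrow> cone s c = 0"
  unfolding cone_def
proof (rule frag_extend_eq_0)
  fix W assume "keys c \<subseteq> headed s" "W \<in> keys c"
  then obtain X where "W = s # X" by (cases W) (auto simp: headed_def)
  then show "be_class (s # W) = 0" by simp
qed

lemma be_pcomp_headed_keys:
  assumes "U \<in> headed u" "V \<in> headed v"
  shows "keys (be_pcomp k U V) \<subseteq> headed (perm_comp k u v)"
  unfolding be_pcomp_def
proof (intro keys_sum_subset keys_cmul_subset)
  fix p
  show "keys (be_class (path_simplex k U V p)) \<subseteq> headed (perm_comp k u v)"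
    using keys_be_class[of "path_simplex k U V p"] hd_gpath[of U V "perm_comp k" p] assms
    by (auto simp: headed_def path_simplex_gpath)
qed

lemma ez_headed:
  assumes "keys x \<subseteq> headed u" "keys y \<subseteq> headed v"
  shows "keys (ez k x y) \<subseteq> headed (perm_comp k u v)"
  unfolding ez_def
  by (rule order_trans[OF keys_bilin]) (use assms be_pcomp_headed_keys in blast)

abbreviation be_chains :: "nat \<Rightarrow> nat \<Rightarrow> (simplex \<Rightarrow>\<^sub>0 int) set" where
  "be_chains r d \<equiv> {c. keys c \<subseteq> be_simplices r d}"

lemma be_simplices_nd: "be_simplices r d \<subseteq> nd_simplices d"
  by (auto simp: be_simplices_iff nd_simplices_def)

lemma be_chains_nd: "x \<in> be_chains r d \<Longrightarrow> keys x \<subseteq> nd_simplices d"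
  using be_simplices_nd by blast

lemma be_simplices_Cons:
  assumes "U \<in> be_simplices r d"
  obtains u us where "U = u # us" "u \<in> perms r" "length us = d" "set us \<subseteq> perms r"
  using assms by (cases U) (auto simp: be_simplices_iff)

lemma keys_be_bdry_chains: "W \<in> be_simplices r (Suc d) \<Longrightarrow> be_bdry W \<in> be_chains r d"
  unfolding be_bdry_def mem_Collect_eq
proof (intro keys_sum_subset keys_cmul_subset)
  fix i assume W: "W \<in> be_simplices r (Suc d)" "i \<in> {..<length W}"
  then show "keys (be_class (delete_nth i W)) \<subseteq> be_simplices r d"
    using keys_be_class[of "delete_nth i W"] set_delete_nth[of i W]
    by (auto simp: be_simplices_iff)
qed

lemma bd_chains: "c \<in> be_chains r (Suc d) \<Longrightarrow> frag_extend be_bdry c \<in> be_chains r d"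
  using keys_be_bdry_chains unfolding mem_Collect_eq by (intro keys_extend_subset) blast

lemma be_pcomp_chains:
  assumes "1 \<le> k" "k \<le> r" "1 \<le> s" "U \<in> be_simplices r d" "V \<in> be_simplices s e"
  shows "be_pcomp k U V \<in> be_chains (r + s - 1) (d + e)"
  unfolding be_pcomp_def mem_Collect_eq
proof (intro keys_sum_subset keys_cmul_subset)
  fix p assume p: "p \<in> lattice_paths (length U - 1) (length V - 1)"
  have "set (gpath (perm_comp k) U V p) \<subseteq> perms (r + s - 1)"
  proof (rule set_gpath[OF p])
    show "U \<noteq> []" "V \<noteq> []" using assms by (auto simp: be_simplices_iff)
  qed (use assms perm_comp_perms[OF assms(1-3)] in \<open>auto simp: be_simplices_iff subset_iff\<close>)
  then show "keys (be_class (path_simplex k U V p)) \<subseteq> be_simplices (r + s - 1) (d + e)"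
    using keys_be_class[of "path_simplex k U V p"] length_lattice_path[OF p] assms
    by (auto simp: be_simplices_iff path_simplex_gpath)
qed

lemma trilinear_eqI:
  assumes "\<And>a b c. a \<in> keys x \<Longrightarrow> b \<in> keys y \<Longrightarrow> c \<in> keys z \<Longrightarrow>
      F (frag_of a) (frag_of b) (frag_of c) = G (frag_of a) (frag_of b) (frag_of c)"
    and "\<And>a a' b c. F (a - a') b c = F a b c - F a' b c"
    and "\<And>a b b' c. F a (b - b') c = F a b c - F a b' c"
    and "\<And>a b c c'. F a b (c - c') = F a b c - F a b c'"
    and "\<And>a a' b c. G (a - a') b c = G a b c - G a' b c"
    and "\<And>a b b' c. G a (b - b') c = G a b c - G a b' c"
    and "\<And>a b c c'. G a b (c - c') = G a b c - G a b c'"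
  shows "F x y z = (G x y z :: 'd::ab_group_add)"
proof (rule linear_eq_on_keys[where x = x])
  fix a assume a: "a \<in> keys x"
  show "F (frag_of a) y z = G (frag_of a) y z"
  proof (rule linear_eq_on_keys[where x = y])
    fix b assume b: "b \<in> keys y"
    show "F (frag_of a) (frag_of b) z = G (frag_of a) (frag_of b) z"
      by (rule linear_eq_on_keys[where x = z], rule assms(1)[OF a b], assumption, rule assms(4), rule assms(7))
  qed (rule assms(3) assms(6))+
qed (rule assms(2) assms(5))+

lemma ez_simps:
  "ez k (x + x') y = ez k x y + ez k x' y" "ez k x (y + y') = ez k x y + ez k x y'"
  "ez k (x - x') y = ez k x y - ez k x' y" "ez k x (y - y') = ez k x y - ez k x y'"
  "ez k (frag_cmul m x) y = frag_cmul m (ez k x y)" "ez k x (frag_cmul m y) = frag_cmul m (ez k x y)"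
  "ez k 0 y = 0" "ez k x 0 = 0" "ez k (frag_of U) (frag_of V) = be_pcomp k U V"
  by (simp_all add: ez_def bilin_add_left bilin_add_right bilin_diff_left bilin_diff_right
      bilin_cmul_left bilin_cmul_right)

lemma be_chains_bd_cases:
  assumes "x \<in> be_chains r d"
  obtains "d = 0" "frag_extend be_bdry x = 0"
    | d' where "d = Suc d'" "frag_extend be_bdry x \<in> be_chains r d'"
  using assms bd_degree_0[of x] bd_chains[of x r] be_chains_nd[OF assms] by (cases d) auto

lemma ez_sequential:
  assumes "1 \<le> k" "k \<le> r" "1 \<le> l" "l \<le> s" "1 \<le> t"
    "x \<in> be_chains r d" "y \<in> be_chains s e" "z \<in> be_chains t f"
  shows "ez (k + l - 1) (ez k x y) z = ez k x (ez l y z)"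
  using assms(6-8)
proof (induction "d + e + f" arbitrary: d e f x y z rule: less_induct)
  case less
  show ?case
  proof (rule trilinear_eqI[where F = "\<lambda>x y z. ez (k + l - 1) (ez k x y) z"
        and G = "\<lambda>x y z. ez k x (ez l y z)"])
    fix U V W assume UVW: "U \<in> keys x" "V \<in> keys y" "W \<in> keys z"
    have ch: "frag_of U \<in> be_chains r d" "frag_of V \<in> be_chains s e" "frag_of W \<in> be_chains t f"
      using UVW less.prems by auto
    note nd = be_chains_nd[OF ch(1)] be_chains_nd[OF ch(2)] be_chains_nd[OF ch(3)]
    obtain u us where U: "U = u # us" "u \<in> perms r" "length us = d"
      using ch(1) be_simplices_Cons[of U r d] by (metis keys_of_subset mem_Collect_eq)
    obtain v vs where V: "V = v # vs" "v \<in> perms s" "length vs = e"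
      using ch(2) be_simplices_Cons[of V s e] by (metis keys_of_subset mem_Collect_eq)
    obtain w ws where W: "W = w # ws" "w \<in> perms t" "length ws = f"
      using ch(3) be_simplices_Cons[of W t f] by (metis keys_of_subset mem_Collect_eq)
    have seq: "perm_comp (k + l - 1) (perm_comp k u v) w = perm_comp k u (perm_comp l v w)"
      using assms V(2) length_perms[OF V(2)] by (intro perm_comp_sequential) (auto simp: perms_iff)
    let ?A = "ez (k + l - 1) (ez k (frag_of U) (frag_of V)) (frag_of W)"
    let ?B = "ez k (frag_of U) (ez l (frag_of V) (frag_of W))"
    show "?A = ?B"
    proof (cases "d + e + f")
      case 0
      then show ?thesis using U V W seq by (simp add: ez_simps be_pcomp_degree_0)
    next
      case (Suc m)
      show ?thesis
      proof (rule headed_eqI)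
        show "keys ?A \<subseteq> nd_simplices (Suc m)"
          using keys_ez[OF keys_ez[OF nd(1,2)] nd(3)] by (simp add: Suc)
        show "keys ?B \<subseteq> nd_simplices (Suc m)"
          using keys_ez[OF nd(1) keys_ez[OF nd(2,3)]] by (simp add: Suc[symmetric] add.assoc)
        have h: "keys (frag_of U) \<subseteq> headed u" "keys (frag_of V) \<subseteq> headed v" "keys (frag_of W) \<subseteq> headed w"
          using U V W by (auto simp: headed_def)
        show "cone (perm_comp k u (perm_comp l v w)) ?B = 0"
          by (intro cone_headed ez_headed h)
        show "cone (perm_comp k u (perm_comp l v w)) ?A = 0"
          unfolding seq[symmetric] by (intro cone_headed ez_headed h)
        \<comment> \<open>The equations \<open>1\<close>, \<open>2\<close>, \<open>3\<close> match
          the three summands of the iterated Leibniz rule. In each, either the total degree has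
          dropped, or the factor has degree 0 and its boundary vanishes.\<close>
        have 1: "ez (k + l - 1) (ez k (frag_extend be_bdry (frag_of U)) (frag_of V)) (frag_of W)
            = ez k (frag_extend be_bdry (frag_of U)) (ez l (frag_of V) (frag_of W))"
          using ch(1)
        proof (cases rule: be_chains_bd_cases)
          case (2 d')
          then show ?thesis by (intro less.hyps[OF _ 2(2) ch(2,3)]) auto
        qed (simp add: ez_simps)
        have 2: "ez (k + l - 1) (ez k (frag_of U) (frag_extend be_bdry (frag_of V))) (frag_of W)
            = ez k (frag_of U) (ez l (frag_extend be_bdry (frag_of V)) (frag_of W))"
          using ch(2)
        proof (cases rule: be_chains_bd_cases)
          case (2 e')
          then show ?thesis by (intro less.hyps[OF _ ch(1) 2(2) ch(3)]) auto
        qed (simp add: ez_simps)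
        have 3: "ez (k + l - 1) (ez k (frag_of U) (frag_of V)) (frag_extend be_bdry (frag_of W))
            = ez k (frag_of U) (ez l (frag_of V) (frag_extend be_bdry (frag_of W)))"
          using ch(3)
        proof (cases rule: be_chains_bd_cases)
          case (2 f')
          then show ?thesis by (intro less.hyps[OF _ ch(1,2) 2(2)]) auto
        qed (simp add: ez_simps)
        show "frag_extend be_bdry ?A = frag_extend be_bdry ?B"
          unfolding leibniz[OF keys_ez[OF nd(1,2)] nd(3)] leibniz[OF nd(1) keys_ez[OF nd(2,3)]]
            leibniz[OF nd(1,2)] leibniz[OF nd(2,3)] ez_simps(1,2,5,6) 1 2 3
          by (simp add: frag_cmul_distrib2 power_add algebra_simps)
      qed
    qed
  qed (simp_all add: ez_simps)
qed

lemma ez_parallel: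
  assumes "1 \<le> i" "i < k" "k \<le> r" "1 \<le> s" "1 \<le> t"
    "x \<in> be_chains r d" "y \<in> be_chains s e" "z \<in> be_chains t f"
  shows "ez i (ez k x y) z = frag_cmul ((-1) ^ (e * f)) (ez (k + t - 1) (ez i x z) y)"
  using assms(6-8)
proof (induction "d + e + f" arbitrary: d e f x y z rule: less_induct)
  case less
  show ?case
  proof (rule trilinear_eqI[where F = "\<lambda>x y z. ez i (ez k x y) z"
        and G = "\<lambda>x y z. frag_cmul ((-1) ^ (e * f)) (ez (k + t - 1) (ez i x z) y)"])
    fix U V W assume UVW: "U \<in> keys x" "V \<in> keys y" "W \<in> keys z"
    have ch: "frag_of U \<in> be_chains r d" "frag_of V \<in> be_chains s e" "frag_of W \<in> be_chains t f"
      using UVW less.prems by auto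
    note nd = be_chains_nd[OF ch(1)] be_chains_nd[OF ch(2)] be_chains_nd[OF ch(3)]
    obtain u us where U: "U = u # us" "u \<in> perms r" "length us = d"
      using ch(1) be_simplices_Cons[of U r d] by (metis keys_of_subset mem_Collect_eq)
    obtain v vs where V: "V = v # vs" "v \<in> perms s" "length vs = e"
      using ch(2) be_simplices_Cons[of V s e] by (metis keys_of_subset mem_Collect_eq)
    obtain w ws where W: "W = w # ws" "w \<in> perms t" "length ws = f"
      using ch(3) be_simplices_Cons[of W t f] by (metis keys_of_subset mem_Collect_eq)
    have par: "perm_comp i (perm_comp k u v) w = perm_comp (k + t - 1) (perm_comp i u w) v"
      using perm_comp_parallel[of i k v w u] assms V(2) W(2) length_perms[OF V(2)] length_perms[OF W(2)]
      by (simp add: perms_iff)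
    let ?A = "ez i (ez k (frag_of U) (frag_of V)) (frag_of W)"
    let ?B = "ez (k + t - 1) (ez i (frag_of U) (frag_of W)) (frag_of V)"
    show "?A = frag_cmul ((-1) ^ (e * f)) ?B"
    proof (cases "d + e + f")
      case 0
      then show ?thesis using U V W par by (simp add: ez_simps be_pcomp_degree_0)
    next
      case (Suc m)
      show ?thesis
      proof (rule headed_eqI)
        show "keys ?A \<subseteq> nd_simplices (Suc m)"
          using keys_ez[OF keys_ez[OF nd(1,2)] nd(3)] by (simp add: Suc)
        show "keys (frag_cmul ((-1) ^ (e * f)) ?B) \<subseteq> nd_simplices (Suc m)"
          using keys_ez[OF keys_ez[OF nd(1,3)] nd(2)]
          by (intro keys_cmul_subset) (simp add: Suc[symmetric] ac_simps)
        have h: "keys (frag_of U) \<subseteq> headed u" "keys (frag_of V) \<subseteq> headed v" "keys (frag_of W) \<subseteq> headed w"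
          using U V W by (auto simp: headed_def)
        show "cone (perm_comp i (perm_comp k u v) w) ?A = 0"
          by (intro cone_headed ez_headed h)
        show "cone (perm_comp i (perm_comp k u v) w) (frag_cmul ((-1) ^ (e * f)) ?B) = 0"
          unfolding par by (intro cone_headed keys_cmul_subset ez_headed h)
        have 1: "ez i (ez k (frag_extend be_bdry (frag_of U)) (frag_of V)) (frag_of W)
            = frag_cmul ((-1) ^ (e * f))
                (ez (k + t - 1) (ez i (frag_extend be_bdry (frag_of U)) (frag_of W)) (frag_of V))"
          using ch(1)
        proof (cases rule: be_chains_bd_cases)
          case (2 d')
          then show ?thesis by (intro less.hyps[OF _ 2(2) ch(2,3)]) auto
        qed (simp add: ez_simps)
        \<comment> \<open>The induction gives the exponent \<open>(e - 1) * f\<close>. It is written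
          \<open>e * f + f\<close>, of the same parity, so that it combines with the Leibniz sign
          without truncated subtraction.\<close>
        have 2: "ez i (ez k (frag_of U) (frag_extend be_bdry (frag_of V))) (frag_of W)
            = frag_cmul ((-1) ^ (e * f + f))
                (ez (k + t - 1) (ez i (frag_of U) (frag_of W)) (frag_extend be_bdry (frag_of V)))"
          using ch(2)
        proof (cases rule: be_chains_bd_cases)
          case (2 e')
          have "((-1) ^ (e' * f) :: int) = (-1) ^ (e * f + f)"
            using 2 by (simp add: power_add)
          then show ?thesis using less.hyps[OF _ ch(1) 2(2) ch(3)] 2(1) by simp
        qed (simp add: ez_simps)
        have 3: "ez i (ez k (frag_of U) (frag_of V)) (frag_extend be_bdry (frag_of W))
            = frag_cmul ((-1) ^ (e * f + e))
                (ez (k + t - 1) (ez i (frag_of U) (frag_extend be_bdry (frag_of W))) (frag_of V))"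
          using ch(3)
        proof (cases rule: be_chains_bd_cases)
          case (2 f')
          have "((-1) ^ (e * f') :: int) = (-1) ^ (e * f + e)"
            using 2 by (simp add: power_add)
          then show ?thesis using less.hyps[OF _ ch(1,2) 2(2)] 2(1) by simp
        qed (simp add: ez_simps)
        show "frag_extend be_bdry ?A = frag_extend be_bdry (frag_cmul ((-1) ^ (e * f)) ?B)"
          unfolding leibniz[OF keys_ez[OF nd(1,2)] nd(3)] frag_extend_cmul
            leibniz[OF keys_ez[OF nd(1,3)] nd(2)]
            leibniz[OF nd(1,2)] leibniz[OF nd(1,3)] ez_simps(1,2,5,6) 1 2 3
          by (simp add: frag_cmul_distrib2 power_add algebra_simps)
      qed
    qed
  qed (simp_all add: ez_simps frag_cmul_diff_right)
qed

section \<open>Permutation action and units on Barratt-Eccles chains\<close>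

definition be_map :: "(nat list \<Rightarrow> nat list) \<Rightarrow> (simplex \<Rightarrow>\<^sub>0 int) \<Rightarrow> simplex \<Rightarrow>\<^sub>0 int" where
  "be_map g = frag_extend (\<lambda>W. be_class (map g W))"

lemma be_map_class: "be_map g (be_class W) = be_class (map g W)"
  by (auto simp: be_map_def be_class_def dest: distinct_adj_mapD)

lemma be_map_bdry: "be_bdry (map g W) = be_map g (be_bdry W)"
proof -
  have "be_map g (\<Sum>i\<in>I. frag_cmul (c i) (be_class (D i))) = (\<Sum>i\<in>I. frag_cmul (c i) (be_class (map g (D i))))"
    if "finite I" for c D and I :: "nat set"
    using that by (induction) (simp_all add: be_map_def frag_extend_add frag_extend_cmul be_map_class[unfolded be_map_def])
  then show ?thesis unfolding be_bdry_def by (simp add: map_delete_nth)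
qed

lemma be_map_bd: "frag_extend be_bdry (be_map g x) = be_map g (frag_extend be_bdry x)"
  unfolding be_map_def frag_extend_extend bd_class be_map_bdry by (simp add: be_map_def)

lemma map_permutes_perms: "\<sigma> permutes {1..r} \<Longrightarrow> u \<in> perms r \<Longrightarrow> map \<sigma> u \<in> perms r"
  using permutes_image[of \<sigma> "{1..r}"] permutes_inj_on[of \<sigma> "{1..r}"]
  by (auto simp: perms_iff distinct_map inj_on_subset)

lemma be_map_id: "x \<in> be_chains r d \<Longrightarrow> be_map id x = x"
proof -
  assume x: "x \<in> be_chains r d"
  have "be_map id x = frag_extend frag_of x"
    unfolding be_map_def
  proof (rule frag_extend_eq)
    fix W assume "W \<in> keys x"
    then have "W \<in> nd_simplices d" using be_chains_nd[OF x] by blast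
    then show "be_class (map id W) = frag_of W" by (simp add: be_class_nd)
  qed
  then show ?thesis by simp
qed

lemma be_map_comp: "be_map g (be_map h x) = be_map (g \<circ> h) x"
  by (simp add: be_map_def frag_extend_extend be_map_class[unfolded be_map_def])

lemma be_map_ez:
  assumes "x \<in> be_chains r d" "y \<in> be_chains s e" "\<sigma> permutes {1..r}" "\<tau> permutes {1..s}"
  shows "ez (\<sigma> k) (be_map (map \<sigma>) x) (be_map (map \<tau>) y)
    = be_map (map (block_perm s k \<sigma> \<tau>)) (ez k x y)"
proof -
  have inj: "inj (map \<sigma>)" "inj (map \<tau>)"
    using assms(3,4) by (simp_all add: permutes_inj inj_mapI)
  \<comment> \<open>Injective relabelling creates no degeneracy, so the images are again generators
    and the bilinear extension can be evaluated on them.\<close>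
  have of: "be_class (map g W) = frag_of (map g W)" if "inj g" "W \<in> be_simplices q m" for g W q m
    using that distinct_adj_mapI[of W g] by (auto simp: be_class_def be_simplices_iff inj_on_def inj_def)
  have eq: "be_pcomp (\<sigma> k) (map (map \<sigma>) U) (map (map \<tau>) V)
      = be_map (map (block_perm s k \<sigma> \<tau>)) (be_pcomp k U V)"
    if UV: "U \<in> keys x" "V \<in> keys y" for U V
  proof -
    have mem: "U \<in> be_simplices r d" "V \<in> be_simplices s e" using UV assms by auto
    then have ne: "U \<noteq> []" "V \<noteq> []" by (auto simp: be_simplices_iff)
    have "path_sum (perm_comp (\<sigma> k)) be_class (map (map \<sigma>) U) (map (map \<tau>) V)
      = path_sum (perm_comp k) (\<lambda>X. be_class (map (map (block_perm s k \<sigma> \<tau>)) X)) U V"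
      using mem length_perms permutes_inj[OF assms(3)]
      by (intro path_sum_map perm_comp_equivariant) (auto simp: be_simplices_iff perms_iff subset_iff)
    also have "\<dots> = be_map (map (block_perm s k \<sigma> \<tau>)) (path_sum (perm_comp k) be_class U V)"
      by (subst path_sum_linear) (simp_all add: be_map_def frag_extend_add frag_extend_cmul
          be_map_class[unfolded be_map_def])
    finally show ?thesis using ne by (simp add: be_pcomp_path_sum)
  qed
  have "ez (\<sigma> k) (be_map (map \<sigma>) x) (be_map (map \<tau>) y)
    = ez (\<sigma> k) (frag_extend (\<lambda>W. frag_of (map (map \<sigma>) W)) x) (frag_extend (\<lambda>W. frag_of (map (map \<tau>) W)) y)"
    unfolding be_map_def using of[OF inj(1)] of[OF inj(2)] assms
    by (intro arg_cong2[of _ _ _ _ "ez (\<sigma> k)"] frag_extend_eq) auto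
  also have "\<dots> = bilin (\<lambda>U V. be_pcomp (\<sigma> k) (map (map \<sigma>) U) (map (map \<tau>) V)) x y"
    by (simp add: ez_def bilin_extend_left bilin_extend_right)
  also have "\<dots> = bilin (\<lambda>U V. be_map (map (block_perm s k \<sigma> \<tau>)) (be_pcomp k U V)) x y"
    by (intro bilin_cong eq)
  also have "\<dots> = be_map (map (block_perm s k \<sigma> \<tau>)) (ez k x y)"
    by (simp add: ez_def be_map_def extend_bilin)
  finally show ?thesis .
qed

lemma ez_unit_left:
  assumes "y \<in> be_chains s e"
  shows "ez 1 (frag_of [[1]]) y = y"
proof -
  have "ez 1 (frag_of [[1]]) y = frag_extend frag_of y"
    unfolding ez_def bilin_def frag_extend_of
  proof (rule frag_extend_eq)
    fix V assume "V \<in> keys y"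
    then have V: "V \<in> be_simplices s e" using assms by auto
    then have "V \<noteq> []" by (auto simp: be_simplices_iff)
    moreover have "be_class V = frag_of V" using V be_class_nd be_simplices_nd by blast
    ultimately show "be_pcomp 1 [[1]] V = frag_of V"
      by (simp add: be_pcomp_path_sum path_sum_singleton_left perm_comp_unit_left[simplified] map_idI)
  qed
  then show ?thesis by simp
qed

lemma ez_unit_right:
  assumes "x \<in> be_chains r d" "1 \<le> k"
  shows "ez k x (frag_of [[1]]) = x"
proof -
  have "ez k x (frag_of [[1]]) = frag_extend frag_of x"
    unfolding ez_def bilin_def frag_extend_of
  proof (rule frag_extend_eq)
    fix U assume "U \<in> keys x"
    then have U: "U \<in> be_simplices r d" using assms by auto
    then have "U \<noteq> []" by (auto simp: be_simplices_iff)
    moreover have "be_class U = frag_of U" using U be_class_nd be_simplices_nd by blast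
    ultimately show "be_pcomp k U [[1]] = frag_of U"
      using perm_comp_unit_right[OF assms(2)] by (simp add: be_pcomp_path_sum path_sum_singleton_right)
  qed
  then show ?thesis by simp
qed

section \<open>Variations\<close>

lemma variations_Nil [simp]: "variations [] = 0"
  and variations_singleton [simp]: "variations [a] = 0"
  by (simp_all add: variations_def)

lemma variations_Cons_Cons [simp]:
  "variations (a # b # xs) = (if a \<noteq> b then 1 else 0) + variations (b # xs)"
proof -
  let ?S = "{l. Suc l < length (b # xs) \<and> (b # xs) ! l \<noteq> (b # xs) ! Suc l}"
  have fin: "finite ?S" by (rule finite_subset[of _ "{..length xs}"]) auto
  have "{l. Suc l < length (a # b # xs) \<and> (a # b # xs) ! l \<noteq> (a # b # xs) ! Suc l}
    = (if a \<noteq> b then {0} else {}) \<union> Suc ` ?S" (is "?L = ?R")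
  proof (rule Set.set_eqI)
    show "l \<in> ?L \<longleftrightarrow> l \<in> ?R" for l by (cases l) (auto split: if_splits)
  qed
  then show ?thesis
    unfolding variations_def using fin by (simp add: card_image)
qed

lemma variations_Cons:
  "variations (a # xs) = (if xs \<noteq> [] \<and> a \<noteq> hd xs then 1 else 0) + variations xs"
  by (cases xs) auto

lemma variations_Cons_mono: "variations xs \<le> variations (a # xs)"
  by (simp add: variations_Cons)

lemma variations_insert: "variations (a # xs) \<le> variations (a # b # xs)"
  by (cases xs) auto

text \<open>Deleting an entry never adds variations, by the triangle inequality in
  \<open>variations_insert\<close>. The first entry is kept fixed: this is the form needed for
  counts with an additional vertex or letter in front.\<close>

lemma variations_subseq_Cons: "subseq xs ys \<Longrightarrow> variations (a # xs) \<le> variations (a # ys)"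
proof (induction arbitrary: a rule: list_emb.induct)
  case (list_emb_Cons xs ys y)
  then show ?case using variations_insert[of a ys y] by (meson order_trans)
qed auto

lemma variations_subseq: "subseq xs ys \<Longrightarrow> variations xs \<le> variations ys"
proof (induction rule: list_emb.induct)
  case (list_emb_Cons xs ys y)
  then show ?case using variations_Cons_mono[of ys y] by simp
next
  case (list_emb_Cons2 x y xs ys)
  then show ?case using variations_subseq_Cons[of xs ys y] by simp
qed simp

lemma subseq_delete_nth: "subseq (delete_nth i xs) xs"
proof (cases "i < length xs")
  case True
  have "subseq (take i xs @ drop (Suc i) xs) (take i xs @ drop i xs)"
    using True by (simp add: Cons_nth_drop_Suc[symmetric] list_emb_append_mono subseq_Cons')
  then show ?thesis by (simp add: delete_nth_def)
qed (simp add: delete_nth_def)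

lemma variations_map_le: "variations (map f xs) \<le> variations xs"
  by (induction xs rule: induct_list012) auto

lemma variations_map_gpath_Cons:
  assumes "U \<noteq> []" "V \<noteq> []"
  shows "variations (map F (a # gpath f U V p)) =
    (if F a \<noteq> F (f (hd U) (hd V)) then 1 else 0) + variations (map F (gpath f U V p))"
  using assms unfolding list.map by (subst variations_Cons) (simp add: hd_map hd_gpath)

lemma variations_map_Cons:
  "us \<noteq> [] \<Longrightarrow> variations (map g (u # us)) =
    (if g u \<noteq> g (hd us) then 1 else 0) + variations (map g us)"
  unfolding list.map by (subst variations_Cons) (simp add: hd_map)

text \<open>The hypothesis says that \<open>F\<close> sees the first coordinate only, and that only
  through \<open>g\<close>. Then y-steps cause no variation and an x-step causes one only where
  \<open>g\<close> changes along \<open>U\<close>.\<close>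

lemma variations_gpath_left:
  assumes "p \<in> lattice_paths (length U - 1) (length V - 1)" "U \<noteq> []" "V \<noteq> []"
    and "\<And>u u' v v'. \<lbrakk>u \<in> set U; u' \<in> set U; v \<in> set V; v' \<in> set V; g u = g u'\<rbrakk> \<Longrightarrow> F (f u v) = F (f u' v')"
  shows "variations (map F (gpath f U V p)) \<le> variations (map g U)"
  using assms
proof (induction p arbitrary: U V)
  case Nil
  then show ?case by (simp add: gpath_def)
next
  case (Cons b p)
  obtain u us v vs where UV: "U = u # us" "V = v # vs"
    using Cons.prems(2,3) by (cases U; cases V) auto
  show ?case
  proof (cases b)
    case True
    then have us: "us \<noteq> []" and p: "p \<in> lattice_paths (length us - 1) (length V - 1)"
      using Cons.prems(1) by (auto simp: UV lattice_paths_def)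
    have IH: "variations (map F (gpath f us V p)) \<le> variations (map g us)"
      by (rule Cons.IH[OF p us Cons.prems(3)]) (rule Cons.prems(4), auto simp: UV)
    have "F (f u v) = F (f (hd us) v)" if "g u = g (hd us)"
      by (rule Cons.prems(4)) (use us that in \<open>auto simp: UV\<close>)
    then have "variations (map F (f u v # gpath f us V p)) \<le> variations (map g (u # us))"
      using IH unfolding variations_map_gpath_Cons[OF us Cons.prems(3)] variations_map_Cons[OF us]
      by (simp add: UV)
    then show ?thesis by (simp only: UV True gpath_True)
  next
    case False
    then have vs: "vs \<noteq> []" and p: "p \<in> lattice_paths (length U - 1) (length vs - 1)"
      using Cons.prems(1) by (auto simp: UV lattice_paths_def)
    have IH: "variations (map F (gpath f U vs p)) \<le> variations (map g U)"
      by (rule Cons.IH[OF p Cons.prems(2) vs]) (rule Cons.prems(4), auto simp: UV)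
    have "F (f u v) = F (f u (hd vs))"
      by (rule Cons.prems(4)) (use vs in \<open>auto simp: UV\<close>)
    then have "variations (map F (f u v # gpath f U vs p)) \<le> variations (map g U)"
      using IH unfolding variations_map_gpath_Cons[OF Cons.prems(2) vs] by (simp add: UV)
    then show ?thesis using False by (simp add: UV gpath_False)
  qed
qed

lemma variations_gpath_right:
  assumes "p \<in> lattice_paths (length U - 1) (length V - 1)" "U \<noteq> []" "V \<noteq> []"
    and "\<And>u u' v v'. \<lbrakk>u \<in> set U; u' \<in> set U; v \<in> set V; v' \<in> set V; g v = g v'\<rbrakk> \<Longrightarrow> F (f u v) = F (f u' v')"
  shows "variations (map F (gpath f U V p)) \<le> variations (map g V)"
  using assms
proof (induction p arbitrary: U V)
  case Nil
  then show ?case by (simp add: gpath_def)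
next
  case (Cons b p)
  obtain u us v vs where UV: "U = u # us" "V = v # vs"
    using Cons.prems(2,3) by (cases U; cases V) auto
  show ?case
  proof (cases b)
    case True
    then have us: "us \<noteq> []" and p: "p \<in> lattice_paths (length us - 1) (length V - 1)"
      using Cons.prems(1) by (auto simp: UV lattice_paths_def)
    have IH: "variations (map F (gpath f us V p)) \<le> variations (map g V)"
      by (rule Cons.IH[OF p us Cons.prems(3)]) (rule Cons.prems(4), auto simp: UV)
    have "F (f u v) = F (f (hd us) v)"
      by (rule Cons.prems(4)) (use us in \<open>auto simp: UV\<close>)
    then have "variations (map F (f u v # gpath f us V p)) \<le> variations (map g V)"
      using IH unfolding variations_map_gpath_Cons[OF us Cons.prems(3)] by (simp add: UV)
    then show ?thesis by (simp only: UV True gpath_True)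
  next
    case False
    then have vs: "vs \<noteq> []" and p: "p \<in> lattice_paths (length U - 1) (length vs - 1)"
      using Cons.prems(1) by (auto simp: UV lattice_paths_def)
    have IH: "variations (map F (gpath f U vs p)) \<le> variations (map g vs)"
      by (rule Cons.IH[OF p Cons.prems(2) vs]) (rule Cons.prems(4), auto simp: UV)
    have "F (f u v) = F (f u (hd vs))" if "g v = g (hd vs)"
      by (rule Cons.prems(4)) (use vs that in \<open>auto simp: UV\<close>)
    then have "variations (map F (f u v # gpath f U vs p)) \<le> variations (map g (v # vs))"
      using IH unfolding variations_map_gpath_Cons[OF Cons.prems(2) vs] variations_map_Cons[OF vs]
      by (simp add: UV)
    then show ?thesis using False by (simp add: UV gpath_False)
  qed
qed

section \<open>Restriction to two letters\<close>

lemma restrict_word_commute: "restrict_word i j = restrict_word j i"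
  by (auto simp: restrict_word_def fun_eq_iff intro!: filter_cong)

lemma restrict_word_Nil [simp]: "restrict_word i j [] = []"
  and restrict_word_append: "restrict_word i j (u @ v) = restrict_word i j u @ restrict_word i j v"
  and restrict_word_Cons: "restrict_word i j (x # u) =
    (if x = i \<or> x = j then x # restrict_word i j u else restrict_word i j u)"
  by (simp_all add: restrict_word_def)

lemma restrict_word_map:
  assumes "inj f"
  shows "restrict_word (f i) (f j) (map f w) = map f (restrict_word i j w)"
  by (simp add: restrict_word_def filter_map o_def inj_eq[OF assms])

lemma filter_eq_distinct: "distinct l \<Longrightarrow> filter (\<lambda>z. z = a) l = (if a \<in> set l then [a] else [])"
  by (induction l) auto

lemma restrict_word_perm_comp_block:
  assumes "u \<in> perms r" "1 \<le> k" "k \<le> r" "v \<in> perms s"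
    and "k \<le> i" "i < k + s" "k \<le> j" "j < k + s"
  shows "restrict_word i j (perm_comp k u v)
    = map (\<lambda>y. y + k - 1) (restrict_word (i - k + 1) (j - k + 1) v)"
proof -
  obtain A B where u: "u = A @ k # B"
    using assms(1-3) by (metis atLeastAtMost_iff perms_iff split_list)
  have AB: "k \<notin> set A" "k \<notin> set B" using assms(1) by (auto simp: u perms_iff)
  have len: "length v = s" by (rule length_perms[OF assms(4)])
  have 0: "restrict_word i j (map (\<lambda>x. if x > k then x + length v - 1 else x) C) = []"
    if "k \<notin> set C" for C
    using that assms len by (auto simp: restrict_word_def filter_empty_conv)
  have "y + k - 1 = i \<longleftrightarrow> y = i - k + 1" "y + k - 1 = j \<longleftrightarrow> y = j - k + 1" if "y \<in> set v" for y
    using that assms by (auto simp: perms_iff)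
  then have "filter (\<lambda>y. y + k - 1 = i \<or> y + k - 1 = j) v
      = filter (\<lambda>y. y = i - k + 1 \<or> y = j - k + 1) v"
    by (intro filter_cong) blast+
  then have "restrict_word i j (map (\<lambda>y. y + k - 1) v)
      = map (\<lambda>y. y + k - 1) (restrict_word (i - k + 1) (j - k + 1) v)"
    by (simp add: restrict_word_def filter_map o_def)
  then show ?thesis
    using 0[OF AB(1)] 0[OF AB(2)] unfolding u perm_comp_split[OF AB] by (simp add: restrict_word_append)
qed

text \<open>The value of the outer permutation from which a value of the composite at
  \<open>k\<close> originates: the whole inserted block goes to \<open>k\<close>.\<close>

definition collapse :: "nat \<Rightarrow> nat \<Rightarrow> nat \<Rightarrow> nat" where
  "collapse s k x = (if x < k then x else if x < k + s then k else x - s + 1)"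

text \<open>If \<open>i\<close> and \<open>j\<close> have different origins, at most one of them
  lies in the inserted block, and the block contributes that value exactly once, like the letter
  \<open>k\<close> it replaces. So the restricted composite is a relabelling of a restriction of
  \<open>u\<close>.\<close>

lemma restrict_word_perm_comp:
  assumes "set u \<subseteq> {1..r}" "1 \<le> k" "v \<in> perms s" "1 \<le> s"
    and "collapse s k i \<noteq> collapse s k j"
  shows "restrict_word i j (perm_comp k u v)
    = map (\<lambda>x. if x = collapse s k i then i else j) (restrict_word (collapse s k i) (collapse s k j) u)"
proof -
  have len: "length v = s" by (rule length_perms[OF assms(3)])
  have blk: "restrict_word a b (map (\<lambda>y. y + k - 1) v) = (if k \<le> a \<and> a < k + s then [a] else [])"
    if "\<not> (k \<le> b \<and> b < k + s)" for a b
  proof -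
    have "distinct (map (\<lambda>y. y + k - 1) v)"
      using assms(3) by (auto simp: perms_iff distinct_map inj_on_def)
    moreover have set: "set (map (\<lambda>y. y + k - 1) v) = {k..<k + s}"
    proof -
      have "x \<in> (\<lambda>y. y + k - 1) ` {1..s}" if "x \<in> {k..<k + s}" for x
        using that assms(2) by (intro image_eqI[of _ _ "x - k + 1"]) auto
      then show ?thesis using assms(2,3) by (auto simp: perms_iff)
    qed
    moreover have "restrict_word a b (map (\<lambda>y. y + k - 1) v) = filter (\<lambda>z. z = a) (map (\<lambda>y. y + k - 1) v)"
      unfolding restrict_word_def using that set by (intro filter_cong) auto
    ultimately show ?thesis by (simp add: filter_eq_distinct)
  qed
  have single: "restrict_word i j (perm_comp k [x] v) = map (\<lambda>x. if x = collapse s k i then i else j)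
      (restrict_word (collapse s k i) (collapse s k j) [x])" if "x \<in> {1..r}" for x
  proof (cases "x = k")
    case True
    have pc: "perm_comp k [x] v = map (\<lambda>y. y + k - 1) v"
      using True by (simp add: perm_comp_Cons)
    show ?thesis
    proof (cases "k \<le> j \<and> j < k + s")
      case j: True
      then have cj: "collapse s k j = k" by (simp add: collapse_def)
      then have "\<not> (k \<le> i \<and> i < k + s)" using assms(5) by (auto simp: collapse_def)
      then have "restrict_word i j (perm_comp k [x] v) = [j]"
        using blk[of i j] j unfolding pc restrict_word_commute[of i j] by simp
      then show ?thesis using True assms(5) by (simp add: cj restrict_word_Cons)
    next
      case False
      then have "restrict_word i j (perm_comp k [x] v) = (if k \<le> i \<and> i < k + s then [i] else [])"
        unfolding pc by (rule blk)
      moreover have "collapse s k j \<noteq> k" using False assms(4) by (auto simp: collapse_def)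
      moreover have "collapse s k i = k \<longleftrightarrow> k \<le> i \<and> i < k + s"
        using assms(4) by (auto simp: collapse_def)
      ultimately show ?thesis using True by (auto simp: restrict_word_Cons)
    qed
  next
    case False
    define x' where "x' = (if x > k then x + s - 1 else x)"
    have "x' = a \<longleftrightarrow> x = collapse s k a" for a
      using False assms(2,4) unfolding x'_def collapse_def by (cases "x > k") (simp; linarith)+
    moreover have "perm_comp k [x] v = [x']"
      using False len by (simp add: perm_comp_Cons x'_def)
    ultimately show ?thesis by (auto simp: restrict_word_Cons)
  qed
  show ?thesis using assms(1)
  proof (induction u)
    case (Cons x u)
    then have x: "x \<in> {1..r}" and IH: "restrict_word i j (perm_comp k u v)
      = map (\<lambda>x. if x = collapse s k i then i else j) (restrict_word (collapse s k i) (collapse s k j) u)"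
      by auto
    have "restrict_word i j (perm_comp k (x # u) v)
      = restrict_word i j (perm_comp k [x] v) @ restrict_word i j (perm_comp k u v)"
      using perm_comp_append[of k "[x]" u v] by (simp add: restrict_word_append)
    moreover have "restrict_word a b (x # u) = restrict_word a b [x] @ restrict_word a b u" for a b
      by (simp add: restrict_word_Cons)
    ultimately show ?case unfolding single[OF x] IH by simp
  qed simp
qed

section \<open>The filtered Barratt-Eccles operad\<close>

text \<open>Quantified over ordered pairs \<open>i \<noteq> j\<close> rather than
  \<open>i < j\<close>, because neither the relabelling by a permutation nor \<open>collapse\<close>
  can be relied on to preserve the order of a pair.\<close>

definition pair_bounded :: "(nat \<Rightarrow> nat \<Rightarrow> nat) \<Rightarrow> enat \<Rightarrow> nat \<Rightarrow> bool" where
  "pair_bounded V n r \<longleftrightarrow> (\<forall>i\<in>{1..r}. \<forall>j\<in>{1..r}. i \<noteq> j \<longrightarrow> enat (V i j) < n)"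

lemma pair_bounded_sym:
  assumes "\<And>i j. V i j = V j i"
  shows "pair_bounded V n r \<longleftrightarrow> (\<forall>i j. 1 \<le> i \<and> i < j \<and> j \<le> r \<longrightarrow> enat (V i j) < n)"
proof
  assume *: "\<forall>i j. 1 \<le> i \<and> i < j \<and> j \<le> r \<longrightarrow> enat (V i j) < n"
  have "enat (V i j) < n" if "i \<in> {1..r}" "j \<in> {1..r}" "i \<noteq> j" for i j
    using *[rule_format, of i j] *[rule_format, of j i] that assms[of i j]
    by (cases "i < j") auto
  then show "pair_bounded V n r" by (simp add: pair_bounded_def)
qed (auto simp: pair_bounded_def)

definition be_var :: "simplex \<Rightarrow> nat \<Rightarrow> nat \<Rightarrow> nat" where
  "be_var W i j = variations (map (restrict_word i j) W)"

definition be_fil :: "enat \<Rightarrow> nat \<Rightarrow> nat \<Rightarrow> simplex set" where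
  "be_fil n r d = {W \<in> be_simplices r d. pair_bounded (be_var W) n r}"

lemma be_fil_alt: "be_fil n r d = {W \<in> be_simplices r d.
      \<forall>i j. 1 \<le> i \<and> i < j \<and> j \<le> r \<longrightarrow> enat (variations (map (restrict_word i j) W)) < n}"
  unfolding be_fil_def
  by (subst pair_bounded_sym) (auto simp: be_var_def restrict_word_commute)

lemma be_fil_subset: "be_fil n r d \<subseteq> be_simplices r d"
  by (auto simp: be_fil_def)

lemma be_filD:
  "\<lbrakk>W \<in> be_fil n r d; i \<in> {1..r}; j \<in> {1..r}; i \<noteq> j\<rbrakk> \<Longrightarrow> enat (be_var W i j) < n"
  unfolding be_fil_def pair_bounded_def by blast

lemma be_filI:
  assumes "W \<in> be_simplices r d"
    and "\<And>i j. \<lbrakk>i \<in> {1..r}; j \<in> {1..r}; i \<noteq> j\<rbrakk> \<Longrightarrow> enat (be_var W i j) < n"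
  shows "W \<in> be_fil n r d"
  using assms unfolding be_fil_def pair_bounded_def by blast

lemma be_fil_mono:
  assumes "W \<in> be_fil n r d" "W' \<in> be_simplices r d'"
    and "\<And>i j. \<lbrakk>i \<in> {1..r}; j \<in> {1..r}; i \<noteq> j\<rbrakk> \<Longrightarrow> be_var W' i j \<le> be_var W i j"
  shows "W' \<in> be_fil n r d'"
proof -
  have "enat (be_var W' i j) < n" if "i \<in> {1..r}" "j \<in> {1..r}" "i \<noteq> j" for i j
    using assms(1) assms(3)[OF that] that
    by (auto simp: be_fil_def pair_bounded_def intro: le_less_trans[of _ "enat (be_var W i j)"])
  then show ?thesis using assms(2) by (simp add: be_fil_def pair_bounded_def)
qed

lemma be_fil_bdry:
  assumes "W \<in> be_fil n r (Suc d)"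
  shows "keys (be_bdry W) \<subseteq> be_fil n r d"
  unfolding be_bdry_def
proof (intro keys_sum_subset keys_cmul_subset subsetI)
  fix i W' assume i: "i \<in> {..<length W}" and W': "W' \<in> keys (be_class (delete_nth i W))"
  have eq: "W' = delete_nth i W" and nd: "distinct_adj W'"
    using W' keys_be_class[of "delete_nth i W"] by auto
  have "W' \<in> be_simplices r d"
    using assms i nd set_delete_nth[of i W] by (auto simp: eq be_fil_def be_simplices_iff)
  then show "W' \<in> be_fil n r d"
    by (rule be_fil_mono[OF assms])
      (auto simp: eq be_var_def map_delete_nth intro: variations_subseq subseq_delete_nth)
qed

lemma be_fil_map:
  assumes "\<sigma> permutes {1..r}" "W \<in> be_fil n r d"
  shows "keys (be_class (map (map \<sigma>) W)) \<subseteq> be_fil n r d"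
proof
  fix W' assume W': "W' \<in> keys (be_class (map (map \<sigma>) W))"
  then have eq: "W' = map (map \<sigma>) W" and nd: "distinct_adj W'"
    using keys_be_class[of "map (map \<sigma>) W"] by auto
  have W: "W' \<in> be_simplices r d"
    using assms nd map_permutes_perms[OF assms(1)] by (auto simp: eq be_fil_def be_simplices_iff)
  have "enat (be_var W' i j) < n" if ij: "i \<in> {1..r}" "j \<in> {1..r}" "i \<noteq> j" for i j
  proof -
    obtain i' j' where i': "i = \<sigma> i'" "i' \<in> {1..r}" and j': "j = \<sigma> j'" "j' \<in> {1..r}"
      using permutes_image[OF assms(1)] ij by blast
    have "be_var W' i j = variations (map (map \<sigma>) (map (restrict_word i' j') W))"
      by (simp add: be_var_def eq i'(1) j'(1) restrict_word_map[OF permutes_inj[OF assms(1)]] o_def)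
    also have "\<dots> \<le> be_var W i' j'"
      unfolding be_var_def by (rule variations_map_le)
    finally have "enat (be_var W' i j) \<le> enat (be_var W i' j')" by simp
    moreover have "enat (be_var W i' j') < n"
      using be_filD[OF assms(2) i'(2) j'(2)] i' j' ij(3) by blast
    ultimately show ?thesis by (rule le_less_trans)
  qed
  then show "W' \<in> be_fil n r d" using W by (simp add: be_fil_def pair_bounded_def)
qed

lemma collapse_range: "1 \<le> k \<Longrightarrow> k \<le> r \<Longrightarrow> 1 \<le> s \<Longrightarrow> i \<in> {1..r + s - 1} \<Longrightarrow> collapse s k i \<in> {1..r}"
  by (auto simp: collapse_def)

text \<open>Two values of the composite either lie in the same block, and then their relative order
  along a path depends on \<open>V\<close> alone, or have different origins, and then it depends on
  \<open>U\<close> alone. Variations of \<open>U\<close> and \<open>V\<close> are therefore never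
  added up.\<close>

lemma be_fil_pcomp:
  assumes "1 \<le> k" "k \<le> r" "1 \<le> s" "U \<in> be_fil n r d" "V \<in> be_fil n s e"
  shows "keys (be_pcomp k U V) \<subseteq> be_fil n (r + s - 1) (d + e)"
proof
  fix X assume X: "X \<in> keys (be_pcomp k U V)"
  have UV: "U \<in> be_simplices r d" "V \<in> be_simplices s e" using assms be_fil_subset by auto
  then have ne: "U \<noteq> []" "V \<noteq> []" by (auto simp: be_simplices_iff)
  have XS: "X \<in> be_simplices (r + s - 1) (d + e)"
    using X be_pcomp_chains[OF assms(1-3) UV] by auto
  from X have "X \<in> (\<Union>p\<in>lattice_paths (length U - 1) (length V - 1). keys (be_class (path_simplex k U V p)))"
    unfolding be_pcomp_def
    using keys_sum_subset[of "lattice_paths (length U - 1) (length V - 1)"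
        "\<lambda>p. frag_cmul (shuffle_sign p) (be_class (path_simplex k U V p))"
        "\<Union>p\<in>lattice_paths (length U - 1) (length V - 1). keys (be_class (path_simplex k U V p))"]
    by (auto simp del: keys_cmul_iff intro: keys_cmul_subset dest!: subsetD)
  then obtain p where p: "p \<in> lattice_paths (length U - 1) (length V - 1)"
    and "X \<in> keys (be_class (path_simplex k U V p))" by auto
  then have eq: "X = gpath (perm_comp k) U V p"
    using keys_be_class path_simplex_gpath by fastforce
  have perms: "u \<in> perms r" if "u \<in> set U" for u using UV(1) that by (auto simp: be_simplices_iff)
  have perms': "v \<in> perms s" if "v \<in> set V" for v using UV(2) that by (auto simp: be_simplices_iff)
  have "enat (be_var X i j) < n" if ij: "i \<in> {1..r + s - 1}" "j \<in> {1..r + s - 1}" "i \<noteq> j" for i j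
  proof (cases "collapse s k i = collapse s k j")
    case True
    then have b: "k \<le> i" "i < k + s" "k \<le> j" "j < k + s"
      using ij(3) assms(3) by (auto simp: collapse_def split: if_splits)
    have "be_var X i j \<le> be_var V (i - k + 1) (j - k + 1)"
      unfolding be_var_def eq
      by (rule variations_gpath_right[OF p ne])
        (simp only: restrict_word_perm_comp_block[OF perms assms(1,2) perms' b])
    moreover have "enat (be_var V (i - k + 1) (j - k + 1)) < n"
      using assms(5) b ij(3) by (auto simp: be_fil_def pair_bounded_def)
    ultimately show ?thesis using le_less_trans enat_ord_simps(1) by metis
  next
    case False
    have su: "set u \<subseteq> {1..r}" if "u \<in> set U" for u using perms[OF that] by (simp add: perms_iff)
    have "be_var X i j \<le> be_var U (collapse s k i) (collapse s k j)"
      unfolding be_var_def eq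
      by (rule variations_gpath_left[OF p ne])
        (simp only: restrict_word_perm_comp[OF su assms(1) perms' assms(3) False])
    moreover have "enat (be_var U (collapse s k i) (collapse s k j)) < n"
      using assms(4) False collapse_range[OF assms(1-3)] ij by (auto simp: be_fil_def pair_bounded_def)
    ultimately show ?thesis using le_less_trans enat_ord_simps(1) by metis
  qed
  then show "X \<in> be_fil n (r + s - 1) (d + e)"
    using XS by (simp add: be_fil_def pair_bounded_def)
qed

lemma be_filtration_simps [simp]:
  "chains (be_filtration n) = (\<lambda>r d. {c. keys c \<subseteq> be_fil n r d})"
  "bdry (be_filtration n) = (\<lambda>r. frag_extend be_bdry)"
  "act (be_filtration n) = (\<lambda>r \<sigma>. be_map (map \<sigma>))"
  "pcomp (be_filtration n) = (\<lambda>r s k. ez k)"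
  "opunit (be_filtration n) = frag_of [[1]]"
  by (simp_all add: be_filtration_def barratt_eccles_def be_fil_alt be_map_def ez_def bilin_def fun_eq_iff)

lemma be_fil_chains: "x \<in> {c. keys c \<subseteq> be_fil n r d} \<Longrightarrow> x \<in> be_chains r d"
  using be_fil_subset by blast

lemma dg_operad_be_filtration: "dg_operad (be_filtration n)"
proof (unfold_locales; unfold be_filtration_simps)
  fix r d and x y :: "simplex \<Rightarrow>\<^sub>0 int"
  show "0 \<in> {c. keys c \<subseteq> be_fil n r d}" by simp
  show "x + y \<in> {c. keys c \<subseteq> be_fil n r d}"
    if "x \<in> {c. keys c \<subseteq> be_fil n r d}" "y \<in> {c. keys c \<subseteq> be_fil n r d}"
    using that by (simp add: keys_add_subset)
  show "- x \<in> {c. keys c \<subseteq> be_fil n r d}" if "x \<in> {c. keys c \<subseteq> be_fil n r d}"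
    using that by simp
  show "frag_extend be_bdry x \<in> {c. keys c \<subseteq> be_fil n r d}"
    if "x \<in> {c. keys c \<subseteq> be_fil n r (Suc d)}"
    using that be_fil_bdry unfolding mem_Collect_eq by (intro keys_extend_subset) blast
  show "frag_extend be_bdry x = 0" if "x \<in> {c. keys c \<subseteq> be_fil n r 0}"
    using bd_degree_0 be_chains_nd be_fil_chains[OF that] by blast
  show "frag_extend be_bdry (x + y) = frag_extend be_bdry x + frag_extend be_bdry y"
    by (rule frag_extend_add)
  show "frag_extend be_bdry (frag_extend be_bdry x) = 0" by (rule bd_bd)
  show "be_map (map id) x = x" if "x \<in> {c. keys c \<subseteq> be_fil n r d}"
    using be_map_id[OF be_fil_chains[OF that]] by simp
  fix \<sigma> assume \<sigma>: "\<sigma> permutes {1..r}"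
  show "be_map (map \<sigma>) x \<in> {c. keys c \<subseteq> be_fil n r d}" if "x \<in> {c. keys c \<subseteq> be_fil n r d}"
    using that be_fil_map[OF \<sigma>] unfolding be_map_def mem_Collect_eq
    by (intro keys_extend_subset) blast
  show "be_map (map \<sigma>) (x + y) = be_map (map \<sigma>) x + be_map (map \<sigma>) y"
    by (simp add: be_map_def frag_extend_add)
  show "be_map (map \<sigma>) (be_map (map \<tau>) x) = be_map (map (\<sigma> \<circ> \<tau>)) x" for \<tau>
    by (simp add: be_map_comp)
  show "frag_extend be_bdry (be_map (map \<sigma>) x) = be_map (map \<sigma>) (frag_extend be_bdry x)"
    by (rule be_map_bd)
next
  fix k r s d e and x x' y y' :: "simplex \<Rightarrow>\<^sub>0 int"
  assume k: "1 \<le> k" "k \<le> r" "1 \<le> s"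
    and x: "x \<in> {c. keys c \<subseteq> be_fil n r d}" and y: "y \<in> {c. keys c \<subseteq> be_fil n s e}"
  show "ez k x y \<in> {c. keys c \<subseteq> be_fil n (r + s - 1) (d + e)}"
    unfolding ez_def mem_Collect_eq
    by (rule order_trans[OF keys_bilin]) (use x y be_fil_pcomp[OF k] in blast)
  show "ez k (x + x') y = ez k x y + ez k x' y" "ez k x (y + y') = ez k x y + ez k x y'"
    by (simp_all add: ez_simps)
  show "frag_extend be_bdry (ez k x y)
      = ez k (frag_extend be_bdry x) y + signed d (ez k x (frag_extend be_bdry y))"
    unfolding signed_cmul
    by (rule leibniz[OF be_chains_nd[OF be_fil_chains[OF x]] be_chains_nd[OF be_fil_chains[OF y]]])
  show "ez (\<sigma> k) (be_map (map \<sigma>) x) (be_map (map \<tau>) y)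
      = be_map (map (block_perm s k \<sigma> \<tau>)) (ez k x y)"
    if "\<sigma> permutes {1..r}" "\<tau> permutes {1..s}" for \<sigma> \<tau>
    by (rule be_map_ez[OF be_fil_chains[OF x] be_fil_chains[OF y] that])
next
  fix k l r s t d e f and x y z :: "simplex \<Rightarrow>\<^sub>0 int"
  assume kl: "1 \<le> k" "k \<le> r" "1 \<le> l" "l \<le> s" "1 \<le> t"
    and x: "x \<in> {c. keys c \<subseteq> be_fil n r d}" and y: "y \<in> {c. keys c \<subseteq> be_fil n s e}"
    and z: "z \<in> {c. keys c \<subseteq> be_fil n t f}"
  show "ez (k + l - 1) (ez k x y) z = ez k x (ez l y z)"
    by (rule ez_sequential[OF kl be_fil_chains[OF x] be_fil_chains[OF y] be_fil_chains[OF z]])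
next
  fix i k r s t d e f and x y z :: "simplex \<Rightarrow>\<^sub>0 int"
  assume ik: "1 \<le> i" "i < k" "k \<le> r" "1 \<le> s" "1 \<le> t"
    and x: "x \<in> {c. keys c \<subseteq> be_fil n r d}" and y: "y \<in> {c. keys c \<subseteq> be_fil n s e}"
    and z: "z \<in> {c. keys c \<subseteq> be_fil n t f}"
  show "ez i (ez k x y) z = signed (e * f) (ez (k + t - 1) (ez i x z) y)"
    unfolding signed_cmul
    by (rule ez_parallel[OF ik be_fil_chains[OF x] be_fil_chains[OF y] be_fil_chains[OF z]])
next
  show "frag_of [[1]] \<in> {c. keys c \<subseteq> be_fil n 1 0}"
    by (simp add: be_fil_def be_simplices_iff perms_iff pair_bounded_def)
next
  fix s e and y :: "simplex \<Rightarrow>\<^sub>0 int"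
  assume "y \<in> {c. keys c \<subseteq> be_fil n s e}"
  then show "ez 1 (frag_of [[1]]) y = y" by (rule ez_unit_left[OF be_fil_chains])
next
  fix k r d :: nat and x :: "simplex \<Rightarrow>\<^sub>0 int"
  assume "1 \<le> k" "x \<in> {c. keys c \<subseteq> be_fil n r d}"
  then show "ez k x (frag_of [[1]]) = x" using ez_unit_right[OF be_fil_chains] by blast
qed

section \<open>Letterwise operations on words\<close>

definition pre :: "nat \<Rightarrow> (nat list \<Rightarrow>\<^sub>0 int) \<Rightarrow> nat list \<Rightarrow>\<^sub>0 int" where
  "pre a = frag_extend (\<lambda>u. frag_of (a # u))"

text \<open>\<open>drp a\<close> forgets the value \<open>a\<close>; surjections in which \<open>a\<close> is repeated would lose degrees and
  are sent to \<open>0\<close>.\<close>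

definition drp_word :: "nat \<Rightarrow> nat list \<Rightarrow> nat list \<Rightarrow>\<^sub>0 int" where
  "drp_word a u = (if count_list u a = 1 then frag_of (removeAll a u) else 0)"

definition drp :: "nat \<Rightarrow> (nat list \<Rightarrow>\<^sub>0 int) \<Rightarrow> nat list \<Rightarrow>\<^sub>0 int" where
  "drp a = frag_extend (drp_word a)"

text \<open>The surjection boundary before passing to classes. Since \<open>sj_sign\<close> is 0 at
  the only occurrence of a value, no term loses a letter, so neither the arity nor surjectivity has
  to be mentioned.\<close>

definition word_bdry :: "nat list \<Rightarrow> nat list \<Rightarrow>\<^sub>0 int" where
  "word_bdry u = (\<Sum>i<length u. frag_cmul (sj_sign u i) (frag_of (delete_nth i u)))"

abbreviation wbd :: "(nat list \<Rightarrow>\<^sub>0 int) \<Rightarrow> nat list \<Rightarrow>\<^sub>0 int" where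
  "wbd \<equiv> frag_extend word_bdry"

lemma pre_simps [simp]: "pre a 0 = 0" "pre a (frag_of u) = frag_of (a # u)"
  and pre_add: "pre a (x + y) = pre a x + pre a y"
  and pre_diff: "pre a (x - y) = pre a x - pre a y"
  and pre_cmul: "pre a (frag_cmul m x) = frag_cmul m (pre a x)"
  by (simp_all add: pre_def frag_extend_add frag_extend_diff frag_extend_minus frag_extend_cmul)

lemma pre_sum: "finite I \<Longrightarrow> pre a (sum f I) = (\<Sum>i\<in>I. pre a (f i))"
  by (induction rule: finite_induct) (simp_all add: pre_add)

lemma drp_simps [simp]: "drp a 0 = 0" "drp a (frag_of u) = drp_word a u"
  and drp_add: "drp a (x + y) = drp a x + drp a y"
  and drp_diff: "drp a (x - y) = drp a x - drp a y"
  by (simp_all add: drp_def frag_extend_add frag_extend_diff frag_extend_minus)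

lemma keys_pre: "keys (pre a x) \<subseteq> (#) a ` keys x"
  unfolding pre_def by (rule keys_extend_subset) auto

lemma keys_pre_subset: "(\<And>u. u \<in> keys x \<Longrightarrow> a # u \<in> S) \<Longrightarrow> keys (pre a x) \<subseteq> S"
  using keys_pre[of a x] by blast

lemma keys_drp: "keys (drp a x) \<subseteq> removeAll a ` {u \<in> keys x. count_list u a = 1}"
  unfolding drp_def by (rule keys_extend_subset) (auto simp: drp_word_def)

lemma frag_extend_pre: "frag_extend f (pre a x) = frag_extend (\<lambda>u. f (a # u)) x"
  by (simp add: pre_def frag_extend_extend)

lemma drp_pre_other: "b \<noteq> a \<Longrightarrow> drp a (pre b x) = pre b (drp a x)"
  unfolding drp_def frag_extend_pre pre_def frag_extend_extend
  by (intro frag_extend_eq) (auto simp: drp_word_def)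

lemma drp_pre_same:
  assumes "\<And>u. u \<in> keys x \<Longrightarrow> a \<notin> set u"
  shows "drp a (pre a x) = x"
proof -
  have "drp a (pre a x) = frag_extend frag_of x"
    unfolding drp_def frag_extend_pre
    by (intro frag_extend_eq) (use assms in \<open>auto simp: drp_word_def count_list_0_iff\<close>)
  then show ?thesis by simp
qed

lemma drp_pre_repeated:
  assumes "\<And>u. u \<in> keys x \<Longrightarrow> a \<in> set u"
  shows "drp a (pre a x) = 0"
  unfolding drp_def frag_extend_pre
  by (intro frag_extend_eq_0) (use assms in \<open>auto simp: drp_word_def count_list_0_iff\<close>)

section \<open>The boundary of a word\<close>

lemma caesura_0: "caesura (a # u) 0 \<longleftrightarrow> a \<in> set u"
  by (auto simp: caesura_def in_set_conv_nth gr0_conv_Suc Suc_less_eq2 nth_Cons')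

lemma caesura_Suc: "caesura (a # u) (Suc i) \<longleftrightarrow> caesura u i"
proof
  assume "caesura (a # u) (Suc i)"
  then obtain j where "Suc i < j" "j < length (a # u)" "(a # u) ! j = (a # u) ! Suc i"
    by (auto simp: caesura_def)
  then show "caesura u i" unfolding caesura_def
    by (intro conjI exI[of _ "j - 1"]) (auto simp: nth_Cons')
next
  assume "caesura u i"
  then show "caesura (a # u) (Suc i)" unfolding caesura_def
    by (metis Suc_mono length_Cons nth_Cons_Suc)
qed

lemma caesura_sign_0: "caesura_sign u 0 = 1"
  by (simp add: caesura_sign_def)

lemma caesura_sign_Suc:
  "caesura_sign (a # u) (Suc i) = (if a \<in> set u then - caesura_sign u i else caesura_sign u i)"
proof -
  have "{j. j < Suc i \<and> caesura (a # u) j}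
      = (if a \<in> set u then {0} else {}) \<union> Suc ` {j. j < i \<and> caesura u j}" (is "?L = ?R")
  proof (rule Set.set_eqI)
    show "j \<in> ?L \<longleftrightarrow> j \<in> ?R" for j
      by (cases j) (auto simp: caesura_0 caesura_Suc)
  qed
  moreover have "finite {j. j < i \<and> caesura u j}" by simp
  ultimately show ?thesis
    unfolding caesura_sign_def by (simp add: card_image)
qed

lemma Max_Suc_image: "finite A \<Longrightarrow> A \<noteq> {} \<Longrightarrow> Max (Suc ` A) = Suc (Max A)"
  by (simp add: mono_Max_commute mono_Suc)

lemma sj_sign_0: "sj_sign (a # u) 0 = (if a \<in> set u then 1 else 0)"
  by (simp add: sj_sign_def caesura_0 caesura_sign_0)

text \<open>If \<open>a\<close> recurs in \<open>u\<close>, the new first letter is a caesura with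
  sign \<open>+\<close> and reverses the sign of every later caesura, hence also of the last
  occurrences attached to them. The exception is a letter \<open>a\<close> with only one occurrence
  in \<open>u\<close>: its sign was 0, and it becomes the last occurrence attached to the new
  caesura, with sign \<open>-1\<close>.\<close>

lemma sj_sign_Suc:
  assumes "i < length u"
  shows "sj_sign (a # u) (Suc i) =
    (if a \<in> set u then (if u ! i = a \<and> count_list u a = 1 then - 1 else - sj_sign u i)
     else sj_sign u i)"
proof (cases "caesura u i")
  case True
  then obtain j where j: "i < j" "j < length u" "u ! j = u ! i" by (auto simp: caesura_def)
  have "count_list u a \<noteq> 1" if "u ! i = a"
  proof -
    have "count_list (take (Suc i) u) a \<ge> 1" "count_list (drop (Suc i) u) a \<ge> 1"
      using j that by (auto simp: Suc_le_eq count_list_0_iff in_set_conv_nth take_Suc_conv_app_nth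
          simp flip: neq0_conv intro!: exI[of _ "j - Suc i"])
    then show ?thesis
      using count_list_append[of "take (Suc i) u" "drop (Suc i) u" a] by simp
  qed
  then show ?thesis using True
    by (auto simp: sj_sign_def caesura_Suc caesura_sign_Suc)
next
  case False
  let ?P = "{j. j < i \<and> u ! j = u ! i}"
  have eq: "{j. j < Suc i \<and> (a # u) ! j = (a # u) ! Suc i}
      = (if u ! i = a then {0} else {}) \<union> Suc ` ?P" (is "?L = ?R")
  proof (rule Set.set_eqI)
    show "j \<in> ?L \<longleftrightarrow> j \<in> ?R" for j by (cases j) auto
  qed
  have fin: "finite ?P" by simp
  have ex: "(\<exists>j<Suc i. (a # u) ! j = (a # u) ! Suc i) \<longleftrightarrow> u ! i = a \<or> ?P \<noteq> {}"
    using eq by (auto simp: set_eq_iff)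
  show ?thesis
  proof (cases "?P = {}")
    case True
    have cnt: "count_list u a = 1" if "u ! i = a"
    proof -
      have "a \<notin> set (take i u)" using True that by (auto simp: in_set_conv_nth)
      moreover have "a \<notin> set (drop (Suc i) u)"
      proof
        assume "a \<in> set (drop (Suc i) u)"
        then obtain l where "l < length u - Suc i" "u ! (Suc i + l) = a"
          by (auto simp: in_set_conv_nth)
        then have "caesura u i"
          unfolding caesura_def using assms that by (intro conjI exI[of _ "Suc i + l"]) auto
        then show False using False by blast
      qed
      ultimately have "count_list (take i u @ u ! i # drop (Suc i) u) a = 1"
        using that by (simp add: count_list_0_iff)
      then show ?thesis using assms by (simp add: id_take_nth_drop[symmetric])
    qed
    have s0: "sj_sign u i = 0" using False True by (auto simp: sj_sign_def)
    show ?thesis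
    proof (cases "u ! i = a")
      case True
      then have "{j. j < Suc i \<and> (a # u) ! j = (a # u) ! Suc i} = {0}"
        unfolding eq \<open>?P = {}\<close> by (simp add: True)
      moreover have "a \<in> set u" using True assms by auto
      ultimately show ?thesis using True cnt False ex
        by (simp add: sj_sign_def caesura_Suc caesura_sign_0)
    next
      case False
      then have noex: "\<not> (\<exists>j<Suc i. (a # u) ! j = (a # u) ! Suc i)"
        using ex True by blast
      have "sj_sign (a # u) (Suc i) = 0"
        unfolding sj_sign_def caesura_Suc if_not_P[OF \<open>\<not> caesura u i\<close>] if_not_P[OF noex] ..
      then show ?thesis using False s0 by simp
    qed
  next
    case P: False
    then obtain j where j: "j < i" "u ! j = u ! i" by auto
    have cnt: "count_list u a \<noteq> 1" if "u ! i = a"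
    proof -
      have "a \<in> set (take i u)" "a \<in> set (drop i u)"
        using j that assms by (auto simp: in_set_conv_nth Cons_nth_drop_Suc[symmetric])
      then have "count_list (take i u) a \<ge> 1" "count_list (drop i u) a \<ge> 1"
        by (auto simp: Suc_le_eq count_list_0_iff simp flip: neq0_conv)
      then show ?thesis
        using count_list_append[of "take i u" "drop i u" a] by simp
    qed
    have "Max {j. j < Suc i \<and> (a # u) ! j = (a # u) ! Suc i} = Suc (Max ?P)"
    proof -
      have "Max (Suc ` ?P) = Suc (Max ?P)" by (rule Max_Suc_image[OF fin P])
      moreover have "Max (insert 0 (Suc ` ?P)) = max 0 (Max (Suc ` ?P))"
        by (rule Max_insert) (use fin P in blast)+
      ultimately show ?thesis unfolding eq by (cases "u ! i = a") simp_all
    qed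
    moreover have "\<exists>j<i. u ! j = u ! i" using j by blast
    ultimately show ?thesis using False P cnt ex
      by (auto simp: sj_sign_def caesura_Suc caesura_sign_Suc)
  qed
qed

lemma word_bdry_Nil [simp]: "word_bdry [] = 0"
  by (simp add: word_bdry_def)

lemma delete_nth_unique:
  "i < length u \<Longrightarrow> u ! i = a \<Longrightarrow> count_list u a = 1 \<Longrightarrow> delete_nth i u = removeAll a u"
proof (induction u arbitrary: i)
  case (Cons b u)
  then show ?case
    by (cases i) (auto simp: count_list_0_iff split: if_splits)
qed simp

lemma sj_sign_unique:
  assumes "i < length u" "count_list u (u ! i) = 1"
  shows "sj_sign u i = 0"
  using assms
proof (induction u arbitrary: i)
  case (Cons b u)
  show ?case
  proof (cases i)
    case 0
    then show ?thesis using Cons.prems by (simp add: sj_sign_0 count_list_0_iff)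
  next
    case (Suc j)
    then have "u ! j \<noteq> b \<and> count_list u (u ! j) = 1"
      using Cons.prems by (auto simp: count_list_0_iff split: if_splits)
    then show ?thesis using Suc Cons by (simp add: sj_sign_Suc)
  qed
qed simp

text \<open>The recursion that carries the signs of the boundary. The \<open>drp_word\<close> term
  is the deletion of a second and last \<open>a\<close>, which was not deletable in \<open>u\<close>
  but is in \<open>a # u\<close>; what remains is \<open>a\<close> followed by \<open>u\<close>
  without \<open>a\<close>.\<close>

lemma word_bdry_Cons:
  "word_bdry (a # u) =
    (if a \<in> set u then frag_of u - pre a (word_bdry u) - pre a (drp_word a u)
     else pre a (word_bdry u))"
proof -
  have *: "word_bdry (a # u) = frag_cmul (sj_sign (a # u) 0) (frag_of u)
      + (\<Sum>i<length u. frag_cmul (sj_sign (a # u) (Suc i)) (frag_of (a # delete_nth i u)))"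
    unfolding word_bdry_def by (simp add: sum.lessThan_Suc_shift del: sum.lessThan_Suc)
  have pre: "pre a (word_bdry u) = (\<Sum>i<length u. frag_cmul (sj_sign u i) (frag_of (a # delete_nth i u)))"
    unfolding word_bdry_def by (simp add: pre_sum pre_cmul)
  show ?thesis
  proof (cases "a \<in> set u")
    case False
    then show ?thesis unfolding * pre by (auto simp: sj_sign_0 sj_sign_Suc intro!: sum.cong)
  next
    case True
    have "(\<Sum>i<length u. frag_cmul (sj_sign (a # u) (Suc i)) (frag_of (a # delete_nth i u)))
      = (\<Sum>i<length u. (if u ! i = a \<and> count_list u a = 1 then - frag_of (a # delete_nth i u) else 0)
          - frag_cmul (sj_sign u i) (frag_of (a # delete_nth i u)))"
      using True by (intro sum.cong) (auto simp: sj_sign_Suc sj_sign_unique)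
    also have "\<dots> = (\<Sum>i<length u. (if u ! i = a \<and> count_list u a = 1 then - frag_of (a # delete_nth i u) else 0))
        - pre a (word_bdry u)"
      by (simp add: sum_subtractf pre)
    also have "(\<Sum>i<length u. (if u ! i = a \<and> count_list u a = 1 then - frag_of (a # delete_nth i u) else 0))
      = - pre a (drp_word a u)"
    proof (cases "count_list u a = 1")
      case 1: True
      obtain j where j: "j < length u" "u ! j = a" using True by (auto simp: in_set_conv_nth)
      have uniq: "i = j" if "i < length u" "u ! i = a" for i
      proof (rule ccontr)
        have two: "count_list u a \<noteq> 1" if "k < l" "l < length u" "u ! k = a" "u ! l = a" for k l
        proof -
          have "a \<in> set (take l u)" "a \<in> set (drop l u)"
            using that by (auto simp: in_set_conv_nth Cons_nth_drop_Suc[symmetric])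
          then have "count_list (take l u) a \<ge> 1" "count_list (drop l u) a \<ge> 1"
            by (auto simp: Suc_le_eq count_list_0_iff simp flip: neq0_conv)
          then show ?thesis
            using count_list_append[of "take l u" "drop l u" a] by simp
        qed
        assume "i \<noteq> j"
        then show False using two[of i j] two[of j i] that j 1 by (cases "i < j") auto
      qed
      have "(\<Sum>i<length u. (if u ! i = a \<and> count_list u a = 1 then - frag_of (a # delete_nth i u) else 0))
        = (\<Sum>i<length u. (if i = j then - frag_of (a # delete_nth j u) else 0))"
      proof (rule sum.cong[OF refl])
        fix i assume "i \<in> {..<length u}"
        then have i: "u ! i = a \<longleftrightarrow> i = j" using uniq[of i] j(2) by blast
        show "(if u ! i = a \<and> count_list u a = 1 then - frag_of (a # delete_nth i u) else 0)
          = (if i = j then - frag_of (a # delete_nth j u) else 0)"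
          unfolding i 1 by simp
      qed
      also have "\<dots> = - frag_of (a # delete_nth j u)" using j by simp
      finally show ?thesis using 1 j by (simp add: drp_word_def delete_nth_unique)
    qed (simp add: drp_word_def)
    finally show ?thesis using True unfolding * by (simp add: sj_sign_0 del: One_nat_def)
  qed
qed

lemma keys_word_bdry: "v \<in> keys (word_bdry u) \<Longrightarrow> set v = set u \<and> length u = Suc (length v)"
proof (induction u arbitrary: v)
  case (Cons a u)
  have sub: "keys (pre a (word_bdry u)) \<subseteq> {v. set v = insert a (set u) \<and> length u = length v}"
    by (rule keys_pre_subset) (use Cons.IH in auto)
  show ?case
  proof (cases "a \<in> set u")
    case True
    have "keys (pre a (drp_word a u)) \<subseteq> {v. set v = insert a (set u) \<and> length u = length v}"
    proof (rule keys_pre_subset)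
      fix w assume "w \<in> keys (drp_word a u)"
      then have w: "w = removeAll a u" "count_list u a = 1" by (auto simp: drp_word_def split: if_splits)
      obtain A B where u: "u = A @ a # B" using True by (meson split_list)
      then have "a \<notin> set A" "a \<notin> set B" using w(2) by (auto simp: count_list_0_iff)
      then show "a # w \<in> {v. set v = insert a (set u) \<and> length u = length v}"
        by (auto simp: w(1) u)
    qed
    then have "keys (word_bdry (a # u)) \<subseteq> {v. set v = insert a (set u) \<and> length u = length v}"
      unfolding word_bdry_Cons if_P[OF True]
      by (intro keys_diff_subset sub) (use True in auto)
    then show ?thesis using Cons.prems True by auto
  next
    case False
    then show ?thesis using Cons.prems sub by (auto simp: word_bdry_Cons)
  qed
qed simp

section \<open>Degenerate words\<close>

definition degenerate :: "nat list set" where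
  "degenerate = {u. \<not> distinct_adj u}"

lemma degenerate_Cons: "u \<in> degenerate \<Longrightarrow> a # u \<in> degenerate"
  and degenerate_double: "a # a # u \<in> degenerate"
  by (auto simp: degenerate_def dest: distinct_adj_ConsD)

lemma degenerate_cases:
  assumes "a # u \<in> degenerate"
  obtains "u \<in> degenerate" | u' where "u = a # u'"
  using assms by (cases u) (auto simp: degenerate_def)

lemma keys_pre_degenerate: "keys x \<subseteq> degenerate \<Longrightarrow> keys (pre a x) \<subseteq> degenerate"
  by (rule keys_pre_subset) (auto intro: degenerate_Cons)

text \<open>A doubled letter occurs at least twice, so it differs from the unique \<open>a\<close>;
  its two copies stay adjacent.\<close>

lemma removeAll_degenerate:
  assumes "u \<in> degenerate" "count_list u a = 1"
  shows "removeAll a u \<in> degenerate"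
proof -
  have "\<exists>A b B. u = A @ b # b # B" using assms(1)
  proof (induction u)
    case (Cons a u)
    from Cons.prems show ?case
    proof (cases rule: degenerate_cases)
      case 1
      then show ?thesis using Cons.IH by (metis append_Cons)
    next
      case (2 v)
      then show ?thesis by (metis append_Nil)
    qed
  qed (simp add: degenerate_def)
  then obtain A b B where u: "u = A @ b # b # B" by blast
  then have "b \<noteq> a" using assms(2) by auto
  then show ?thesis unfolding u degenerate_def by (simp add: distinct_adj_append_iff)
qed

lemma keys_drp_degenerate: "keys x \<subseteq> degenerate \<Longrightarrow> keys (drp a x) \<subseteq> degenerate"
  using keys_drp[of a x] removeAll_degenerate by fastforce

lemma word_bdry_degenerate: "u \<in> degenerate \<Longrightarrow> keys (word_bdry u) \<subseteq> degenerate"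
proof (induction u)
  case (Cons a u)
  from Cons.prems show ?case
  proof (cases rule: degenerate_cases)
    case 1
    have "keys (drp_word a u) \<subseteq> degenerate"
      using keys_drp_degenerate[of "frag_of u" a] 1 by simp
    then have "keys (frag_of u - pre a (word_bdry u) - pre a (drp_word a u)) \<subseteq> degenerate"
      using 1 Cons.IH by (intro keys_diff_subset keys_pre_degenerate) auto
    then show ?thesis using 1 Cons.IH
      by (auto simp: word_bdry_Cons intro: keys_pre_degenerate[THEN subsetD])
  next
    \<comment> \<open>For \<open>a # a # v\<close> the deletions of the two leading copies cancel,
      through the \<open>drp_word\<close> term if there is no third \<open>a\<close>. All other
      terms keep both copies.\<close>
    case (2 v)
    have dd: "keys (pre a (pre a x)) \<subseteq> degenerate" for x
      unfolding pre_def frag_extend_extend frag_extend_of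
      by (rule keys_extend_subset) (simp add: degenerate_double)
    show ?thesis
    proof (cases "a \<in> set v")
      case True
      then have "drp_word a (a # v) = 0"
        by (simp add: drp_word_def count_list_0_iff)
      then have "word_bdry (a # u) = pre a (pre a (word_bdry v)) + pre a (pre a (drp_word a v))"
        using True unfolding 2 by (simp add: word_bdry_Cons[of a "a # v"] word_bdry_Cons[of a v] pre_diff)
      then show ?thesis using dd keys_add_subset by metis
    next
      case False
      then have "drp_word a (a # v) = frag_of v"
        by (simp add: drp_word_def count_list_0_iff)
      then have "word_bdry (a # u) = - pre a (pre a (word_bdry v))"
        using False unfolding 2 by (simp add: word_bdry_Cons[of a "a # v"] word_bdry_Cons[of a v])
      then show ?thesis using dd by (simp add: keys_minus)
    qed
  qed
qed (simp add: degenerate_def)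

section \<open>Passing from words to surjections\<close>

definition cls :: "nat \<Rightarrow> (nat list \<Rightarrow>\<^sub>0 int) \<Rightarrow> nat list \<Rightarrow>\<^sub>0 int" where
  "cls r = frag_extend (sj_class r)"

lemma cls_simps [simp]: "cls r 0 = 0" "cls r (frag_of u) = sj_class r u"
  and cls_add: "cls r (x + y) = cls r x + cls r y"
  and cls_diff: "cls r (x - y) = cls r x - cls r y"
  and cls_cmul: "cls r (frag_cmul m x) = frag_cmul m (cls r x)"
  by (simp_all add: cls_def frag_extend_add frag_extend_diff frag_extend_minus frag_extend_cmul)

lemma cls_sum: "finite I \<Longrightarrow> cls r (sum f I) = (\<Sum>i\<in>I. cls r (f i))"
  by (induction rule: finite_induct) (simp_all add: cls_add)

lemma cls_degenerate: "keys x \<subseteq> degenerate \<Longrightarrow> cls r x = 0"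
  unfolding cls_def by (rule frag_extend_eq_0) (auto simp: sj_class_def degenerate_def)

definition sj_words :: "nat \<Rightarrow> nat list set" where
  "sj_words r = {u. set u = {1..r}}"

lemma cls_nondegenerate:
  assumes "keys x \<subseteq> {u \<in> sj_words r. distinct_adj u}"
  shows "cls r x = x"
proof -
  have "cls r x = frag_extend frag_of x"
    unfolding cls_def using assms
    by (intro frag_extend_eq) (auto simp: sj_class_def sj_words_def)
  then show ?thesis by simp
qed

lemma keys_cls: "keys (cls r x) \<subseteq> {u \<in> keys x. u \<in> sj_words r \<and> distinct_adj u}"
  unfolding cls_def by (rule keys_extend_subset) (auto simp: sj_class_def sj_words_def)

text \<open>On words using all of \<open>{1..r}\<close>, \<open>cls r\<close> discards degenerate
  words only. An operation that sends degenerate words to degenerate ones can therefore be computed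
  on unnormalized sums.\<close>

lemma cls_extend_cls:
  assumes "keys x \<subseteq> sj_words r"
    and "\<And>u. u \<in> keys x \<Longrightarrow> u \<in> degenerate \<Longrightarrow> keys (f u) \<subseteq> degenerate"
  shows "cls q (frag_extend f (cls r x)) = cls q (frag_extend f x)"
  unfolding cls_def frag_extend_extend
proof (rule frag_extend_eq)
  fix u assume u: "u \<in> keys x"
  show "frag_extend (\<lambda>a. frag_extend (sj_class q) (f a)) (sj_class r u) = frag_extend (sj_class q) (f u)"
  proof (cases "distinct_adj u")
    case True
    then show ?thesis using assms(1) u by (auto simp: sj_class_def sj_words_def)
  next
    case False
    then have "cls q (f u) = 0"
      using assms(2)[OF u] by (intro cls_degenerate) (auto simp: degenerate_def)
    then show ?thesis using False by (simp add: sj_class_def cls_def)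
  qed
qed

lemma sj_bdry_cls: "sj_bdry r u = cls r (word_bdry u)"
  by (simp add: sj_bdry_def word_bdry_def cls_sum cls_cmul)

lemma sj_bdry_extend: "frag_extend (sj_bdry r) x = cls r (wbd x)"
  unfolding cls_def frag_extend_extend by (rule frag_extend_eq) (simp add: sj_bdry_cls cls_def)

lemma sj_bdry_extend_cls:
  "keys x \<subseteq> sj_words r \<Longrightarrow> frag_extend (sj_bdry r) (cls r x) = cls r (wbd x)"
  unfolding sj_bdry_extend by (intro cls_extend_cls word_bdry_degenerate)

section \<open>Table reduction, letter by letter\<close>

text \<open>The first letter of the first word is either a non-final letter of its row, and then deleted
  from all words, or it ends the row.\<close>

function trw :: "nat list list \<Rightarrow> nat list \<Rightarrow>\<^sub>0 int" where
  "trw [] = 0"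
| "trw ([] # ws) = (if ws = [] then frag_of [] else 0)"
| "trw ((a # w) # ws) = pre a (trw (map (removeAll a) ((a # w) # ws))) + pre a (trw ws)"
  by pat_completeness auto
termination
proof (relation "measure (\<lambda>W. sum_list (map length W) + length W)")
  fix a :: nat and w :: "nat list" and ws
  have "sum_list (map (\<lambda>x. length (removeAll a x)) ws) \<le> sum_list (map length ws)"
    by (intro sum_list_mono) (rule length_removeAll_less_eq)
  from add_mono[OF length_removeAll_less_eq[of a w] this]
  show "(map (removeAll a) ((a # w) # ws), (a # w) # ws)
      \<in> measure (\<lambda>W. sum_list (map length W) + length W)"
    by (simp add: o_def)
qed auto

text \<open>The common letter set \<open>A\<close> is arbitrary because the recursion of
  \<open>trw\<close> removes letters from all words at once.\<close>

definition family :: "nat set \<Rightarrow> nat list list \<Rightarrow> bool" where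
  "family A W \<longleftrightarrow> (\<forall>w\<in>set W. distinct w \<and> set w = A)"

lemma family_Nil [simp]: "family A []"
  and family_Cons: "family A (w # ws) \<longleftrightarrow> distinct w \<and> set w = A \<and> family A ws"
  by (auto simp: family_def)

lemma family_remove: "family A W \<Longrightarrow> family (A - {a}) (map (removeAll a) W)"
  by (auto simp: family_def distinct_removeAll)

text \<open>Of the \<open>length W\<close> rows each but the last contributes one caesura, its final
  letter, which occurs again further on.\<close>

lemma keys_trw:
  assumes "family A W" "u \<in> keys (trw W)"
  shows "set u = A \<and> length u + 1 = card A + length W"
  using assms
proof (induction W arbitrary: A u rule: trw.induct)
  case (2 ws)
  then show ?case by (auto simp: family_Cons split: if_splits)
next
  case (3 a w ws)
  have a: "a \<in> A" "finite A" using 3(3) by (auto simp: family_Cons)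
  obtain m where m: "card (A - {a}) = m" "card A = Suc m"
    using card.remove[OF a(2,1)] by blast
  from 3(4) obtain v where u: "u = a # v"
    and v: "v \<in> keys (trw (map (removeAll a) ((a # w) # ws))) \<or> v \<in> keys (trw ws)"
    unfolding trw.simps(3)
    using keys_add[of "pre a (trw (map (removeAll a) ((a # w) # ws)))" "pre a (trw ws)"]
      keys_pre[of a "trw (map (removeAll a) ((a # w) # ws))"] keys_pre[of a "trw ws"] by blast
  from v show ?case
  proof
    assume "v \<in> keys (trw (map (removeAll a) ((a # w) # ws)))"
    from 3(1)[OF family_remove[OF 3(3)] this] have "set v = A - {a}"
      and "length v + 1 = m + Suc (length ws)" unfolding m(1) by auto
    then show ?case using a(1) m(2) by (auto simp: u)
  next
    assume "v \<in> keys (trw ws)"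
    from 3(2)[OF _ this, of A] 3(3) have "set v = A" "length v + 1 = card A + length ws"
      by (auto simp: family_Cons)
    then show ?case using a(1) by (auto simp: u)
  qed
qed simp

text \<open>If \<open>b\<close> ends a row, it occurs again in a later row, so that term is killed
  by \<open>drp b\<close>. What survives are the tables in which \<open>b\<close> is written once,
  inside a row or in the last one, and erasing it there is reducing the words without
  \<open>b\<close>.\<close>

lemma trw_drp:
  assumes "family A W" "b \<in> A"
  shows "drp b (trw W) = trw (map (removeAll b) W)"
  using assms
proof (induction W arbitrary: A rule: trw.induct)
  case (2 ws)
  then show ?case by (auto simp: family_Cons)
next
  case (3 a w ws)
  have fam: "family A ws" using 3(3) by (simp add: family_Cons)
  show ?case
  proof (cases "a = b")
    case True
    have 1: "drp b (pre b (trw (map (removeAll b) ((b # w) # ws)))) = trw (map (removeAll b) ((b # w) # ws))"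
      using keys_trw[OF family_remove[OF 3(3)]] True by (intro drp_pre_same) blast
    have 2: "drp b (pre b (trw ws)) = 0"
      using keys_trw[OF fam] 3(4) by (intro drp_pre_repeated) blast
    show ?thesis using 1 2 True by (simp add: drp_add)
  next
    case False
    have "drp b (trw (map (removeAll a) ((a # w) # ws)))
        = trw (map (removeAll b) (map (removeAll a) ((a # w) # ws)))"
      by (rule 3(1)[OF family_remove[OF 3(3)]]) (use False 3(4) in auto)
    also have "map (removeAll b) (map (removeAll a) ((a # w) # ws))
        = map (removeAll a) (map (removeAll b) ((a # w) # ws))"
      by (simp add: removeAll_commute)
    finally show ?thesis
      using False 3(2)[OF fam 3(4)] by (simp add: drp_add drp_pre_other)
  qed
qed simp

lemma wbd_pre_new:
  assumes "\<And>u. u \<in> keys x \<Longrightarrow> a \<notin> set u"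
  shows "wbd (pre a x) = pre a (wbd x)"
  unfolding pre_def frag_extend_extend
  by (rule frag_extend_eq) (use assms in \<open>simp add: word_bdry_Cons pre_def\<close>)

lemma wbd_pre_old:
  assumes "\<And>u. u \<in> keys x \<Longrightarrow> a \<in> set u"
  shows "wbd (pre a x) = x - pre a (wbd x) - pre a (drp a x)"
proof -
  have "wbd (pre a x) = frag_extend (\<lambda>u. frag_of u - pre a (word_bdry u) - pre a (drp_word a u)) x"
    unfolding frag_extend_pre
    by (rule frag_extend_eq) (use assms in \<open>simp add: word_bdry_Cons\<close>)
  then show ?thesis
    by (simp add: frag_extend_fun_diff pre_def drp_def frag_extend_extend)
qed

text \<open>The recursion of \<open>trw\<close> is matched with \<open>word_bdry_Cons\<close>.
  Deleting a leading \<open>a\<close> that ends its row gives face 0; the remaining terms pair up by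
  induction.\<close>

lemma trw_bdry:
  assumes "family A W"
  shows "wbd (trw W) = (\<Sum>i<length W. frag_cmul ((-1) ^ i) (trw (delete_nth i W)))"
  using assms
proof (induction W arbitrary: A rule: trw.induct)
  case (2 ws)
  show ?case
  proof (cases ws)
    case (Cons w ws')
    then have ws: "ws = [] # ws'" using 2 by (auto simp: family_Cons)
    have "trw (delete_nth i ([] # ws)) = (if ws' = [] \<and> i < 2 then frag_of [] else 0)"
      if "i < length ([] # ws)" for i
    proof (cases i)
      case 0 then show ?thesis by (simp add: ws)
    next
      case (Suc j)
      then show ?thesis using that by (cases j; cases ws') (auto simp: ws)
    qed
    then have "(\<Sum>i<length ([] # ws). frag_cmul ((-1) ^ i) (trw (delete_nth i ([] # ws))))
      = (\<Sum>i<length ([] # ws). frag_cmul ((-1) ^ i) (if ws' = [] \<and> i < 2 then frag_of [] else 0))"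
      by (intro sum.cong) auto
    then show ?thesis by (cases ws') (simp_all add: ws lessThan_Suc)
  qed (simp add: delete_nth_def)
next
  case (3 a w ws)
  let ?W = "(a # w) # ws" and ?R = "map (removeAll a)"
  have a: "a \<in> A" and fam: "family A ws" using 3(3) by (auto simp: family_Cons)
  have new: "wbd (pre a (trw (?R ?W))) = pre a (wbd (trw (?R ?W)))"
    by (rule wbd_pre_new) (use keys_trw[OF family_remove[OF 3(3)]] in blast)
  have old: "wbd (pre a (trw ws)) = trw ws - pre a (wbd (trw ws)) - pre a (trw (?R ws))"
    unfolding trw_drp[OF fam a, symmetric]
    by (rule wbd_pre_old) (use keys_trw[OF fam] a in blast)
  have split: "(\<Sum>i<length (v # X). frag_cmul ((-1) ^ i) (f (delete_nth i (v # X))))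
      = f X - (\<Sum>i<length X. frag_cmul ((-1) ^ i) (f (v # delete_nth i X)))"
    for v :: "nat list" and X and f :: "nat list list \<Rightarrow> nat list \<Rightarrow>\<^sub>0 int"
    by (simp add: sum.lessThan_Suc_shift sum_negf[symmetric] del: sum.lessThan_Suc)
  \<comment> \<open>Its leading term, face 0 of the simplex without \<open>a\<close>, cancels the
    \<open>drp a\<close> term of \<open>old\<close>. This is the reason for the deletion term in
    \<open>word_bdry_Cons\<close>.\<close>
  have IH1: "wbd (trw (?R ?W)) = trw (?R ws)
      - (\<Sum>i<length ws. frag_cmul ((-1) ^ i) (trw (?R ((a # w) # delete_nth i ws))))"
    unfolding 3(1)[OF family_remove[OF 3(3)]] unfolding list.map split by (simp add: map_delete_nth)
  have "(\<Sum>i<length ?W. frag_cmul ((-1) ^ i) (trw (delete_nth i ?W)))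
    = trw ws - (\<Sum>i<length ws. frag_cmul ((-1) ^ i) (trw ((a # w) # delete_nth i ws)))"
    by (rule split)
  also have "(\<Sum>i<length ws. frag_cmul ((-1) ^ i) (trw ((a # w) # delete_nth i ws)))
    = pre a (\<Sum>i<length ws. frag_cmul ((-1) ^ i) (trw (?R ((a # w) # delete_nth i ws))))
      + pre a (\<Sum>i<length ws. frag_cmul ((-1) ^ i) (trw (delete_nth i ws)))"
    unfolding trw.simps by (simp add: frag_cmul_distrib2 sum.distrib pre_sum pre_cmul)
  finally show ?case
    unfolding trw.simps frag_extend_add new old IH1 3(2)[OF fam]
    by (simp add: pre_diff)
qed simp

text \<open>If the first two words are equal and the first row ends at once with \<open>a\<close>,
  the next row starts with \<open>a\<close> again and the letter is doubled. In all other cases two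
  equal neighbours survive to the recursive call.\<close>

lemma trw_degenerate: "\<not> distinct_adj W \<Longrightarrow> keys (trw W) \<subseteq> degenerate"
proof (induction W rule: trw.induct)
  case (2 ws)
  then show ?case by auto
next
  case (3 a w ws)
  have "keys (trw (map (removeAll a) ((a # w) # ws))) \<subseteq> degenerate"
    using 3 distinct_adj_mapD by blast
  moreover have "keys (pre a (trw ws)) \<subseteq> degenerate"
  proof (cases "distinct_adj ws")
    case False
    then show ?thesis using 3 by (intro keys_pre_degenerate) auto
  next
    case True
    then obtain ws' where ws: "ws = (a # w) # ws'" using 3(3) by (cases ws) auto
    have "keys (pre a (pre a x)) \<subseteq> degenerate" for x
      unfolding pre_def frag_extend_extend frag_extend_of
      by (rule keys_extend_subset) (simp add: degenerate_double)
    then show ?thesis unfolding ws trw.simps pre_add by (intro keys_add_subset)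
  qed
  ultimately show ?case
    unfolding trw.simps by (intro keys_add_subset[OF keys_pre_degenerate])
qed simp

lemma trw_singleton: "distinct w \<Longrightarrow> trw [w] = frag_of w"
proof (induction w)
  case (Cons a w)
  then show ?case by simp
qed simp

section \<open>Row lengths\<close>

text \<open>Values known to be deleted can be removed from the words beforehand; this turns the
  accumulating set of \<open>table_rows\<close> into the \<open>removeAll\<close> of
  \<open>trw\<close>.\<close>

lemma table_rows_union:
  "table_rows (D \<union> E) ls W = table_rows D ls (map (filter (\<lambda>x. x \<notin> E)) W)"
proof (induction ls arbitrary: D W)
  case (Cons l ls)
  show ?case
  proof (cases W)
    case (Cons w ws)
    have "filter (\<lambda>x. x \<notin> D \<union> E) w = filter (\<lambda>x. x \<notin> D) (filter (\<lambda>x. x \<notin> E) w)"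
      by (simp add: conj_commute cong: filter_cong)
    moreover have "D \<union> E \<union> X = (D \<union> X) \<union> E" for X by blast
    ultimately show ?thesis using Cons.IH unfolding Cons by (simp add: Let_def)
  qed simp
qed simp

text \<open>The row lengths of a table with \<open>m\<close> letters and \<open>n\<close> rows:
  every passage to a new row repeats one letter, so the total is \<open>m + n - 1\<close>. Letters
  and rows are counted separately because the recursion lowers one or the other.\<close>

definition row_splits :: "nat \<Rightarrow> nat \<Rightarrow> nat list set" where
  "row_splits m n = {ls. length ls = n \<and> (\<forall>l\<in>set ls. 1 \<le> l) \<and> sum_list ls + 1 = m + n}"

lemma row_lengths_row_splits: "row_lengths r d = row_splits r (Suc d)"
  by (auto simp: row_lengths_def row_splits_def)

lemma length_le_sum_list: "(\<forall>l\<in>set ls. (1::nat) \<le> l) \<Longrightarrow> length ls \<le> sum_list ls"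
  by (induction ls) auto

lemma row_splits_0: "row_splits 0 n = {}"
  using length_le_sum_list by (fastforce simp: row_splits_def)

lemma row_splits_1: "1 \<le> m \<Longrightarrow> row_splits m 1 = {[m]}"
  by (auto simp: row_splits_def length_Suc_conv)

lemma finite_row_splits: "finite (row_splits m n)"
proof (rule finite_subset)
  show "row_splits m n \<subseteq> {ls. set ls \<subseteq> {..m + n} \<and> length ls = n}"
    using member_le_sum_list by (fastforce simp: row_splits_def)
qed (simp add: finite_lists_length_eq)

text \<open>Either the first row has one letter, which is then final, or a letter can be split off
  in front. These are the two summands in the recursion of \<open>trw\<close>.\<close>

lemma row_splits_split:
  assumes "1 \<le> m"
  shows "row_splits m (Suc (Suc n)) = (#) 1 ` row_splits m (Suc n)
    \<union> (\<lambda>ls. Suc (hd ls) # tl ls) ` row_splits (m - 1) (Suc (Suc n))"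
    (is "?L = ?A \<union> ?B")
proof
  show "?L \<subseteq> ?A \<union> ?B"
  proof
    fix ls assume ls: "ls \<in> ?L"
    then obtain l ls' where eq: "ls = l # ls'" by (cases ls) (auto simp: row_splits_def)
    show "ls \<in> ?A \<union> ?B"
    proof (cases "l = 1")
      case True
      then show ?thesis using ls by (auto simp: eq row_splits_def)
    next
      case False
      have "length ls' \<le> sum_list ls'"
        using ls by (intro length_le_sum_list) (auto simp: eq row_splits_def)
      then have "(l - 1) # ls' \<in> row_splits (m - 1) (Suc (Suc n))"
        using ls False by (auto simp: eq row_splits_def)
      moreover have "ls = Suc (hd ((l - 1) # ls')) # tl ((l - 1) # ls')"
        using ls False by (auto simp: eq row_splits_def)
      ultimately show ?thesis by blast
    qed
  qed
  have "Suc (hd ls) # tl ls \<in> ?L" if "ls \<in> row_splits (m - 1) (Suc (Suc n))" for ls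
    using that assms by (cases ls) (auto simp: row_splits_def)
  then have "?B \<subseteq> ?L" by blast
  moreover have "?A \<subseteq> ?L" by (auto simp: row_splits_def)
  ultimately show "?A \<union> ?B \<subseteq> ?L" by blast
qed

text \<open>The single empty word has to be excluded: its \<open>trw\<close> is the empty word,
  needed as the end of the recursion, whereas no positive row length fits zero letters.\<close>

lemma sum_table_rows:
  assumes "family A W" "W \<noteq> []" "A = {} \<Longrightarrow> length W \<ge> 2"
  shows "(\<Sum>ls\<in>row_splits (card A) (length W). frag_of (table_rows {} ls W)) = trw W"
  using assms
proof (induction W arbitrary: A rule: trw.induct)
  case (2 ws)
  then have "A = {}" "ws \<noteq> []" by (auto simp: family_Cons)
  then show ?case by (simp add: row_splits_0)
next
  case (3 a w ws)
  have a: "a \<in> A" "finite A" "distinct (a # w)" "set (a # w) = A" and fam: "family A ws"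
    using 3(3) by (auto simp: family_Cons)
  obtain m where m: "card (A - {a}) = m" "card A = Suc m"
    using card.remove[OF a(2,1)] by blast
  show ?case
  proof (cases ws)
    case Nil
    have "length (a # w) = card A" using a distinct_card by metis
    then show ?thesis using trw_singleton[OF a(3)] m(2)
      unfolding Nil by (simp add: row_splits_1[simplified])
  next
    case (Cons w' ws')
    let ?R = "map (removeAll a)"
    obtain n where n: "length ((a # w) # ws) = Suc (Suc n)" "length ws = Suc n"
      using Cons by simp
    have wa: "a \<notin> set w" using a by simp
    have eq1: "table_rows {} (1 # ls) ((a # w) # ws) = a # table_rows {} ls ws" for ls
      by simp
    have eq2: "table_rows {} (Suc (hd ls) # tl ls) ((a # w) # ws) = a # table_rows {} ls (?R ((a # w) # ws))"
      if ls: "ls \<in> row_splits (m) (Suc (Suc n))" for ls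
    proof -
      obtain l ls' where l: "ls = l # ls'" "l \<ge> 1"
        using ls by (cases ls) (auto simp: row_splits_def)
      \<comment> \<open>The shortened first row must still contain a letter, so that
        \<open>a\<close> is in its \<open>butlast\<close> part once put back, and hence among the
        deleted values.\<close>
      have "m \<noteq> 0" using ls row_splits_0[of "Suc (Suc n)"] by (cases m) auto
      then have "w \<noteq> []" using a(3,4) m(2) by auto
      then have ne: "take l w \<noteq> []" using l by auto
      have "table_rows {} (Suc l # ls') ((a # w) # ws)
        = a # take l w @ table_rows (set (butlast (take l w)) \<union> {a}) ls' ws"
        using ne by simp
      also have "\<dots> = a # take l w @ table_rows (set (butlast (take l w))) ls' (?R ws)"
        unfolding table_rows_union by (simp add: removeAll_filter_not_eq eq_commute)
      also have "\<dots> = a # table_rows {} ls (?R ((a # w) # ws))"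
        using wa by (simp add: l Let_def)
      finally show ?thesis by (simp add: l Let_def)
    qed
    have inj: "inj_on (\<lambda>ls. Suc (hd ls) # tl ls) (row_splits (m) (Suc (Suc n)))"
    proof (rule inj_onI)
      fix x y assume "x \<in> row_splits m (Suc (Suc n))" "y \<in> row_splits m (Suc (Suc n))"
      then have "x \<noteq> []" "y \<noteq> []" by (auto simp: row_splits_def)
      then show "x = y" if "Suc (hd x) # tl x = Suc (hd y) # tl y"
        using that by (cases x; cases y) simp_all
    qed
    have hd: "1 \<le> hd ls" if "ls \<in> row_splits m (Suc (Suc n))" for ls
      using that by (cases ls) (auto simp: row_splits_def)
    have disj: "(#) 1 ` row_splits (Suc m) (Suc n)
        \<inter> (\<lambda>ls. Suc (hd ls) # tl ls) ` row_splits (m) (Suc (Suc n)) = {}"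
      by (auto simp: row_splits_def length_Suc_conv)
    have "(\<Sum>ls\<in>row_splits (card A) (length ((a # w) # ws)). frag_of (table_rows {} ls ((a # w) # ws)))
      = (\<Sum>ls\<in>row_splits (Suc m) (Suc n). frag_of (a # table_rows {} ls ws))
        + (\<Sum>ls\<in>row_splits (m) (Suc (Suc n)). frag_of (a # table_rows {} ls (?R ((a # w) # ws))))"
      unfolding n(1) m(2)
      by (subst row_splits_split)
         (simp_all add: sum.union_disjoint finite_row_splits disj sum.reindex inj eq1 eq2
           del: table_rows.simps list.map One_nat_def)
    also have "(\<Sum>ls\<in>row_splits (Suc m) (Suc n). frag_of (a # table_rows {} ls ws)) = pre a (trw ws)"
    proof -
      have "A \<noteq> {}" "ws \<noteq> []" using a(1) Cons by auto
      then have "trw ws = (\<Sum>ls\<in>row_splits (Suc m) (Suc n). frag_of (table_rows {} ls ws))"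
        using 3(2)[OF fam] unfolding m(2) n(2) by simp
      then show ?thesis by (simp add: pre_sum finite_row_splits)
    qed
    also have "(\<Sum>ls\<in>row_splits (m) (Suc (Suc n)). frag_of (a # table_rows {} ls (?R ((a # w) # ws))))
      = pre a (trw (?R ((a # w) # ws)))"
    proof -
      have "trw (?R ((a # w) # ws))
        = (\<Sum>ls\<in>row_splits (m) (Suc (Suc n)). frag_of (table_rows {} ls (?R ((a # w) # ws))))"
        using 3(1)[OF family_remove[OF 3(3)]] n unfolding m(1) by (simp del: table_rows.simps)
      then show ?thesis by (simp add: pre_sum finite_row_splits del: list.map)
    qed
    finally show ?thesis by (simp add: add.commute)
  qed
qed simp

section \<open>Table reduction as a chain map\<close>

definition red :: "nat \<Rightarrow> (simplex \<Rightarrow>\<^sub>0 int) \<Rightarrow> nat list \<Rightarrow>\<^sub>0 int" where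
  "red r = frag_extend (\<lambda>W. cls r (trw W))"

lemma be_simplices_family: "W \<in> be_simplices r d \<Longrightarrow> family {1..r} W"
  by (auto simp: be_simplices_iff family_def perms_iff)

lemma table_reduction_red:
  assumes "1 \<le> r" "x \<in> be_chains r d"
  shows "table_reduction r x = red r x"
  unfolding table_reduction_def red_def
proof (rule frag_extend_eq)
  fix W assume "W \<in> keys x"
  then have W: "W \<in> be_simplices r d" using assms by auto
  then have "W \<noteq> []" "length W = Suc d" by (auto simp: be_simplices_iff)
  then have "trw W = (\<Sum>ls\<in>row_lengths r (length W - 1). frag_of (table_rows {} ls W))"
    using sum_table_rows[OF be_simplices_family[OF W]] assms(1)
    by (simp add: row_lengths_row_splits)
  then show "(\<Sum>ls\<in>row_lengths r (length W - 1). sj_class r (table_rows {} ls W)) = cls r (trw W)"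
    by (simp add: cls_sum row_lengths_row_splits finite_row_splits)
qed

lemma red_simps [simp]: "red r 0 = 0" "red r (frag_of W) = cls r (trw W)"
  and red_add: "red r (x + y) = red r x + red r y"
  and red_diff: "red r (x - y) = red r x - red r y"
  and red_cmul: "red r (frag_cmul m x) = frag_cmul m (red r x)"
  by (simp_all add: red_def frag_extend_add frag_extend_diff frag_extend_minus frag_extend_cmul)

lemma red_sum: "finite I \<Longrightarrow> red r (sum f I) = (\<Sum>i\<in>I. red r (f i))"
  by (induction rule: finite_induct) (simp_all add: red_add)

lemma red_class: "red r (be_class W) = cls r (trw W)"
  using trw_degenerate[of W] by (auto simp: be_class_def cls_degenerate)

lemma family_sj_words: "family {1..r} W \<Longrightarrow> keys (trw W) \<subseteq> sj_words r"
  using keys_trw by (auto simp: sj_words_def)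

lemma red_bdry:
  assumes "x \<in> be_chains r d"
  shows "frag_extend (sj_bdry r) (red r x) = red r (frag_extend be_bdry x)"
proof (rule linear_eq_on_keys[where x = x])
  fix W assume "W \<in> keys x"
  then have fam: "family {1..r} W" using assms be_simplices_family by blast
  have "frag_extend (sj_bdry r) (red r (frag_of W)) = cls r (wbd (trw W))"
    by (simp add: sj_bdry_extend_cls[OF family_sj_words[OF fam]])
  also have "\<dots> = red r (be_bdry W)"
    unfolding trw_bdry[OF fam] be_bdry_def by (simp add: cls_sum red_sum cls_cmul red_cmul red_class)
  finally show "frag_extend (sj_bdry r) (red r (frag_of W)) = red r (frag_extend be_bdry (frag_of W))"
    by simp
qed (simp_all add: red_diff frag_extend_diff)

section \<open>Equivariance of table reduction\<close>

definition sj_map :: "nat \<Rightarrow> (nat \<Rightarrow> nat) \<Rightarrow> (nat list \<Rightarrow>\<^sub>0 int) \<Rightarrow> nat list \<Rightarrow>\<^sub>0 int" where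
  "sj_map r \<sigma> = frag_extend (\<lambda>u. sj_class r (map \<sigma> u))"

lemma removeAll_map_inj: "inj f \<Longrightarrow> removeAll (f a) (map f w) = map f (removeAll a w)"
  by (induction w) (auto simp: inj_eq)

lemma trw_map:
  assumes "inj f"
  shows "trw (map (map f) W) = frag_extend (\<lambda>u. frag_of (map f u)) (trw W)"
proof (induction W rule: trw.induct)
  case (3 a w ws)
  have e: "map (removeAll (f a)) (map (map f) ((a # w) # ws)) = map (map f) (map (removeAll a) ((a # w) # ws))"
    using removeAll_map_inj[OF assms, of a] by (simp add: inj_eq[OF assms])
  have p: "pre (f a) (frag_extend (\<lambda>u. frag_of (map f u)) x) = frag_extend (\<lambda>u. frag_of (map f u)) (pre a x)" for x
    by (simp add: pre_def frag_extend_extend)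
  have "trw (map (map f) ((a # w) # ws))
    = pre (f a) (trw (map (removeAll (f a)) (map (map f) ((a # w) # ws)))) + pre (f a) (trw (map (map f) ws))"
    by simp
  also have "\<dots> = frag_extend (\<lambda>u. frag_of (map f u)) (trw ((a # w) # ws))"
    unfolding e 3 p trw.simps frag_extend_add ..
  finally show ?case .
qed auto

lemma red_be_map:
  assumes "\<sigma> permutes {1..r}" "x \<in> be_chains r d"
  shows "red r (be_map (map \<sigma>) x) = sj_map r \<sigma> (red r x)"
proof (rule linear_eq_on_keys[where x = x])
  fix W assume "W \<in> keys x"
  then have fam: "family {1..r} W" using assms be_simplices_family by blast
  have cls: "sj_map r \<sigma> y = cls r (frag_extend (\<lambda>u. frag_of (map \<sigma> u)) y)" for y
    by (simp add: sj_map_def cls_def frag_extend_extend)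
  have "red r (be_map (map \<sigma>) (frag_of W)) = cls r (trw (map (map \<sigma>) W))"
    by (simp add: be_map_def red_class)
  also have "\<dots> = cls r (frag_extend (\<lambda>u. frag_of (map \<sigma> u)) (cls r (trw W)))"
    unfolding trw_map[OF permutes_inj[OF assms(1)]]
    by (subst cls_extend_cls[OF family_sj_words[OF fam]])
       (auto simp: degenerate_def dest: distinct_adj_mapD)
  finally show "red r (be_map (map \<sigma>) (frag_of W)) = sj_map r \<sigma> (red r (frag_of W))"
    by (simp add: cls)
qed (simp_all add: red_diff frag_extend_diff be_map_def sj_map_def)

section \<open>Composition of surjections, letter by letter\<close>

definition shf :: "nat \<Rightarrow> nat \<Rightarrow> nat \<Rightarrow> nat" where
  "shf s k x = (if x > k then x + s - 1 else x)"

definition blk :: "nat \<Rightarrow> nat \<Rightarrow> nat" where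
  "blk k y = y + k - 1"

fun ncaes :: "nat list \<Rightarrow> nat" where
  "ncaes [] = 0"
| "ncaes (a # u) = (if a \<in> set u then Suc (ncaes u) else ncaes u)"

text \<open>A position is either a caesura or the last occurrence of its value. For a surjection in
  the operad this makes \<open>ncaes\<close> the degree.\<close>

lemma length_ncaes: "length u = ncaes u + card (set u)"
  by (induction u) (auto simp: card_insert_if)

lemma inj_shf: "1 \<le> s \<Longrightarrow> inj (shf s k)"
  by (rule injI) (auto simp: shf_def split: if_splits)

lemma shf_neq_blk: "1 \<le> k \<Longrightarrow> 1 \<le> y \<Longrightarrow> y \<le> s \<Longrightarrow> x \<noteq> k \<Longrightarrow> shf s k x \<noteq> blk k y"
  by (auto simp: shf_def blk_def)

text \<open>While the last occurrence of \<open>k\<close> is being replaced, all of \<open>v\<close> has to be used up; before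
  that, the current letter of \<open>v\<close> may be repeated at the start of the next segment.\<close>

fun insl :: "nat \<Rightarrow> nat \<Rightarrow> nat list \<Rightarrow> nat list \<Rightarrow> (nat \<times> bool) list list" where
  "insl s k [] v = []"
| "insl s k (x # u) [] = []"
| "insl s k (x # u) (b # v) =
    (if x \<noteq> k then map ((#) (shf s k x, True)) (insl s k u (b # v))
     else (if v = [] then [] else map ((#) (blk k b, False)) (insl s k (x # u) v))
       @ (if k \<in> set u then map ((#) (blk k b, True)) (insl s k u (b # v))
          else if v = [] then [(blk k b, False) # map (\<lambda>x. (shf s k x, True)) u] else []))"

text \<open>The signed sum of the words produced by \<open>insl\<close>. A letter \<open>b\<close>
  of \<open>v\<close> that stays inside a segment is a caesura of type \<open>v\<close> exactly when
  \<open>b\<close> recurs in \<open>v\<close>, and it then precedes all remaining caesuras of type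
  \<open>u\<close>, \<open>ncaes (x # u)\<close> in number. A letter that ends a segment before
  another \<open>k\<close> has type \<open>u\<close> and needs no sign.\<close>

fun insr :: "nat \<Rightarrow> nat \<Rightarrow> nat list \<Rightarrow> nat list \<Rightarrow> nat list \<Rightarrow>\<^sub>0 int" where
  "insr s k [] v = 0"
| "insr s k (x # u) [] = 0"
| "insr s k (x # u) (b # v) =
    (if x \<noteq> k then pre (shf s k x) (insr s k u (b # v))
     else (if v = [] then 0 else
         frag_cmul (if b \<in> set v then (-1) ^ ncaes (x # u) else 1) (pre (blk k b) (insr s k (x # u) v)))
       + (if k \<in> set u then pre (blk k b) (insr s k u (b # v))
          else if v = [] then pre (blk k b) (frag_of (map (shf s k) u)) else 0))"

fun caesura_types :: "(nat \<times> bool) list \<Rightarrow> bool list" where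
  "caesura_types [] = []"
| "caesura_types (l # c) = (if fst l \<in> fst ` set c then snd l # caesura_types c else caesura_types c)"

definition signed_word :: "(nat \<times> bool) list \<Rightarrow> nat list \<Rightarrow>\<^sub>0 int" where
  "signed_word c = frag_cmul (shuffle_sign (caesura_types c)) (frag_of (map fst c))"

lemma caesura_types_eq:
  "map (\<lambda>i. snd (c ! i)) (filter (caesura (map fst c)) [0..<length c]) = caesura_types c"
proof (induction c)
  case (Cons l c)
  have "[0..<length (l # c)] = 0 # map Suc [0..<length c]"
    by (simp add: map_Suc_upt upt_conv_Cons del: upt_Suc)
  moreover have "filter (caesura (map fst (l # c))) (map Suc X)
      = map Suc (filter (caesura (map fst c)) X)" for X
    by (simp add: filter_map o_def caesura_Suc)
  ultimately show ?case using Cons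
    by (simp add: caesura_0 o_def del: upt_Suc)
qed simp

lemma sj_pcomp_signed_word:
  "sj_pcomp r s k u v = cls (r + s - 1)
    (\<Sum>js\<in>cut_sequences (count_list u k) (length v). signed_word (sj_insert s k u v js))"
proof (cases "finite (cut_sequences (count_list u k) (length v))")
  case True
  then show ?thesis
    unfolding sj_pcomp_def Let_def caesura_types_eq by (simp add: cls_sum cls_cmul signed_word_def)
qed (simp add: sj_pcomp_def)

text \<open>Cut sequences with a free starting position \<open>j\<close>, as needed when the letters
  of \<open>v\<close> are consumed one at a time.\<close>

definition cuts :: "nat \<Rightarrow> nat \<Rightarrow> nat \<Rightarrow> nat list set" where
  "cuts n j m = {js. length js = Suc n \<and> sorted js \<and> js ! 0 = j \<and> js ! n = m}"

lemma cut_sequences_cuts: "cut_sequences n m = cuts n 1 m"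
  by (simp add: cut_sequences_def cuts_def)

lemma cuts_0: "cuts 0 j m = (if j = m then {[m]} else {})"
  by (auto simp: cuts_def length_Suc_conv)

lemma cuts_empty: "m < j \<Longrightarrow> cuts n j m = {}"
  by (auto simp: cuts_def) (metis le0 lessI not_le sorted_nth_mono)

lemma finite_cuts: "finite (cuts n j m)"
proof (rule finite_subset)
  show "cuts n j m \<subseteq> {js. set js \<subseteq> {..m} \<and> length js = Suc n}"
  proof
    fix js assume js: "js \<in> cuts n j m"
    have "js ! i \<le> m" if "i < length js" for i
      using js that sorted_nth_mono[of js i n] by (auto simp: cuts_def)
    then show "js \<in> {js. set js \<subseteq> {..m} \<and> length js = Suc n}"
      using js by (auto simp: cuts_def in_set_conv_nth)
  qed
qed (simp add: finite_lists_length_eq)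

text \<open>Either the segment ends with the current letter of \<open>v\<close>, and the next
  segment starts at the same position, or it goes on; in the second case the rest is a sequence
  starting at \<open>Suc j\<close> with its first entry lowered to \<open>j\<close>.\<close>

lemma cuts_split:
  "cuts (Suc n) j m = (#) j ` cuts n j m \<union> (\<lambda>js. j # tl js) ` cuts (Suc n) (Suc j) m"
  (is "?L = ?A \<union> ?B")
proof
  show "?L \<subseteq> ?A \<union> ?B"
  proof
    fix js assume js: "js \<in> ?L"
    then obtain js' where eq: "js = j # js'" "length js' = Suc n"
      by (cases js) (auto simp: cuts_def)
    then have s: "sorted js'" "js' ! n = m" "\<forall>x\<in>set js'. j \<le> x"
      using js by (auto simp: cuts_def)
    have j: "j \<le> js' ! 0" using s(3) eq(2) by auto
    show "js \<in> ?A \<union> ?B"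
    proof (cases "js' ! 0 = j")
      case True
      then have "js' \<in> cuts n j m" using s eq by (simp add: cuts_def)
      then show ?thesis using eq by blast
    next
      case False
      then have "Suc j \<le> js' ! 0" using j by simp
      then have "\<forall>x\<in>set js'. Suc j \<le> x"
        using s(1) by (metis in_set_conv_nth le0 order_trans sorted_nth_mono)
      then have "Suc j # js' \<in> cuts (Suc n) (Suc j) m" using s eq by (simp add: cuts_def)
      then show ?thesis using eq by force
    qed
  qed
  show "?A \<union> ?B \<subseteq> ?L"
  proof
    fix js assume "js \<in> ?A \<union> ?B"
    then consider js' where "js = j # js'" "js' \<in> cuts n j m"
      | x js' where "js = j # js'" "x # js' \<in> cuts (Suc n) (Suc j) m"
      by (auto simp: cuts_def length_Suc_conv)
    then show "js \<in> ?L"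
    proof cases
      case 1
      then have "\<forall>x\<in>set js'. j \<le> x"
        by (auto simp: cuts_def in_set_conv_nth) (metis le0 sorted_nth_mono)
      then show ?thesis using 1 by (auto simp: cuts_def)
    next
      case 2
      then show ?thesis by (auto simp: cuts_def)
    qed
  qed
qed

lemma cuts_disjoint: "(#) j ` cuts n j m \<inter> (\<lambda>js. j # tl js) ` cuts (Suc n) (Suc j) m = {}"
proof -
  have "js' \<noteq> tl js" if js': "js' \<in> cuts n j m" and js: "js \<in> cuts (Suc n) (Suc j) m" for js js'
  proof
    assume eq: "js' = tl js"
    obtain x y zs where "js = x # y # zs"
      using js by (cases js; cases "tl js") (auto simp: cuts_def)
    then show False using js js' by (auto simp: cuts_def eq)
  qed
  then show ?thesis by auto
qed

lemma inj_on_tl_cuts: "inj_on (\<lambda>js. j # tl js) (cuts n i m)"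
proof (rule inj_onI)
  fix x y assume "x \<in> cuts n i m" "y \<in> cuts n i m" "j # tl x = j # tl y"
  then show "x = y" by (cases x; cases y) (auto simp: cuts_def)
qed

lemma sj_insert_other:
  "x \<noteq> k \<Longrightarrow> sj_insert s k (x # u) v js = (shf s k x, True) # sj_insert s k u v js"
  unfolding sj_insert_def length_Cons
  by (simp add: upt_conv_Cons map_Suc_upt[symmetric] o_def shf_def Let_def
      del: upt_Suc cong: if_cong)

lemma sj_insert_same:
  "sj_insert s k (k # u) v (j # js) =
    map (\<lambda>i. (v ! (i - 1) + k - 1, i = js ! 0 \<and> k \<in> set u)) [j..<Suc (js ! 0)] @ sj_insert s k u v js"
  unfolding sj_insert_def length_Cons
  by (simp add: upt_conv_Cons map_Suc_upt[symmetric] o_def Let_def count_list_0_iff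
      del: upt_Suc cong: if_cong flip: neq0_conv)

lemma sj_insert_none:
  "k \<notin> set u \<Longrightarrow> sj_insert s k u v js = map (\<lambda>x. (shf s k x, True)) u"
proof (induction u)
  case Nil
  show ?case by (simp add: sj_insert_def)
qed (simp add: sj_insert_other)

lemma sum_sj_insert:
  assumes "k \<in> set u" "1 \<le> j" "j \<le> length v"
  shows "(\<Sum>js\<in>cuts (count_list u k) j (length v). F (sj_insert s k u v js))
    = (sum_list (map F (insl s k u (drop (j - 1) v))) :: 'x :: comm_monoid_add)"
  using assms
proof (induction "length u + (length v - j)" arbitrary: u j F rule: less_induct)
  case less
  obtain x u' where u: "u = x # u'" using less.prems(1) by (cases u) auto
  define b where "b = v ! (j - 1)"
  have dr: "drop (j - 1) v = b # drop j v"
    using less.prems by (cases j) (auto simp: b_def Cons_nth_drop_Suc)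
  show ?case
  proof (cases "x = k")
    case False
    then have k: "k \<in> set u'" using less.prems u by auto
    have "(\<Sum>js\<in>cuts (count_list u k) j (length v). F (sj_insert s k u v js))
      = (\<Sum>js\<in>cuts (count_list u' k) j (length v). (F \<circ> (#) (shf s k x, True)) (sj_insert s k u' v js))"
      using False by (simp add: u sj_insert_other)
    also have "\<dots> = sum_list (map (F \<circ> (#) (shf s k x, True)) (insl s k u' (drop (j - 1) v)))"
      by (rule less.hyps) (use u k less.prems in auto)
    finally show ?thesis using False unfolding u dr by simp
  next
    case x: True
    let ?n = "count_list u' k" and ?m = "length v"
    have "(\<Sum>js\<in>cuts (count_list u k) j ?m. F (sj_insert s k u v js))
      = (\<Sum>js\<in>cuts ?n j ?m. F (sj_insert s k u v (j # js)))
        + (\<Sum>js\<in>cuts (Suc ?n) (Suc j) ?m. F (sj_insert s k u v (j # tl js)))"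
      unfolding u x count_list.simps if_P[OF refl] add.commute[of _ 1] plus_1_eq_Suc
      by (subst cuts_split, subst sum.union_disjoint)
        (simp_all add: finite_cuts cuts_disjoint sum.reindex inj_on_tl_cuts o_def)
    also have "(\<Sum>js\<in>cuts (Suc ?n) (Suc j) ?m. F (sj_insert s k u v (j # tl js)))
      = sum_list (map F (if drop j v = [] then [] else map ((#) (blk k b, False)) (insl s k u (drop j v))))"
    proof (cases "j = ?m")
      case True
      then show ?thesis by (simp add: cuts_empty)
    next
      case False
      have "sj_insert s k u v (j # tl js) = (blk k b, False) # sj_insert s k u v js"
        if mem: "js \<in> cuts (Suc ?n) (Suc j) ?m" for js
      proof -
        obtain y ys where js: "js = Suc j # y # ys" and le: "Suc j \<le> y"
          using mem by (cases js; cases "tl js") (auto simp: cuts_def)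
        have "[j..<Suc y] = j # [Suc j..<Suc y]" using le by (simp add: upt_conv_Cons del: upt_Suc)
        then show ?thesis using le
          unfolding js u x list.sel sj_insert_same by (simp add: blk_def b_def del: upt_Suc)
      qed
      then have "(\<Sum>js\<in>cuts (Suc ?n) (Suc j) ?m. F (sj_insert s k u v (j # tl js)))
        = (\<Sum>js\<in>cuts (count_list u k) (Suc j) ?m. (F \<circ> (#) (blk k b, False)) (sj_insert s k u v js))"
        by (simp add: u x)
      also have "\<dots> = sum_list (map (F \<circ> (#) (blk k b, False)) (insl s k u (drop (Suc j - 1) v)))"
        by (rule less.hyps) (use less.prems False in auto)
      finally show ?thesis using False less.prems by simp
    qed
    also have "(\<Sum>js\<in>cuts ?n j ?m. F (sj_insert s k u v (j # js)))
      = sum_list (map F (if k \<in> set u' then map ((#) (blk k b, True)) (insl s k u' (b # drop j v))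
          else if drop j v = [] then [(blk k b, False) # map (\<lambda>x. (shf s k x, True)) u'] else []))"
    proof (cases "k \<in> set u'")
      case True
      have "sj_insert s k u v (j # js) = (blk k b, True) # sj_insert s k u' v js"
        if "js \<in> cuts ?n j ?m" for js
        using that True unfolding u x sj_insert_same by (simp add: cuts_def blk_def b_def)
      then have "(\<Sum>js\<in>cuts ?n j ?m. F (sj_insert s k u v (j # js)))
        = (\<Sum>js\<in>cuts ?n j ?m. (F \<circ> (#) (blk k b, True)) (sj_insert s k u' v js))"
        by simp
      also have "\<dots> = sum_list (map (F \<circ> (#) (blk k b, True)) (insl s k u' (drop (j - 1) v)))"
        by (rule less.hyps) (use u True less.prems in auto)
      finally show ?thesis using True unfolding dr by simp
    next
      case False
      then have n: "?n = 0" by (simp add: count_list_0_iff)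
      show ?thesis
      proof (cases "j = ?m")
        case True
        then show ?thesis using False less.prems unfolding n cuts_0 u x
          by (simp add: sj_insert_same sj_insert_none blk_def b_def)
      next
        case jm: False
        then show ?thesis using False less.prems unfolding n cuts_0 by simp
      qed
    qed
    finally show ?thesis
      unfolding dr u x insl.simps by (simp add: u x add.commute)
  qed
qed

section \<open>Types and signs of the inserted words\<close>

lemma insl_letters:
  assumes "c \<in> set (insl s k u v)" "k \<in> set u"
  shows "fst ` set c = shf s k ` (set u - {k}) \<union> blk k ` set v"
  using assms
proof (induction s k u v arbitrary: c rule: insl.induct)
  case (3 s k x u b v)
  show ?case
  proof (cases "x = k")
    case False
    then obtain c' where "c = (shf s k x, True) # c'" "c' \<in> set (insl s k u (b # v))"
      using 3(4) by auto
    then show ?thesis using 3(1)[OF False, of c'] 3(5) False by auto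
  next
    case True
    from 3(4) True consider c' where "v \<noteq> []" "c = (blk k b, False) # c'" "c' \<in> set (insl s k (x # u) v)"
      | c' where "k \<in> set u" "c = (blk k b, True) # c'" "c' \<in> set (insl s k u (b # v))"
      | "k \<notin> set u" "v = []" "c = (blk k b, False) # map (\<lambda>x. (shf s k x, True)) u"
      by (auto split: if_splits)
    then show ?thesis
    proof cases
      case 1
      then show ?thesis using 3(2)[of c'] True by auto
    next
      case 2
      then show ?thesis using 3(3)[of c'] True by auto
    next
      case 3
      then show ?thesis using True by (auto simp: image_iff)
    qed
  qed
qed auto

lemma caesura_types_map:
  "inj f \<Longrightarrow> count_list (caesura_types (map (\<lambda>x. (f x, True)) u)) True = ncaes u"
  "shuffle_sign (caesura_types (map (\<lambda>x. (f x, True)) u)) = 1"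
  by (induction u) (auto simp: image_image inj_image_mem_iff)

definition block_ok :: "nat \<Rightarrow> nat \<Rightarrow> nat list \<Rightarrow> bool" where
  "block_ok s k v \<longleftrightarrow> 1 \<le> k \<and> 1 \<le> s \<and> set v \<subseteq> {1..s}"

lemma block_ok_Cons: "block_ok s k (b # v) \<Longrightarrow> block_ok s k v"
  by (auto simp: block_ok_def)

lemma shf_mem_letters:
  assumes "block_ok s k v" "x \<noteq> k"
  shows "shf s k x \<in> shf s k ` (A - {k}) \<union> blk k ` set v \<longleftrightarrow> x \<in> A"
  using assms shf_neq_blk[of k _ s x] inj_image_mem_iff[OF inj_shf, of s k x "A - {k}"]
  by (auto simp: block_ok_def subset_iff image_iff)

lemma blk_mem_letters:
  assumes "block_ok s k (b # v)"
  shows "blk k b \<in> shf s k ` (A - {k}) \<union> blk k ` set v \<longleftrightarrow> b \<in> set v"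
proof -
  have "blk k b \<notin> shf s k ` (A - {k})"
    using assms shf_neq_blk[of k b s] by (fastforce simp: block_ok_def)
  moreover have "blk k b = blk k y \<longleftrightarrow> b = y" if "y \<in> set v" for y
    using that assms by (auto simp: block_ok_def blk_def)
  ultimately show ?thesis by auto
qed

text \<open>Each caesura of \<open>u\<close> yields exactly one caesura of type \<open>u\<close>,
  whatever the cuts: the end of a segment before a further \<open>k\<close> recurs at the start of
  the next segment. Hence the sign in \<open>insr\<close> is the same for all cut sequences.\<close>

lemma insl_types:
  assumes "c \<in> set (insl s k u v)" "k \<in> set u" "block_ok s k v"
  shows "count_list (caesura_types c) True = ncaes u"
  using assms
proof (induction s k u v arbitrary: c rule: insl.induct)
  case (3 s k x u b v)
  show ?case
  proof (cases "x = k")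
    case False
    then have k: "k \<in> set u" using 3(5) by auto
    from False obtain c' where c: "c = (shf s k x, True) # c'" "c' \<in> set (insl s k u (b # v))"
      using 3(4) by auto
    have "shf s k x \<in> fst ` set c' \<longleftrightarrow> x \<in> set u"
      unfolding insl_letters[OF c(2) k] by (rule shf_mem_letters[OF 3(6) False])
    then show ?thesis using 3(1)[OF False c(2) k 3(6)] by (simp add: c(1))
  next
    case True
    note ok = 3(6)
    from 3(4) True consider c' where "v \<noteq> []" "c = (blk k b, False) # c'" "c' \<in> set (insl s k (x # u) v)"
      | c' where "k \<in> set u" "c = (blk k b, True) # c'" "c' \<in> set (insl s k u (b # v))"
      | "k \<notin> set u" "v = []" "c = (blk k b, False) # map (\<lambda>x. (shf s k x, True)) u"
      by (auto split: if_splits)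
    then show ?thesis
    proof cases
      case 1
      then show ?thesis using 3(2)[OF _ _ 1(3) _ block_ok_Cons[OF ok]] True by auto
    next
      case 2
      have "blk k b \<in> fst ` set c'" unfolding insl_letters[OF 2(3,1)] by auto
      then show ?thesis using 3(3)[OF _ 2(1) 2(3) 2(1) ok] True 2 by simp
    next
      case 3
      have "blk k b \<notin> shf s k ` (set u - {k})"
        using blk_mem_letters[of s k b "[]" "set u"] ok 3(2) by simp
      then have "blk k b \<notin> shf s k ` set u" using 3(1) by auto
      then show ?thesis using 3 True caesura_types_map(1)[OF inj_shf, of s k u] ok
        by (auto simp: image_image block_ok_def)
    qed
  qed
qed auto

lemma signed_word_True: "signed_word ((a, True) # c) = pre a (signed_word c)"
  by (simp add: signed_word_def pre_cmul)

lemma signed_word_False: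
  "signed_word ((a, False) # c) =
    frag_cmul (if a \<in> fst ` set c then (-1) ^ count_list (caesura_types c) True else 1) (pre a (signed_word c))"
  by (simp add: signed_word_def pre_cmul)

lemma sum_list_pre: "sum_list (map (\<lambda>c. frag_cmul m (pre a (f c))) L) = frag_cmul m (pre a (sum_list (map f L)))"
  by (induction L) (simp_all add: pre_add frag_cmul_distrib2)

lemma sum_list_insl:
  assumes "k \<in> set u" "block_ok s k v"
  shows "sum_list (map signed_word (insl s k u v)) = insr s k u v"
  using assms
proof (induction s k u v rule: insl.induct)
  case (3 s k x u b v)
  show ?case
  proof (cases "x = k")
    case False
    then show ?thesis using 3(1)[OF False _ 3(5)] 3(4)
      sum_list_pre[of 1 "shf s k x" signed_word "insl s k u (b # v)"]
      by (simp add: o_def signed_word_True)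
  next
    case True
    have stay: "sum_list (map signed_word (map ((#) (blk k b, False)) (insl s k (x # u) v)))
      = frag_cmul (if b \<in> set v then (-1) ^ ncaes (x # u) else 1) (pre (blk k b) (insr s k (x # u) v))"
      if "v \<noteq> []"
    proof -
      have "signed_word ((blk k b, False) # c)
        = frag_cmul (if b \<in> set v then (-1) ^ ncaes (x # u) else 1) (pre (blk k b) (signed_word c))"
        if c: "c \<in> set (insl s k (x # u) v)" for c
        using insl_types[OF c 3(4) block_ok_Cons[OF 3(5)]]
        unfolding signed_word_False insl_letters[OF c 3(4)] blk_mem_letters[OF 3(5)] by simp
      then have m: "map signed_word (map ((#) (blk k b, False)) (insl s k (x # u) v))
        = map (\<lambda>c. frag_cmul (if b \<in> set v then (-1) ^ ncaes (x # u) else 1) (pre (blk k b) (signed_word c)))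
            (insl s k (x # u) v)"
        by simp
      have nx: "\<not> x \<noteq> k" using True by simp
      show ?thesis
        unfolding m sum_list_pre 3(2)[OF nx that 3(4) block_ok_Cons[OF 3(5)]] ..
    qed
    have fin: "sum_list (map signed_word (if k \<in> set u then map ((#) (blk k b, True)) (insl s k u (b # v))
          else if v = [] then [(blk k b, False) # map (\<lambda>x. (shf s k x, True)) u] else []))
      = (if k \<in> set u then pre (blk k b) (insr s k u (b # v))
          else if v = [] then pre (blk k b) (frag_of (map (shf s k) u)) else 0)"
    proof (cases "k \<in> set u")
      case kin: True
      then show ?thesis using 3(3)[OF _ kin kin 3(5)] True
          sum_list_pre[of 1 "blk k b" signed_word "insl s k u (b # v)"]
        by (simp add: o_def signed_word_True)
    next
      case False
      have "blk k b \<notin> shf s k ` set u" if "v = []"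
        using blk_mem_letters[of s k b "[]" "set u"] 3(5) that False by simp
      then show ?thesis using False
        by (simp add: signed_word_False image_image) (simp add: signed_word_def caesura_types_map(2) o_def)
    qed
    have nx: "\<not> x \<noteq> k" using True by simp
    have st: "sum_list (map signed_word (if v = [] then [] else map ((#) (blk k b, False)) (insl s k (x # u) v)))
      = (if v = [] then 0 else
          frag_cmul (if b \<in> set v then (-1) ^ ncaes (x # u) else 1) (pre (blk k b) (insr s k (x # u) v)))"
    proof (cases "v = []")
      case False
      show ?thesis unfolding if_not_P[OF False] by (rule stay[OF False])
    qed simp
    show ?thesis
      unfolding insl.simps insr.simps if_not_P[OF nx] map_append sum_list_append st fin ..
  qed
qed auto

lemma sj_pcomp_insr:
  assumes "k \<in> set u" "v \<noteq> []" "block_ok s k v"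
  shows "sj_pcomp r s k u v = cls (r + s - 1) (insr s k u v)"
  unfolding sj_pcomp_signed_word cut_sequences_cuts
  using sum_sj_insert[OF assms(1), of 1 v signed_word s] assms(2)
  by (simp add: sum_list_insl[OF assms(1,3)] Suc_le_eq)

text \<open>All inserted words share their first letter, so prepending this letter once more makes
  every term degenerate.\<close>

lemma keys_insr_hd:
  "keys (insr s k (x # u) v) \<subseteq> range ((#) (if x = k then blk k (hd v) else shf s k x))"
proof (cases v)
  case (Cons b v')
  have p: "keys (pre a y) \<subseteq> range ((#) a)" for a y using keys_pre[of a y] by blast
  show ?thesis
  proof (cases "x = k")
    case True
    then show ?thesis unfolding Cons
      by (simp only: insr.simps if_P list.sel not_False_eq_True not_True_eq_False if_False simp_thms)
        (intro keys_add_subset; auto dest: p[THEN subsetD])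
  qed (use p in \<open>simp add: Cons\<close>)
qed simp

lemma pre_degenerate_hd:
  assumes "keys y \<subseteq> range ((#) a)"
  shows "keys (pre a y) \<subseteq> degenerate"
  by (rule keys_pre_subset) (use assms degenerate_double in auto)

text \<open>Repetitions survive insertion: a doubled \<open>k\<close> turns into a doubled letter of
  \<open>v\<close>, namely the end of one segment and the start of the next. So composition of
  surjections passes to classes.\<close>

lemma insr_degenerate:
  assumes "u \<in> degenerate \<or> v \<in> degenerate"
  shows "keys (insr s k u v) \<subseteq> degenerate"
  using assms
proof (induction s k u v rule: insr.induct)
  case (3 s k x u b v)
  show ?case
  proof (cases "x = k")
    case False
    have "keys (pre (shf s k x) (insr s k u (b # v))) \<subseteq> degenerate"
    proof (cases "u \<in> degenerate \<or> b # v \<in> degenerate")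
      case True
      then show ?thesis using 3(1)[OF False] by (intro keys_pre_degenerate) auto
    next
      case nd: False
      then obtain u' where "u = x # u'"
        using 3(4) by (auto elim: degenerate_cases)
      then show ?thesis
        using keys_insr_hd[of s k x u' "b # v"] False by (intro pre_degenerate_hd) simp
    qed
    then show ?thesis using False by simp
  next
    case True
    have stay: "keys (pre (blk k b) (insr s k (x # u) v)) \<subseteq> degenerate" if "v \<noteq> []"
    proof (cases "x # u \<in> degenerate \<or> v \<in> degenerate")
      case d: True
      then show ?thesis using 3(2)[OF _ that] True by (intro keys_pre_degenerate) auto
    next
      case nd: False
      then obtain v' where "v = b # v'"
        using 3(4) by (auto elim: degenerate_cases)
      then show ?thesis
        using keys_insr_hd[of s k x u v] True by (intro pre_degenerate_hd) simp
    qed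
    have fin: "keys (pre (blk k b) (insr s k u (b # v))) \<subseteq> degenerate" if "k \<in> set u"
    proof (cases "u \<in> degenerate \<or> b # v \<in> degenerate")
      case d: True
      then show ?thesis using 3(3)[OF _ that] True by (intro keys_pre_degenerate) auto
    next
      case nd: False
      then obtain u' where "u = k # u'"
        using 3(4) True by (auto elim: degenerate_cases)
      then show ?thesis
        using keys_insr_hd[of s k k u' "b # v"] by (intro pre_degenerate_hd) simp
    qed
    have last: "keys (pre (blk k b) (frag_of (map (shf s k) u))) \<subseteq> degenerate"
      if "k \<notin> set u" "v = []"
    proof -
      have "x # u \<in> degenerate"
        using 3(4) that by (simp add: degenerate_def)
      then have "u \<in> degenerate"
        by (cases rule: degenerate_cases) (use that True in auto)
      then have "map (shf s k) u \<in> degenerate"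
        by (auto simp: degenerate_def dest: distinct_adj_mapD)
      then show ?thesis by (simp add: degenerate_Cons)
    qed
    have 1: "keys (if v = [] then 0 else
         frag_cmul (if b \<in> set v then (-1) ^ ncaes (x # u) else 1) (pre (blk k b) (insr s k (x # u) v))) \<subseteq> degenerate"
      using stay by (cases "v = []") (simp_all add: keys_cmul_subset)
    have 2: "keys (if k \<in> set u then pre (blk k b) (insr s k u (b # v))
          else if v = [] then pre (blk k b) (frag_of (map (shf s k) u)) else 0) \<subseteq> degenerate"
      using fin last by simp
    have nx: "\<not> x \<noteq> k" using True by simp
    show ?thesis
      unfolding insr.simps if_not_P[OF nx] by (rule keys_add_subset[OF 1 2])
  qed
qed (auto simp: degenerate_def)

section \<open>Table reduction and composition\<close>

text \<open>\<open>perm_comp\<close> with the size \<open>s\<close> of the block as a parameter.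
  Under table reduction letters disappear from \<open>v\<close>, while the shift of the outer values
  must remain \<open>s - 1\<close>.\<close>

definition pcs :: "nat \<Rightarrow> nat \<Rightarrow> nat list \<Rightarrow> nat list \<Rightarrow> nat list" where
  "pcs s k u v = concat (map (\<lambda>x. if x = k then map (blk k) v else [shf s k x]) u)"

lemma perm_comp_pcs: "length v = s \<Longrightarrow> perm_comp k u v = pcs s k u v"
  unfolding perm_comp_def pcs_def by (intro arg_cong[of _ _ concat] map_cong) (auto simp: blk_def shf_def)

lemma pcs_Nil [simp]: "pcs s k [] v = []"
  and pcs_Cons: "pcs s k (x # u) v = (if x = k then map (blk k) v else [shf s k x]) @ pcs s k u v"
  by (simp_all add: pcs_def)

lemma pcs_dead: "pcs s k u [] = map (shf s k) (removeAll k u)"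
  by (induction u) (auto simp: pcs_Cons)

lemma removeAll_shf_pcs:
  assumes "block_ok s k v" "x \<noteq> k"
  shows "removeAll (shf s k x) (pcs s k u v) = pcs s k (removeAll x u) v"
proof (induction u)
  case (Cons y u)
  have "shf s k x \<notin> set (map (blk k) v)"
    using assms shf_neq_blk[of k _ s x] by (fastforce simp: block_ok_def)
  then have "removeAll (shf s k x) (map (blk k) v) = map (blk k) v" by (rule removeAll_id)
  moreover have "shf s k y = shf s k x \<longleftrightarrow> y = x"
    using inj_shf[of s k] assms by (auto simp: block_ok_def inj_eq)
  ultimately show ?case using Cons assms(2) by (auto simp: pcs_Cons)
qed simp

lemma removeAll_blk_pcs:
  assumes "block_ok s k (b # v)"
  shows "removeAll (blk k b) (pcs s k u v) = pcs s k u (removeAll b v)"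
proof (induction u)
  case (Cons y u)
  have "removeAll (blk k b) (map (blk k) w) = map (blk k) (removeAll b w)" if "set w \<subseteq> {1..s}" for w
    using that assms by (induction w) (auto simp: blk_def block_ok_def)
  then have "removeAll (blk k b) (map (blk k) v) = map (blk k) (removeAll b v)"
    using assms by (auto simp: block_ok_def)
  moreover have "y \<noteq> k \<Longrightarrow> shf s k y \<noteq> blk k b"
    using assms shf_neq_blk[of k b s y] by (auto simp: block_ok_def)
  ultimately show ?case using Cons by (cases "y = k") (auto simp: pcs_Cons)
qed simp

section \<open>Formal sums modulo degenerate words\<close>

definition eqd :: "(nat list \<Rightarrow>\<^sub>0 int) \<Rightarrow> (nat list \<Rightarrow>\<^sub>0 int) \<Rightarrow> bool" where
  "eqd x y \<longleftrightarrow> keys (x - y) \<subseteq> degenerate"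

lemma eqd_refl: "eqd x x"
  by (simp add: eqd_def)

lemma eqd_trans: "eqd x y \<Longrightarrow> eqd y z \<Longrightarrow> eqd x z"
  unfolding eqd_def using keys_add_subset[of "x - y" degenerate "y - z"] by simp

lemma eqd_add: "eqd x x' \<Longrightarrow> eqd y y' \<Longrightarrow> eqd (x + y) (x' + y')"
  unfolding eqd_def using keys_add_subset[of "x - x'" degenerate "y - y'"] by (simp add: algebra_simps)

lemma eqd_pre: "eqd x x' \<Longrightarrow> eqd (pre a x) (pre a x')"
  unfolding eqd_def using keys_pre_degenerate[of "x - x'" a] by (simp add: pre_diff)

lemma eqd_cmul: "eqd x x' \<Longrightarrow> eqd (frag_cmul m x) (frag_cmul m x')"
  unfolding eqd_def using keys_cmul_subset[of "x - x'" degenerate m] by (simp add: frag_cmul_diff_right)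

lemma eqd_0: "keys x \<subseteq> degenerate \<Longrightarrow> eqd x 0"
  by (simp add: eqd_def)

lemma eqd_cls: "eqd x y \<Longrightarrow> cls r x = cls r y"
  unfolding eqd_def using cls_degenerate[of "x - y" r] by (simp add: cls_diff)

lemma eqd_pre_pre_0: "eqd (pre a (pre a x)) 0"
  by (rule eqd_0, rule pre_degenerate_hd) (use keys_pre in blast)

lemma path_sum_tl:
  "path_sum f (\<lambda>X. F (tl X)) (u # us) (v # vs) =
    (if us = [] \<and> vs = [] then F [] else
     path_sum f F us (v # vs) + frag_cmul ((-1) ^ length us) (path_sum f F (u # us) vs))"
  by (simp add: path_sum_Cons)

text \<open>All paths start at the same permutation \<open>a # w\<close>, so the recursion of
  \<open>trw\<close> applies to the whole sum. Deleting \<open>a\<close> affects all vertices;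
  ending the row drops the first vertex, that is, it takes one step along the path.\<close>

lemma path_sum_trw:
  assumes "f u v = a # w"
  shows "path_sum f trw (u # us) (v # vs) =
    pre a (path_sum f (\<lambda>X. trw (map (removeAll a) X)) (u # us) (v # vs))
    + (pre a (path_sum f trw us (v # vs))
       + frag_cmul ((-1) ^ length us) (pre a (path_sum f trw (u # us) vs)))"
proof -
  have "path_sum f trw (u # us) (v # vs)
    = path_sum f (\<lambda>X. pre a (trw (map (removeAll a) X)) + pre a (trw (tl X))) (u # us) (v # vs)"
  proof -
    have "trw (gpath f (u # us) (v # vs) p)
      = pre a (trw (map (removeAll a) (gpath f (u # us) (v # vs) p))) + pre a (trw (tl (gpath f (u # us) (v # vs) p)))" for p
    proof -
      have "hd (gpath f (u # us) (v # vs) p) = a # w" using assms by (simp add: hd_gpath)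
      then obtain X where "gpath f (u # us) (v # vs) p = (a # w) # X"
        by (metis gpath_nonempty list.collapse)
      then show ?thesis by simp
    qed
    then show ?thesis by (simp add: path_sum_def)
  qed
  also have "\<dots> = path_sum f (\<lambda>X. pre a (trw (map (removeAll a) X))) (u # us) (v # vs)
      + path_sum f (\<lambda>X. pre a (trw (tl X))) (u # us) (v # vs)"
    by (simp add: path_sum_def frag_cmul_distrib2 sum.distrib)
  also have "path_sum f (\<lambda>X. pre a (trw (map (removeAll a) X))) (u # us) (v # vs)
      = pre a (path_sum f (\<lambda>X. trw (map (removeAll a) X)) (u # us) (v # vs))"
    by (rule path_sum_linear[of "pre a", OF pre_add pre_cmul, symmetric])
  also have "path_sum f (\<lambda>X. pre a (trw (tl X))) (u # us) (v # vs)
      = pre a (path_sum f (\<lambda>X. trw (tl X)) (u # us) (v # vs))"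
    by (rule path_sum_linear[of "pre a", OF pre_add pre_cmul, symmetric])
  also have "path_sum f (\<lambda>X. trw (tl X)) (u # us) (v # vs) =
      path_sum f trw us (v # vs) + frag_cmul ((-1) ^ length us) (path_sum f trw (u # us) vs)"
    unfolding path_sum_tl by (cases us; cases vs) auto
  finally show ?thesis by (simp add: pre_add pre_cmul)
qed

lemma gpath_repeats:
  assumes "False \<in> set p"
  shows "\<not> distinct_adj (gpath (\<lambda>u v. g u) U V p)"
proof -
  obtain i where i: "i < length p" "p ! i = False" using assms by (auto simp: in_set_conv_nth)
  then have "gpath (\<lambda>u v. g u) U V p ! i = gpath (\<lambda>u v. g u) U V p ! Suc i"
    by (simp add: gpath_def take_Suc_conv_app_nth nth_append del: upt_Suc)
  then show ?thesis using i unfolding distinct_adj_conv_nth by auto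
qed

text \<open>A vertex function that ignores the second coordinate repeats its value at every y-step,
  and with two or more vertices in \<open>V\<close> every path has a y-step.\<close>

lemma path_sum_dead:
  assumes "length V \<ge> 2"
  shows "eqd (path_sum (\<lambda>u v. g u) trw U V) 0"
proof (cases "U = []")
  case False
  have "keys (\<Sum>p\<in>lattice_paths (length U - 1) (length V - 1).
       frag_cmul (shuffle_sign p) (trw (gpath (\<lambda>u v. g u) U V p))) \<subseteq> degenerate"
  proof (intro keys_sum_subset keys_cmul_subset trw_degenerate gpath_repeats)
    fix p assume "p \<in> lattice_paths (length U - 1) (length V - 1)"
    then have "count_list p False \<noteq> 0" using assms by (auto simp: lattice_paths_def)
    then show "False \<in> set p" by (simp add: count_list_0_iff)
  qed
  then show ?thesis using assms by (intro eqd_0) (simp add: path_sum_def)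
qed (simp add: eqd_refl)

lemma path_sum_congf:
  assumes "\<And>u v. u \<in> set U \<Longrightarrow> v \<in> set V \<Longrightarrow> f u v = f' u v"
  shows "path_sum f F U V = path_sum f' F U V"
  using path_sum_map[of U V f id id id f' F] assms by simp

lemma bilin_pre_pre: "bilin f (pre a x) (pre b y) = bilin (\<lambda>u v. f (a # u) (b # v)) x y"
  by (simp add: pre_def bilin_extend_left bilin_extend_right bilin_def frag_extend_extend)

lemma bilin_pre_left: "bilin f (pre a x) y = bilin (\<lambda>u v. f (a # u) v) x y"
  by (simp add: pre_def bilin_extend_left bilin_def frag_extend_extend)

lemma pre_bilin: "pre a (bilin f x y) = bilin (\<lambda>u v. pre a (f u v)) x y"
  unfolding pre_def by (rule extend_bilin)

lemma bilin_fun_add: "bilin (\<lambda>u v. f u v + g u v) x y = bilin f x y + bilin g x y"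
  by (simp add: bilin_def frag_extend_fun_add)

lemma bilin_fun_cmul: "bilin (\<lambda>u v. frag_cmul m (f u v)) x y = frag_cmul m (bilin f x y)"
  by (simp add: bilin_def frag_extend_fun_cmul)

lemma bilin_insr_other:
  assumes "x \<noteq> k" "[] \<notin> keys Y"
  shows "bilin (insr s k) (pre x X) Y = pre (shf s k x) (bilin (insr s k) X Y)"
  unfolding bilin_pre_left pre_bilin
proof (rule bilin_cong)
  fix u v assume "v \<in> keys Y"
  then obtain b v' where "v = b # v'" using assms(2) by (cases v) auto
  then show "insr s k (x # u) v = pre (shf s k x) (insr s k u v)" using assms(1) by simp
qed

lemma ncaes_trw:
  assumes "family A W" "W \<noteq> []" "u \<in> keys (trw W)"
  shows "ncaes u + 1 = length W"
proof -
  have "set u = A" "length u + 1 = card A + length W" using keys_trw[OF assms(1,3)] by auto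
  then show ?thesis using length_ncaes[of u] by simp
qed

text \<open>Here \<open>X\<close> and \<open>Y\<close> collect the reductions with \<open>k\<close> used up and with \<open>k\<close> still to come,
  \<open>C\<close> and \<open>E\<close> those with \<open>b\<close> used up and with \<open>b\<close> still to come.\<close>

lemma bilin_insr_same:
  assumes kX: "\<forall>u\<in>keys X. k \<notin> set u \<and> ncaes (k # u) = n"
    and kY: "\<forall>u\<in>keys Y. k \<in> set u \<and> ncaes (k # u) = n"
    and kC: "\<forall>v\<in>keys C. b \<notin> set v" and kE: "\<forall>v\<in>keys E. b \<in> set v"
  shows "[] \<notin> keys C \<Longrightarrow> bilin (insr s k) (pre k X + pre k Y) (pre b C + pre b E)
      = pre (blk k b) (bilin (insr s k) (pre k X + pre k Y) C)
        + (pre (blk k b) (bilin (insr s k) Y (pre b C + pre b E))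
           + frag_cmul ((-1) ^ n) (pre (blk k b) (bilin (insr s k) (pre k X + pre k Y) E)))"
    and "keys C \<subseteq> {[]} \<Longrightarrow> bilin (insr s k) (pre k X + pre k Y) (pre b C + pre b E)
      = pre (blk k b) (bilin (\<lambda>u v. frag_of (map (shf s k) u)) X C)
        + (pre (blk k b) (bilin (insr s k) Y (pre b C + pre b E))
           + frag_cmul ((-1) ^ n) (pre (blk k b) (bilin (insr s k) (pre k X + pre k Y) E)))"
proof -
  have X: "k \<notin> set u" and nX: "ncaes (k # u) = n" if "u \<in> keys X" for u using kX that by auto
  have Y: "k \<in> set u" and nY: "ncaes (k # u) = n" if "u \<in> keys Y" for u using kY that by auto
  note C = bspec[OF kC] and E = bspec[OF kE]
  have Ene: "v \<noteq> []" if "v \<in> keys E" for v using E[OF that] by auto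
  have XE: "bilin (insr s k) (pre k X) (pre b E)
      = frag_cmul ((-1) ^ n) (pre (blk k b) (bilin (insr s k) (pre k X) E))"
    unfolding bilin_pre_pre unfolding bilin_pre_left pre_bilin bilin_fun_cmul[symmetric]
    by (rule bilin_cong) (use X E Ene nX in simp)
  have YE: "bilin (insr s k) (pre k Y) (pre b E)
      = frag_cmul ((-1) ^ n) (pre (blk k b) (bilin (insr s k) (pre k Y) E))
        + pre (blk k b) (bilin (insr s k) Y (pre b E))"
  proof -
    have "bilin (insr s k) Y (pre b E) = bilin (\<lambda>u v. insr s k u (b # v)) Y E"
      by (simp add: pre_def bilin_extend_right)
    then show ?thesis
      unfolding bilin_pre_pre
      by (simp add: bilin_pre_left pre_bilin bilin_fun_cmul[symmetric] bilin_fun_add[symmetric])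
        (rule bilin_cong, use Y E Ene nY in simp)
  qed
  have YC0: "bilin (insr s k) Y (pre b C) = bilin (\<lambda>u v. insr s k u (b # v)) Y C"
    by (simp add: pre_def bilin_extend_right)
  have sum: "frag_cmul ((-1) ^ n) (pre (blk k b) (bilin (insr s k) (pre k X + pre k Y) E))
      = frag_cmul ((-1) ^ n) (pre (blk k b) (bilin (insr s k) (pre k X) E))
        + frag_cmul ((-1) ^ n) (pre (blk k b) (bilin (insr s k) (pre k Y) E))"
    by (simp add: bilin_add_left pre_add frag_cmul_distrib2)
  {
    assume ne: "[] \<notin> keys C"
    have XC: "bilin (insr s k) (pre k X) (pre b C) = pre (blk k b) (bilin (insr s k) (pre k X) C)"
      unfolding bilin_pre_pre unfolding bilin_pre_left pre_bilin
    proof (rule bilin_cong)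
      fix u v assume "u \<in> keys X" "v \<in> keys C"
      then show "insr s k (k # u) (b # v) = pre (blk k b) (insr s k (k # u) v)"
        using X[of u] C[of v] ne by auto
    qed
    have YC: "bilin (insr s k) (pre k Y) (pre b C) = pre (blk k b) (bilin (insr s k) (pre k Y) C)
        + pre (blk k b) (bilin (insr s k) Y (pre b C))"
      unfolding YC0 unfolding bilin_pre_pre unfolding bilin_pre_left pre_bilin bilin_fun_add[symmetric]
    proof (rule bilin_cong)
      fix u v assume "u \<in> keys Y" "v \<in> keys C"
      then show "insr s k (k # u) (b # v) = pre (blk k b) (insr s k (k # u) v) + pre (blk k b) (insr s k u (b # v))"
        using Y[of u] C[of v] ne by auto
    qed
    show "bilin (insr s k) (pre k X + pre k Y) (pre b C + pre b E)
      = pre (blk k b) (bilin (insr s k) (pre k X + pre k Y) C)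
        + (pre (blk k b) (bilin (insr s k) Y (pre b C + pre b E))
           + frag_cmul ((-1) ^ n) (pre (blk k b) (bilin (insr s k) (pre k X + pre k Y) E)))"
      unfolding sum bilin_add_left bilin_add_right XC YC XE YE pre_add by (simp add: algebra_simps frag_cmul_distrib2)
  next
    assume e: "keys C \<subseteq> {[]}"
    have XC: "bilin (insr s k) (pre k X) (pre b C)
        = pre (blk k b) (bilin (\<lambda>u v. frag_of (map (shf s k) u)) X C)"
      unfolding bilin_pre_pre pre_bilin
    proof (rule bilin_cong)
      fix u v assume "u \<in> keys X" "v \<in> keys C"
      then show "insr s k (k # u) (b # v) = pre (blk k b) (frag_of (map (shf s k) u))"
        using X[of u] e by auto
    qed
    have YC: "bilin (insr s k) (pre k Y) (pre b C) = pre (blk k b) (bilin (insr s k) Y (pre b C))"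
      unfolding YC0 unfolding bilin_pre_pre pre_bilin
    proof (rule bilin_cong)
      fix u v assume "u \<in> keys Y" "v \<in> keys C"
      then show "insr s k (k # u) (b # v) = pre (blk k b) (insr s k u (b # v))"
        using Y[of u] e by auto
    qed
    show "bilin (insr s k) (pre k X + pre k Y) (pre b C + pre b E)
      = pre (blk k b) (bilin (\<lambda>u v. frag_of (map (shf s k) u)) X C)
        + (pre (blk k b) (bilin (insr s k) Y (pre b C + pre b E))
           + frag_cmul ((-1) ^ n) (pre (blk k b) (bilin (insr s k) (pre k X + pre k Y) E)))"
      unfolding sum bilin_add_left bilin_add_right XC YC XE YE pre_add by (simp add: algebra_simps frag_cmul_distrib2)
  }
qed

text \<open>The central comparison of the Eilenberg-Zilber composite with insertion, by induction on
  total size for arbitrary letter sets \<open>A\<close> and \<open>B\<close>, since both recursions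
  delete letters. When the first letter is \<open>k\<close>, the summands of
  \<open>path_sum_trw\<close> correspond to the clauses of \<open>insr\<close>: deleting
  \<open>b\<close> to using up this letter of \<open>v\<close>, an x-step to going on to the next
  \<open>k\<close>, a y-step to a \<open>b\<close> that occurs again.\<close>

theorem path_sum_insr:
  assumes "family A U" "family B V" "k \<in> A" "B \<noteq> {}" "B \<subseteq> {1..s}" "1 \<le> k" "1 \<le> s"
  shows "eqd (path_sum (pcs s k) trw U V) (bilin (insr s k) (trw U) (trw V))"
  using assms(1-5)
proof (induction "sum_list (map length U) + length U + sum_list (map length V) + length V"
    arbitrary: A B U V rule: less_induct)
  case less
  show ?case
  proof (cases "U = [] \<or> V = []")
    case True
    then show ?thesis by (auto simp: eqd_refl)
  next
    case False
    then obtain u0 us v0 vs where U0: "U = u0 # us" and V0: "V = v0 # vs"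
      by (cases U; cases V) auto
    then have "set u0 = A" "set v0 = B" using less.prems by (auto simp: family_Cons)
    then obtain x u b v where uv: "u0 = x # u" "v0 = b # v"
      using less.prems by (cases u0; cases v0) auto
    note U = U0[unfolded uv] and V = V0[unfolded uv]
    have famU: "family A us" "x \<in> A" "finite A" using less.prems(1) by (auto simp: U family_Cons)
    have famV: "family B vs" "b \<in> B" "finite B" using less.prems(2) by (auto simp: V family_Cons)
    have okV: "block_ok s k v'" if "v' \<in> set V" for v'
      using that less.prems(2,5) assms(6,7) by (auto simp: block_ok_def family_def)
    have b1: "b \<in> {1..s}" using famV(2) less.prems(5) by blast
    have Vne: "[] \<notin> keys (trw W)" if "family B W" for W
      using keys_trw[OF that, of "[]"] less.prems(4) by auto
    have smaller: "sum_list (map length (map (removeAll a) W)) \<le> sum_list (map length W)" for a and W :: "nat list list"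
      unfolding map_map o_def by (intro sum_list_mono) (rule length_removeAll_less_eq)
    have len: "length (removeAll a w) \<le> length w" for a and w :: "nat list" by (rule length_removeAll_less_eq)
    have IHus: "eqd (path_sum (pcs s k) trw us V) (bilin (insr s k) (trw us) (trw V))"
      by (rule less.hyps[OF _ famU(1) less.prems(2-5)]) (simp add: U)
    have IHvs: "eqd (path_sum (pcs s k) trw U vs) (bilin (insr s k) (trw U) (trw vs))"
      by (rule less.hyps[OF _ less.prems(1) famV(1) less.prems(3-5)]) (simp add: V)
    show ?thesis
    proof (cases "x = k")
      case False
      let ?a = "shf s k x"
      have "pcs s k (x # u) (b # v) = ?a # pcs s k u (b # v)"
        using False by (simp add: pcs_Cons)
      note rec = path_sum_trw[of "pcs s k", OF this, of us vs, folded U V]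
      have "path_sum (pcs s k) trw (map (removeAll x) U) (map id V)
          = path_sum (pcs s k) (\<lambda>X. trw (map (removeAll ?a) X)) U V"
        by (rule path_sum_map) (simp add: removeAll_shf_pcs[OF okV False])
      then have rem: "path_sum (pcs s k) (\<lambda>X. trw (map (removeAll ?a) X)) U V
          = path_sum (pcs s k) trw (map (removeAll x) U) V" by simp
      have IHrem: "eqd (path_sum (pcs s k) trw (map (removeAll x) U) V)
          (bilin (insr s k) (trw (map (removeAll x) U)) (trw V))"
      proof (rule less.hyps[OF _ family_remove[OF less.prems(1)] less.prems(2) _ less.prems(4,5)])
        show "k \<in> A - {x}" using less.prems(3) False by auto
        show "sum_list (map length (map (removeAll x) U)) + length (map (removeAll x) U)
            + sum_list (map length V) + length V
          < sum_list (map length U) + length U + sum_list (map length V) + length V"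
          using add_mono[OF len[of x u] smaller[of x us]] by (simp add: U)
      qed
      have trwU: "trw U = pre x (trw (map (removeAll x) U)) + pre x (trw us)"
        unfolding U trw.simps ..
      have ins: "bilin (insr s k) (trw U) (trw W) = pre ?a (bilin (insr s k) (trw (map (removeAll x) U)) (trw W))
          + pre ?a (bilin (insr s k) (trw us) (trw W))" if "family B W" for W
        unfolding trwU bilin_add_left using False Vne[OF that] by (simp add: bilin_insr_other)
      \<comment> \<open>A y-step leaves the first word of \<open>U\<close> in place, so the next row
        begins with \<open>?a\<close> again. The term is degenerate, in agreement with the absence
        of a corresponding clause in \<open>insr\<close>.\<close>
      have "eqd (pre ?a (path_sum (pcs s k) trw U vs)) (pre ?a (bilin (insr s k) (trw U) (trw vs)))"
        by (rule eqd_pre[OF IHvs])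
      also have "pre ?a (bilin (insr s k) (trw U) (trw vs))
        = pre ?a (pre ?a (bilin (insr s k) (trw (map (removeAll x) U)) (trw vs)
            + bilin (insr s k) (trw us) (trw vs)))"
        unfolding ins[OF famV(1)] by (simp add: pre_add)
      finally have "eqd (pre ?a (path_sum (pcs s k) trw U vs)) 0"
        using eqd_trans eqd_pre_pre_0 by blast
      then have z: "eqd (frag_cmul ((-1) ^ length us) (pre ?a (path_sum (pcs s k) trw U vs))) 0"
        using eqd_cmul by fastforce
      show ?thesis
        unfolding rec rem ins[OF less.prems(2)]
        using eqd_add[OF eqd_pre[OF IHrem, of ?a] eqd_add[OF eqd_pre[OF IHus, of ?a] z]] by simp
    next
      case x: True
      let ?a = "blk k b"
      have "pcs s k (x # u) (b # v) = ?a # map (blk k) v @ pcs s k u (b # v)"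
        using x by (simp add: pcs_Cons)
      note rec = path_sum_trw[of "pcs s k", OF this, of us vs, folded U V]
      have "path_sum (pcs s k) trw (map id U) (map (removeAll b) V)
          = path_sum (pcs s k) (\<lambda>X. trw (map (removeAll ?a) X)) U V"
      proof (rule path_sum_map)
        fix u v assume "v \<in> set V"
        then have "block_ok s k (b # v)" using okV[of v] b1 by (simp add: block_ok_def)
        then show "pcs s k (id u) (removeAll b v) = removeAll ?a (pcs s k u v)"
          by (simp add: removeAll_blk_pcs)
      qed
      then have rem: "path_sum (pcs s k) (\<lambda>X. trw (map (removeAll ?a) X)) U V
          = path_sum (pcs s k) trw U (map (removeAll b) V)" by simp
      define X where "X = trw (map (removeAll k) U)"
      define Y where "Y = trw us"
      define C where "C = trw (map (removeAll b) V)"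
      define E where "E = trw vs"
      have TU: "trw U = pre k X + pre k Y" unfolding U X_def Y_def x trw.simps ..
      have TV: "trw V = pre b C + pre b E" unfolding V C_def E_def trw.simps ..
      have kX: "k \<notin> set u \<and> ncaes (k # u) = length us" if "u \<in> keys X" for u
        using keys_trw[OF family_remove[OF less.prems(1)], of u k]
          ncaes_trw[OF family_remove[OF less.prems(1)], of k u] that False by (auto simp: X_def U)
      have kY: "k \<in> set u \<and> ncaes (k # u) = length us" if "u \<in> keys Y" for u
      proof -
        have "us \<noteq> []" using that by (auto simp: Y_def)
        then show ?thesis using keys_trw[OF famU(1), of u] ncaes_trw[OF famU(1), of u] that less.prems(3)
          by (simp add: Y_def)
      qed
      have kC: "b \<notin> set v \<and> set v = B - {b}" if "v \<in> keys C" for v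
        using keys_trw[OF family_remove[OF less.prems(2)], of v b] that by (auto simp: C_def)
      have kE: "b \<in> set v" if "v \<in> keys E" for v
        using keys_trw[OF famV(1), of v] that famV(2) by (auto simp: E_def)
      have rest: "eqd (pre ?a (path_sum (pcs s k) trw us V)
          + frag_cmul ((-1) ^ length us) (pre ?a (path_sum (pcs s k) trw U vs)))
        (pre ?a (bilin (insr s k) Y (pre b C + pre b E))
          + frag_cmul ((-1) ^ length us) (pre ?a (bilin (insr s k) (pre k X + pre k Y) E)))"
        using IHus IHvs unfolding Y_def E_def TU[symmetric] TV[symmetric, unfolded E_def]
        by (intro eqd_add eqd_cmul eqd_pre) (simp_all add: TV E_def TU Y_def)
      have hX: "\<forall>u\<in>keys X. k \<notin> set u \<and> ncaes (k # u) = length us"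
        and hY: "\<forall>u\<in>keys Y. k \<in> set u \<and> ncaes (k # u) = length us"
        and hC: "\<forall>v\<in>keys C. b \<notin> set v" and hE: "\<forall>v\<in>keys E. b \<in> set v"
        using kX kY kC kE by blast+
      note formula = bilin_insr_same[where s = s, OF hX hY hC hE]
      show ?thesis
      proof (cases "B = {b}")
        case False
        then have "B - {b} \<noteq> {}" using famV(2) by blast
        then have ne: "[] \<notin> keys C" using kC by fastforce
        have IHrem: "eqd (path_sum (pcs s k) trw U (map (removeAll b) V))
            (bilin (insr s k) (pre k X + pre k Y) C)"
          unfolding TU[symmetric] C_def
        proof (rule less.hyps[OF _ less.prems(1) family_remove[OF less.prems(2)] less.prems(3)])
          show "B - {b} \<noteq> {}" by fact
          show "B - {b} \<subseteq> {1..s}" using less.prems(5) by blast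
          show "sum_list (map length U) + length U
              + sum_list (map length (map (removeAll b) V)) + length (map (removeAll b) V)
            < sum_list (map length U) + length U + sum_list (map length V) + length V"
            using add_mono[OF len[of b v] smaller[of b vs]] by (simp add: V)
        qed
        show ?thesis
          unfolding rec rem unfolding TU TV
          unfolding formula(1)[OF ne] by (rule eqd_add[OF eqd_pre[OF IHrem] rest])
      next
        case B: True
        have all: "w = []" if w: "w \<in> set (map (removeAll b) V)" for w
        proof -
          obtain w' where w': "w' \<in> set V" "w = removeAll b w'" using w by auto
          then have "set w' = {b}" using less.prems(2) B by (auto simp: family_def)
          then have "set w = {}" unfolding w'(2) set_removeAll by simp
          then show ?thesis by (simp only: set_empty)
        qed
        have dead: "path_sum (pcs s k) trw U (map (removeAll b) V)
            = path_sum (\<lambda>u v. map (shf s k) (removeAll k u)) trw U (map (removeAll b) V)"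
        proof (rule path_sum_congf)
          fix u v assume "v \<in> set (map (removeAll b) V)"
          then have "v = []" using all by blast
          then show "pcs s k u v = map (shf s k) (removeAll k u)" by (simp add: pcs_dead)
        qed
        have keysC: "keys C \<subseteq> {[]}" using kC B by fastforce
        have red: "eqd (path_sum (pcs s k) trw U (map (removeAll b) V))
            (bilin (\<lambda>u v. frag_of (map (shf s k) u)) X C)"
        proof (cases vs)
          case Nil
          have "path_sum (pcs s k) trw U (map (removeAll b) V)
              = trw (map (map (shf s k)) (map (removeAll k) U))"
            unfolding dead using False by (simp add: V Nil path_sum_singleton_right o_def)
          also have "\<dots> = frag_extend (\<lambda>u. frag_of (map (shf s k) u)) X"
            unfolding X_def by (rule trw_map[OF inj_shf[OF assms(7)]])
          also have "\<dots> = bilin (\<lambda>u v. frag_of (map (shf s k) u)) X C"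
          proof -
            have "removeAll b (b # v) = []" by (rule all) (simp add: V)
            then have "C = frag_of []" by (simp add: C_def V Nil)
            then show ?thesis by (simp add: bilin_def)
          qed
          finally show ?thesis by (simp add: eqd_refl)
        next
          case (Cons v1 vs1)
          have "removeAll b (b # v) = []" by (rule all) (simp add: V)
          then have "C = 0" by (simp add: C_def V Cons)
          moreover have "eqd (path_sum (pcs s k) trw U (map (removeAll b) V)) 0"
            unfolding dead by (rule path_sum_dead) (simp add: V Cons)
          ultimately show ?thesis by simp
        qed
        show ?thesis
          unfolding rec rem unfolding TU TV
          unfolding formula(2)[OF keysC] by (rule eqd_add[OF eqd_pre[OF red] rest])
      qed
    qed
  qed
qed

lemma frag_extend_bilin: "frag_extend (\<lambda>b. bilin f x (frag_of b)) y = bilin f x y"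
  by (rule linear_eq_on_keys[where x = y]) (simp_all add: frag_extend_diff bilin_diff_right)

lemma bilin_extend_both:
  "bilin f (frag_extend g x) (frag_extend h y) = bilin (\<lambda>a b. bilin f (g a) (h b)) x y"
proof -
  have "bilin f (frag_extend g x) (frag_extend h y)
      = bilin (\<lambda>a b. bilin f (g a) (frag_of b)) x (frag_extend h y)"
    by (rule bilin_extend_left)
  also have "\<dots> = bilin (\<lambda>a b. frag_extend (\<lambda>b. bilin f (g a) (frag_of b)) (h b)) x y"
    by (rule bilin_extend_right)
  finally show ?thesis unfolding frag_extend_bilin .
qed

lemma red_pcomp:
  assumes "1 \<le> k" "k \<le> r" "1 \<le> s" "x \<in> be_chains r d" "y \<in> be_chains s e"
  shows "red (r + s - 1) (ez k x y) = bilin (sj_pcomp r s k) (red r x) (red s y)"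
proof -
  have basis: "red (r + s - 1) (be_pcomp k U V) = bilin (sj_pcomp r s k) (cls r (trw U)) (cls s (trw V))"
    if UV: "U \<in> be_simplices r d" "V \<in> be_simplices s e" for U V
  proof -
    have ne: "U \<noteq> []" "V \<noteq> []" using UV by (auto simp: be_simplices_iff)
    have fam: "family {1..r} U" "family {1..s} V" using UV be_simplices_family by auto
    have "red (r + s - 1) (be_pcomp k U V) = path_sum (perm_comp k) (\<lambda>X. cls (r + s - 1) (trw X)) U V"
      unfolding be_pcomp_path_sum[OF ne] path_sum_linear[of "red (r + s - 1)", OF red_add red_cmul] red_class ..
    also have "\<dots> = cls (r + s - 1) (path_sum (perm_comp k) trw U V)"
      by (rule path_sum_linear[of "cls (r + s - 1)", OF cls_add cls_cmul, symmetric])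
    also have "path_sum (perm_comp k) trw U V = path_sum (pcs s k) trw U V"
      by (rule path_sum_congf) (use UV length_perms in \<open>auto simp: be_simplices_iff intro!: perm_comp_pcs\<close>)
    also have "cls (r + s - 1) \<dots> = cls (r + s - 1) (bilin (insr s k) (trw U) (trw V))"
      by (intro eqd_cls path_sum_insr[OF fam]) (use assms in auto)
    also have "\<dots> = bilin (\<lambda>u v. cls (r + s - 1) (insr s k u v)) (trw U) (trw V)"
      unfolding cls_def by (rule extend_bilin)
    also have "\<dots> = bilin (\<lambda>u v. bilin (sj_pcomp r s k) (sj_class r u) (sj_class s v)) (trw U) (trw V)"
    proof (rule bilin_cong)
      fix u v assume uv: "u \<in> keys (trw U)" "v \<in> keys (trw V)"
      have su: "set u = {1..r}" "set v = {1..s}"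
        using keys_trw[OF fam(1) uv(1)] keys_trw[OF fam(2) uv(2)] by auto
      show "cls (r + s - 1) (insr s k u v) = bilin (sj_pcomp r s k) (sj_class r u) (sj_class s v)"
      proof (cases "distinct_adj u \<and> distinct_adj v")
        case True
        have "sj_pcomp r s k u v = cls (r + s - 1) (insr s k u v)"
          by (rule sj_pcomp_insr) (use su assms in \<open>auto simp: block_ok_def\<close>)
        then show ?thesis using su True by (simp add: sj_class_def)
      next
        case False
        then have "cls (r + s - 1) (insr s k u v) = 0"
          by (intro cls_degenerate insr_degenerate) (auto simp: degenerate_def)
        then show ?thesis using False by (auto simp: sj_class_def)
      qed
    qed
    also have "\<dots> = bilin (sj_pcomp r s k) (cls r (trw U)) (cls s (trw V))"
      unfolding cls_def by (rule bilin_extend_both[symmetric])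
    finally show ?thesis .
  qed
  have "red (r + s - 1) (ez k x y) = bilin (\<lambda>U V. red (r + s - 1) (be_pcomp k U V)) x y"
    unfolding ez_def red_def by (rule extend_bilin)
  also have "\<dots> = bilin (\<lambda>U V. bilin (sj_pcomp r s k) (cls r (trw U)) (cls s (trw V))) x y"
    by (rule bilin_cong) (use basis assms in blast)
  also have "\<dots> = bilin (sj_pcomp r s k) (red r x) (red s y)"
    unfolding red_def by (rule bilin_extend_both[symmetric])
  finally show ?thesis .
qed

section \<open>Sections of table reduction\<close>

text \<open>The cone operator on words that corresponds to \<open>cone \<sigma>\<close> under table reduction.\<close>

primrec word_cone :: "nat list \<Rightarrow> (nat list \<Rightarrow>\<^sub>0 int) \<Rightarrow> nat list \<Rightarrow>\<^sub>0 int" where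
  "word_cone [] x = 0"
| "word_cone (a # \<sigma>) x = pre a x + pre a (word_cone \<sigma> (drp a x))"

lemma word_cone_diff: "word_cone \<sigma> (x - y) = word_cone \<sigma> x - word_cone \<sigma> y"
  by (induction \<sigma> arbitrary: x y) (simp_all add: pre_diff drp_diff)

lemma word_cone_0 [simp]: "word_cone \<sigma> 0 = 0"
  by (induction \<sigma>) simp_all

lemma word_cone_degenerate: "keys x \<subseteq> degenerate \<Longrightarrow> keys (word_cone \<sigma> x) \<subseteq> degenerate"
proof (induction \<sigma> arbitrary: x)
  case (Cons a \<sigma>)
  have "keys (word_cone \<sigma> (drp a x)) \<subseteq> degenerate"
    by (intro Cons.IH keys_drp_degenerate Cons.prems)
  then show ?case
    unfolding word_cone.simps by (intro keys_add_subset keys_pre_degenerate Cons.prems)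
qed simp

lemma word_cone_extend: "word_cone \<sigma> x = frag_extend (\<lambda>u. word_cone \<sigma> (frag_of u)) x"
  by (rule linear_eq_on_keys[where x = x]) (simp_all add: word_cone_diff frag_extend_diff)

text \<open>The first row is read off \<open>\<sigma>\<close>. After a non-final \<open>a\<close>
  the reduction goes on with \<open>a\<close> removed from \<open>W\<close>, and
  \<open>trw_drp\<close> expresses this through the reduction of \<open>W\<close> itself, so a cone
  of simplices becomes an operation on words.\<close>

lemma trw_word_cone:
  assumes "family A (\<sigma> # W)" "W \<noteq> []"
  shows "trw (\<sigma> # W) = word_cone \<sigma> (trw W)"
  using assms
proof (induction \<sigma> arbitrary: A W)
  case (Cons a \<sigma>)
  have fam: "family A W" "a \<in> A" "a \<notin> set \<sigma>" using Cons.prems by (auto simp: family_Cons)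
  have rem: "map (removeAll a) ((a # \<sigma>) # W) = \<sigma> # map (removeAll a) W"
    using fam(3) by simp
  have "trw (\<sigma> # map (removeAll a) W) = word_cone \<sigma> (trw (map (removeAll a) W))"
    using family_remove[OF Cons.prems(1), of a] Cons.prems(2) unfolding rem by (intro Cons.IH) auto
  then show ?case
    unfolding trw.simps rem word_cone.simps trw_drp[OF fam(1,2)] by (simp add: add.commute)
qed simp

lemma cls_word_cone_cls:
  assumes "keys x \<subseteq> sj_words r"
  shows "cls r (word_cone \<sigma> (cls r x)) = cls r (word_cone \<sigma> x)"
  unfolding word_cone_extend[of \<sigma> x] word_cone_extend[of \<sigma> "cls r x"]
  using word_cone_degenerate by (intro cls_extend_cls[OF assms]) simp

lemma red_cone:
  assumes "\<sigma> \<in> perms r" "x \<in> be_chains r d"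
  shows "red r (cone \<sigma> x) = cls r (word_cone \<sigma> (red r x))"
proof (rule linear_eq_on_keys[where x = x])
  fix W assume "W \<in> keys x"
  then have W: "W \<in> be_simplices r d" using assms by auto
  have fam: "family {1..r} W" by (rule be_simplices_family[OF W])
  have "W \<noteq> []" using W by (auto simp: be_simplices_iff)
  moreover have "family {1..r} (\<sigma> # W)" using fam assms(1) by (auto simp: family_Cons perms_iff)
  ultimately have "trw (\<sigma> # W) = word_cone \<sigma> (trw W)" by (intro trw_word_cone)
  then show "red r (cone \<sigma> (frag_of W)) = cls r (word_cone \<sigma> (red r (frag_of W)))"
    by (simp add: cone_def red_class cls_word_cone_cls[OF family_sj_words[OF fam]])
qed (simp_all add: cone_diff red_diff cls_diff word_cone_diff)

primrec first_occs :: "nat list \<Rightarrow> nat list" where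
  "first_occs [] = []"
| "first_occs (a # u) = a # removeAll a (first_occs u)"

lemma set_first_occs: "set (first_occs u) = set u"
  by (induction u) auto

lemma distinct_first_occs: "distinct (first_occs u)"
  by (induction u) (auto simp: distinct_removeAll)

lemma first_occs_perms: "set u = {1..r} \<Longrightarrow> first_occs u \<in> perms r"
  by (simp add: perms_iff set_first_occs distinct_first_occs)

text \<open>Letters occurring once at the front of \<open>u\<close> are peeled off. At the first
  repeated letter \<open>a\<close>, prepending \<open>a\<close> to the boundary restores
  \<open>u\<close> up to doubled letters, and \<open>drp a\<close> kills the boundary, its two
  contributions cancelling. A caesura is required, since the boundary of a permutation is 0.\<close>

lemma word_cone_bdry:
  assumes "ncaes u > 0"
  shows "eqd (word_cone (first_occs u) (word_bdry u)) (frag_of u)"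
  using assms
proof (induction u)
  case (Cons a u)
  show ?case
  proof (cases "a \<in> set u")
    case False
    then have fo: "first_occs (a # u) = a # first_occs u"
      by (simp add: set_first_occs)
    have drp: "drp a (pre a (word_bdry u)) = word_bdry u"
      by (rule drp_pre_same) (use keys_word_bdry False in blast)
    have IH: "eqd (word_cone (first_occs u) (word_bdry u)) (frag_of u)"
      using Cons False by simp
    show ?thesis
      using eqd_add[OF eqd_pre_pre_0[of a "word_bdry u"] eqd_pre[OF IH, of a]] False
      unfolding fo by (simp add: word_bdry_Cons drp)
  next
    case True
    have 1: "drp a (pre a (word_bdry u)) = 0"
      by (rule drp_pre_repeated) (use keys_word_bdry True in blast)
    have 2: "drp a (pre a (drp_word a u)) = drp_word a u"
      by (rule drp_pre_same) (auto simp: drp_word_def split: if_splits)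
    have drp: "drp a (word_bdry (a # u)) = 0"
      using True by (simp add: word_bdry_Cons drp_diff 1 2)
    have "pre a (word_bdry (a # u)) = frag_of (a # u) + frag_cmul (-1) (pre a (pre a (word_bdry u)))
        + frag_cmul (-1) (pre a (pre a (drp_word a u)))"
      using True by (simp add: word_bdry_Cons pre_diff)
    moreover have "eqd (frag_of (a # u) + frag_cmul (-1) (pre a (pre a (word_bdry u)))
        + frag_cmul (-1) (pre a (pre a (drp_word a u)))) (frag_of (a # u) + frag_cmul (-1) 0 + frag_cmul (-1) 0)"
      by (intro eqd_add eqd_cmul eqd_pre_pre_0 eqd_refl)
    ultimately show ?thesis by (simp add: drp)
  qed
qed simp

section \<open>The section and the homotopy on chains\<close>

abbreviation sj_chains :: "nat \<Rightarrow> nat \<Rightarrow> (nat list \<Rightarrow>\<^sub>0 int) set" where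
  "sj_chains r d \<equiv> {c. keys c \<subseteq> surjections r d}"

lemma surjections_ncaes: "u \<in> surjections r d \<Longrightarrow> ncaes u = d"
proof -
  assume "u \<in> surjections r d"
  then have "length u = r + d" "set u = {1..r}" by (auto simp: surjections_def)
  then show "ncaes u = d" using length_ncaes[of u] by simp
qed

lemma cls_surjections: "keys x \<subseteq> surjections r d \<Longrightarrow> cls r x = x"
  by (rule cls_nondegenerate) (auto simp: surjections_def sj_words_def)

lemma surjections_0: "surjections r 0 = perms r"
proof (rule Set.set_eqI, rule iffI)
  fix u assume "u \<in> surjections r 0"
  then have "length u = r" "set u = {1..r}" by (auto simp: surjections_def)
  then show "u \<in> perms r" by (simp add: perms_iff card_distinct)
next
  fix u assume u: "u \<in> perms r"
  have "distinct_adj w" if "distinct w" for w :: "nat list"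
    using that by (induction w) (auto simp: distinct_adj_Cons)
  then show "u \<in> surjections r 0"
    using u length_perms[OF u] by (simp add: surjections_def perms_iff)
qed

lemma keys_sj_bdry: "u \<in> surjections r (Suc d) \<Longrightarrow> keys (sj_bdry r u) \<subseteq> surjections r d"
proof
  fix v assume u: "u \<in> surjections r (Suc d)" and "v \<in> keys (sj_bdry r u)"
  then have "v \<in> keys (word_bdry u)" "distinct_adj v"
    using keys_cls unfolding sj_bdry_cls by blast+
  then show "v \<in> surjections r d"
    using keys_word_bdry[of v u] u by (simp add: surjections_def)
qed

lemma cone_chains:
  assumes "\<sigma> \<in> perms r" "x \<in> be_chains r d"
  shows "cone \<sigma> x \<in> be_chains r (Suc d)"
  unfolding cone_def mem_Collect_eq
proof (rule keys_extend_subset)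
  fix W assume "W \<in> keys x"
  then have "W \<in> be_simplices r d" using assms by auto
  then show "keys (be_class (\<sigma> # W)) \<subseteq> be_simplices r (Suc d)"
    using assms(1) by (auto simp: be_class_def be_simplices_iff)
qed

lemma red_chains:
  assumes "x \<in> be_chains r d"
  shows "red r x \<in> sj_chains r d"
  unfolding red_def mem_Collect_eq
proof (rule keys_extend_subset)
  fix W assume "W \<in> keys x"
  then have W: "W \<in> be_simplices r d" using assms by auto
  have "length W = Suc d" using W by (simp add: be_simplices_iff)
  show "keys (cls r (trw W)) \<subseteq> surjections r d"
  proof
    fix u assume "u \<in> keys (cls r (trw W))"
    then have "u \<in> keys (trw W)" "distinct_adj u" using keys_cls by blast+
    then show "u \<in> surjections r d"
      using keys_trw[OF be_simplices_family[OF W], of u] \<open>length W = Suc d\<close>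
      by (simp add: surjections_def)
  qed
qed

primrec sec :: "nat \<Rightarrow> nat \<Rightarrow> (nat list \<Rightarrow>\<^sub>0 int) \<Rightarrow> simplex \<Rightarrow>\<^sub>0 int" where
  "sec r 0 = frag_extend (\<lambda>u. frag_of [u])"
| "sec r (Suc d) = frag_extend (\<lambda>u. cone (first_occs u) (sec r d (sj_bdry r u)))"

lemma sec_0 [simp]: "sec r d 0 = 0"
  and sec_diff: "sec r d (x - y) = sec r d x - sec r d y"
  by (cases d; simp add: frag_extend_diff)+

lemma sec_extend: "sec r d x = frag_extend (\<lambda>u. sec r d (frag_of u)) x"
  by (cases d) simp_all

lemma sec_chains: "x \<in> sj_chains r d \<Longrightarrow> sec r d x \<in> be_chains r d"
proof (induction d arbitrary: x)
  case 0
  then show ?case unfolding sec.simps mem_Collect_eq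
    by (intro keys_extend_subset) (auto simp: surjections_0 be_simplices_iff)
next
  case (Suc d)
  show ?case unfolding sec.simps mem_Collect_eq
  proof (rule keys_extend_subset)
    fix u assume "u \<in> keys x"
    then have u: "u \<in> surjections r (Suc d)" using Suc.prems by auto
    then have "first_occs u \<in> perms r" by (intro first_occs_perms) (simp add: surjections_def)
    then have "cone (first_occs u) (sec r d (sj_bdry r u)) \<in> be_chains r (Suc d)"
      using Suc.IH keys_sj_bdry[OF u] by (intro cone_chains) auto
    then show "keys (cone (first_occs u) (sec r d (sj_bdry r u))) \<subseteq> be_simplices r (Suc d)" by simp
  qed
qed

text \<open>Under \<open>red\<close> the cone in \<open>sec\<close> becomes
  \<open>word_cone\<close>, which rebuilds \<open>u\<close> from its boundary. Only the section
  property in lower degree enters, not that \<open>sec\<close> commutes with boundaries.\<close>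

lemma red_sec: "x \<in> sj_chains r d \<Longrightarrow> red r (sec r d x) = x"
proof (induction d arbitrary: x)
  case 0
  show ?case
  proof (rule linear_eq_on_keys[where x = x])
    fix u assume "u \<in> keys x"
    then have u: "u \<in> surjections r 0" using 0 by auto
    then have "distinct u" by (simp add: surjections_0 perms_iff)
    then show "red r (sec r 0 (frag_of u)) = frag_of u"
      using cls_surjections[of "frag_of u" r 0] u by (simp add: trw_singleton)
  qed (simp_all add: red_diff sec_diff del: sec.simps)
next
  case (Suc d)
  show ?case
  proof (rule linear_eq_on_keys[where x = x])
    fix u assume "u \<in> keys x"
    then have u: "u \<in> surjections r (Suc d)" using Suc.prems by auto
    then have su: "set u = {1..r}" by (simp add: surjections_def)
    have ch: "sj_bdry r u \<in> sj_chains r d" using keys_sj_bdry[OF u] by simp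
    have "red r (sec r (Suc d) (frag_of u)) = red r (cone (first_occs u) (sec r d (sj_bdry r u)))"
      by simp
    also have "\<dots> = cls r (word_cone (first_occs u) (sj_bdry r u))"
      by (subst red_cone[OF first_occs_perms[OF su] sec_chains[OF ch]]) (simp add: Suc.IH[OF ch])
    also have "\<dots> = cls r (word_cone (first_occs u) (word_bdry u))"
      unfolding sj_bdry_cls
      by (rule cls_word_cone_cls) (use keys_word_bdry su in \<open>auto simp: sj_words_def\<close>)
    also have "\<dots> = cls r (frag_of u)"
      by (rule eqd_cls, rule word_cone_bdry) (simp add: surjections_ncaes[OF u])
    also have "\<dots> = frag_of u"
      by (rule cls_surjections) (use u in simp)
    finally show "red r (sec r (Suc d) (frag_of u)) = frag_of u" .
  qed (simp_all add: red_diff sec_diff del: sec.simps)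
qed

lemma sec_red_0:
  assumes "y \<in> be_chains r 0"
  shows "sec r 0 (red r y) = y"
proof (rule linear_eq_on_keys[where x = y])
  fix W assume "W \<in> keys y"
  then have W: "W \<in> be_simplices r 0" using assms by auto
  then obtain w where w: "W = [w]" "w \<in> perms r"
    by (cases W) (auto simp: be_simplices_iff)
  then have "distinct w" by (simp add: perms_iff)
  then have "red r (frag_of W) = frag_of w"
    using cls_surjections[of "frag_of w" r 0] w by (simp add: trw_singleton surjections_0)
  then show "sec r 0 (red r (frag_of W)) = frag_of W" by (simp add: w)
qed (simp_all add: red_diff sec_diff del: sec.simps)

text \<open>Lift \<open>x\<close> to a Barratt-Eccles chain by \<open>sec\<close>;
  \<open>red\<close> commutes with boundaries, and upstairs the boundary squares to zero.\<close>

lemma sj_bd_bd: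
  assumes "x \<in> sj_chains r d"
  shows "frag_extend (sj_bdry r) (frag_extend (sj_bdry r) x) = 0"
proof -
  let ?z = "sec r d x"
  have z: "?z \<in> be_chains r d" "x = red r ?z" using sec_chains[OF assms] red_sec[OF assms] by auto
  have 1: "frag_extend (sj_bdry r) x = red r (frag_extend be_bdry ?z)"
    using red_bdry[OF z(1)] z(2) by simp
  from z(1) show ?thesis
  proof (cases rule: be_chains_bd_cases)
    case 1
    then show ?thesis using \<open>frag_extend (sj_bdry r) x = _\<close> by simp
  next
    case (2 d')
    show ?thesis unfolding 1 red_bdry[OF 2(2)] by (simp add: bd_bd)
  qed
qed

text \<open>In higher degree the chain that is coned is a cycle by \<open>sj_bd_bd\<close> and the
  induction hypothesis, so it is the boundary of its cone. In degree 1 \<open>aug\<close> need not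
  vanish for formal reasons, and the claim is instead obtained by applying \<open>red\<close>, which
  \<open>sec\<close> inverts on vertices.\<close>

lemma sec_bdry:
  assumes "x \<in> sj_chains r (Suc d)"
  shows "frag_extend be_bdry (sec r (Suc d) x) = sec r d (frag_extend (sj_bdry r) x)"
  using assms
proof (induction d arbitrary: x)
  case 0
  let ?z = "sec r 1 x"
  have z: "?z \<in> be_chains r (Suc 0)" using sec_chains[OF 0] by simp
  have "frag_extend be_bdry ?z = sec r 0 (red r (frag_extend be_bdry ?z))"
    by (rule sec_red_0[symmetric]) (rule bd_chains[OF z])
  also have "red r (frag_extend be_bdry ?z) = frag_extend (sj_bdry r) x"
    unfolding red_bdry[OF z, symmetric] using red_sec[OF 0] by simp
  finally show ?case by simp
next
  case (Suc d)
  show ?case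
  proof (rule linear_eq_on_keys[where x = x])
    fix u assume "u \<in> keys x"
    then have u: "u \<in> surjections r (Suc (Suc d))" using Suc.prems by auto
    let ?y = "sec r (Suc d) (sj_bdry r u)"
    have ch: "sj_bdry r u \<in> sj_chains r (Suc d)" using keys_sj_bdry[OF u] by simp
    have y: "keys ?y \<subseteq> nd_simplices (Suc d)" by (rule be_chains_nd[OF sec_chains[OF ch]])
    have "frag_extend (sj_bdry r) (sj_bdry r u) = 0"
      using sj_bd_bd[of "frag_of u" r "Suc (Suc d)"] u by simp
    then have "frag_extend be_bdry ?y = 0"
      unfolding Suc.IH[OF ch] by simp
    then have "frag_extend be_bdry (cone (first_occs u) ?y) = ?y"
      using homotopy[OF y, of "first_occs u"] aug_degree_pos[OF y] by simp
    then show "frag_extend be_bdry (sec r (Suc (Suc d)) (frag_of u))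
        = sec r (Suc d) (frag_extend (sj_bdry r) (frag_of u))"
      unfolding sec.simps(2)[of r "Suc d"] frag_extend_of .
  qed (simp_all add: frag_extend_diff sec_diff del: sec.simps)
qed

text \<open>The value on \<open>W\<close> must have the coned chain as its boundary; the cone is
  taken from the first vertex of \<open>W\<close>, which keeps the filtration. In degree 0 the value
  is 0 because there \<open>sec\<close> and \<open>red\<close> are inverse to each other.\<close>

primrec homotopy_red :: "nat \<Rightarrow> nat \<Rightarrow> (simplex \<Rightarrow>\<^sub>0 int) \<Rightarrow> simplex \<Rightarrow>\<^sub>0 int" where
  "homotopy_red r 0 = (\<lambda>x. 0)"
| "homotopy_red r (Suc d) = frag_extend (\<lambda>W. cone (hd W)
     (sec r (Suc d) (red r (frag_of W)) - frag_of W - homotopy_red r d (be_bdry W)))"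

lemma homotopy_red_0 [simp]: "homotopy_red r d 0 = 0"
  and homotopy_red_diff: "homotopy_red r d (x - y) = homotopy_red r d x - homotopy_red r d y"
  by (cases d; simp add: frag_extend_diff)+

lemma homotopy_red_chains: "x \<in> be_chains r d \<Longrightarrow> homotopy_red r d x \<in> be_chains r (Suc d)"
proof (induction d arbitrary: x)
  case (Suc d)
  show ?case unfolding homotopy_red.simps mem_Collect_eq
  proof (rule keys_extend_subset)
    fix W assume "W \<in> keys x"
    then have W: "W \<in> be_simplices r (Suc d)" using Suc.prems by auto
    then have hd: "hd W \<in> perms r" by (cases W) (auto simp: be_simplices_iff)
    have "keys (sec r (Suc d) (red r (frag_of W)) - frag_of W - homotopy_red r d (be_bdry W)) \<subseteq> be_simplices r (Suc d)"
      using sec_chains[OF red_chains, of "frag_of W" r "Suc d"] Suc.IH[OF keys_be_bdry_chains[OF W]] W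
      by (intro keys_diff_subset) (auto simp del: red_simps sec.simps)
    then have "cone (hd W) (sec r (Suc d) (red r (frag_of W)) - frag_of W - homotopy_red r d (be_bdry W)) \<in> be_chains r (Suc (Suc d))"
      by (intro cone_chains[OF hd]) simp
    then show "keys (cone (hd W) (sec r (Suc d) (red r (frag_of W)) - frag_of W - homotopy_red r d (be_bdry W)))
      \<subseteq> be_simplices r (Suc (Suc d))" by simp
  qed
qed simp

text \<open>The coned chain is a cycle: the boundary of the \<open>sec\<close> summand is
  \<open>sec\<close> of \<open>red\<close> of the boundary of \<open>W\<close>, and by induction the
  other two summands cancel it. In degree 0 the truncated \<open>d - 1\<close> is harmless, as the
  homotopy vanishes there.\<close>

lemma homotopy_red_bdry:
  assumes "x \<in> be_chains r d"
  shows "frag_extend be_bdry (homotopy_red r d x)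
    = sec r d (red r x) - x - homotopy_red r (d - 1) (frag_extend be_bdry x)"
  using assms
proof (induction d arbitrary: x)
  case 0
  then show ?case using sec_red_0[OF 0] by simp
next
  case (Suc d)
  show ?case
  proof (rule linear_eq_on_keys[where x = x])
    fix W assume "W \<in> keys x"
    then have W: "W \<in> be_simplices r (Suc d)" using Suc.prems by auto
    then have Wc: "frag_of W \<in> be_chains r (Suc d)" by simp
    note bW = keys_be_bdry_chains[OF W]
    let ?S = "sec r (Suc d) (red r (frag_of W))"
    let ?Y = "?S - frag_of W - homotopy_red r d (be_bdry W)"
    have "keys ?Y \<subseteq> be_simplices r (Suc d)"
      using sec_chains[OF red_chains[OF Wc]] homotopy_red_chains[OF bW] W
      by (intro keys_diff_subset) (auto simp del: red_simps sec.simps)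
    then have kY: "keys ?Y \<subseteq> nd_simplices (Suc d)" using be_simplices_nd by blast
    have "frag_extend be_bdry ?S = sec r d (red r (be_bdry W))"
      unfolding sec_bdry[OF red_chains[OF Wc]] red_bdry[OF Wc] by simp
    moreover have "frag_extend be_bdry (homotopy_red r d (be_bdry W)) = sec r d (red r (be_bdry W)) - be_bdry W"
      unfolding Suc.IH[OF bW] bd_bd_basis by simp
    ultimately have "frag_extend be_bdry ?Y = 0"
      unfolding frag_extend_diff by simp
    then have "frag_extend be_bdry (cone (hd W) ?Y) = ?Y"
      using homotopy[OF kY, of "hd W"] aug_degree_pos[OF kY] by simp
    then show "frag_extend be_bdry (homotopy_red r (Suc d) (frag_of W))
        = ?S - frag_of W - homotopy_red r (Suc d - 1) (frag_extend be_bdry (frag_of W))"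
      unfolding homotopy_red.simps frag_extend_of diff_Suc_1 .
  qed (simp_all add: frag_extend_diff sec_diff red_diff homotopy_red_diff algebra_simps
      del: sec.simps homotopy_red.simps)
qed

section \<open>Variation estimates\<close>

lemma keys_word_bdry_subseq: "v \<in> keys (word_bdry u) \<Longrightarrow> subseq v u"
proof -
  have "keys (word_bdry u) \<subseteq> {v. subseq v u}"
    unfolding word_bdry_def
    by (intro keys_sum_subset keys_cmul_subset) (simp add: subseq_delete_nth)
  then show "v \<in> keys (word_bdry u) \<Longrightarrow> subseq v u" by blast
qed

lemma subseq_restrict_word: "subseq v u \<Longrightarrow> subseq (restrict_word i j v) (restrict_word i j u)"
  unfolding restrict_word_def by (rule subseq_filter)

lemma restrict_word_perm:
  assumes "\<sigma> \<in> perms r" "i \<in> {1..r}" "j \<in> {1..r}" "i \<noteq> j"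
  shows "restrict_word i j \<sigma> = [i, j] \<or> restrict_word i j \<sigma> = [j, i]"
proof -
  have d: "distinct (restrict_word i j \<sigma>)" and s: "set (restrict_word i j \<sigma>) = {i, j}"
    using assms by (auto simp: restrict_word_def perms_iff)
  then have "length (restrict_word i j \<sigma>) = 2"
    using distinct_card[OF d] assms(4) by simp
  then obtain a b where "restrict_word i j \<sigma> = [a, b]"
    by (auto simp: numeral_2_eq_2 length_Suc_conv)
  then show ?thesis using d s by (auto simp: doubleton_eq_iff)
qed

lemma restrict_word_perm_hd:
  assumes "\<sigma> \<in> perms r" "\<tau> \<in> perms r" "i \<in> {1..r}" "j \<in> {1..r}" "i \<noteq> j"
  shows "restrict_word i j \<sigma> = restrict_word i j \<tau> \<longleftrightarrow> hd (restrict_word i j \<sigma>) = hd (restrict_word i j \<tau>)"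
  using restrict_word_perm[OF assms(1,3-5)] restrict_word_perm[OF assms(2,3-5)] assms(5) by auto

text \<open>Adding the vertex \<open>s\<close> in front turns the condition on the number of variations and the first
  vertex that defines the cells of the filtrations into one inequality.\<close>

definition be_wt :: "nat \<Rightarrow> nat \<Rightarrow> nat list \<Rightarrow> simplex \<Rightarrow> nat" where
  "be_wt i j s W = variations (restrict_word i j s # map (restrict_word i j) W)"

definition sj_wt :: "nat \<Rightarrow> nat \<Rightarrow> nat list \<Rightarrow> nat list \<Rightarrow> nat" where
  "sj_wt i j s u = variations (hd (restrict_word i j s) # restrict_word i j u)"

lemma be_wt_Cons:
  "be_wt i j s (w # W) = (if restrict_word i j s \<noteq> restrict_word i j w then 1 else 0) + be_wt i j w W"
  by (simp add: be_wt_def)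

lemma be_wt_hd: "W \<noteq> [] \<Longrightarrow> be_wt i j (hd W) W = be_var W i j"
  by (cases W) (simp_all add: be_wt_def be_var_def)

lemma be_var_le_wt: "be_var W i j \<le> be_wt i j s W"
  unfolding be_var_def be_wt_def by (rule variations_Cons_mono)

lemma hd_restrict_first_occs:
  "restrict_word i j u \<noteq> [] \<Longrightarrow> hd (restrict_word i j (first_occs u)) = hd (restrict_word i j u)"
proof (induction u)
  case (Cons a u)
  have rem: "restrict_word i j (removeAll a w) = restrict_word i j w" if "a \<noteq> i" "a \<noteq> j" for w
    using that by (induction w) (auto simp: restrict_word_Cons)
  show ?case using Cons rem by (auto simp: restrict_word_Cons)
qed simp

lemma sj_wt_first_occs:
  assumes "i \<in> set u"
  shows "sj_wt i j (first_occs u) u = variations (restrict_word i j u)"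
proof -
  have "restrict_word i j u \<noteq> []" using assms by (auto simp: restrict_word_def filter_empty_conv)
  then show ?thesis
    unfolding sj_wt_def by (subst variations_Cons) (simp add: hd_restrict_first_occs)
qed

lemma sj_wt_eq:
  assumes "i \<in> set u"
  shows "sj_wt i j s u = (if hd (restrict_word i j s) \<noteq> hd (restrict_word i j u) then 1 else 0)
    + variations (restrict_word i j u)"
proof -
  have "restrict_word i j u \<noteq> []" using assms by (auto simp: restrict_word_def filter_empty_conv)
  then show ?thesis unfolding sj_wt_def by (subst variations_Cons) simp
qed

text \<open>The \<open>+ 1\<close> comes from degree 0, where the word \<open>u\<close> has one
  change between \<open>i\<close> and \<open>j\<close> and the vertex \<open>[u]\<close> has no
  variation. In the induction the words of the boundary are subsequences of \<open>u\<close>, and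
  passing from \<open>first_occs u\<close> to \<open>\<sigma>\<close> in front raises both sides by
  the same amount.\<close>

lemma sec_wt:
  assumes "u \<in> surjections r d" "W \<in> keys (sec r d (frag_of u))"
    and ij: "i \<in> {1..r}" "j \<in> {1..r}" "i \<noteq> j" and "\<sigma> \<in> perms r"
  shows "be_wt i j \<sigma> W + 1 \<le> sj_wt i j \<sigma> u"
  using assms(1,2,6)
proof (induction d arbitrary: u W \<sigma>)
  case 0
  then have W: "W = [u]" and u: "u \<in> perms r" by (auto simp: surjections_0)
  have "i \<in> set u" using u ij by (simp add: perms_iff)
  moreover have "variations (restrict_word i j u) = 1"
    using restrict_word_perm[OF u ij] ij(3) by auto
  ultimately show ?case
    using restrict_word_perm_hd[OF 0(3) u ij] by (simp add: W be_wt_def sj_wt_eq)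
next
  case (Suc d)
  have su: "set u = {1..r}" using Suc.prems by (simp add: surjections_def)
  let ?f = "first_occs u"
  have f: "?f \<in> perms r" by (rule first_occs_perms[OF su])
  from Suc.prems(2) have "W \<in> keys (cone ?f (sec r d (sj_bdry r u)))" by simp
  then obtain W' where W': "W' \<in> keys (sec r d (sj_bdry r u))" and W: "W = ?f # W'"
    using keys_frag_extend[of "\<lambda>W. be_class (?f # W)" "sec r d (sj_bdry r u)"] keys_be_class
    unfolding cone_def by blast
  from W' obtain v where v: "v \<in> keys (sj_bdry r u)" "W' \<in> keys (sec r d (frag_of v))"
    unfolding sec_extend[of r d "sj_bdry r u"]
    using keys_frag_extend[of "\<lambda>u. sec r d (frag_of u)" "sj_bdry r u"] by blast
  have vs: "v \<in> surjections r d" using v(1) keys_sj_bdry[OF Suc.prems(1)] by blast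
  have "be_wt i j ?f W' + 1 \<le> sj_wt i j ?f v"
    by (rule Suc.IH[OF vs v(2) f])
  also have "\<dots> \<le> sj_wt i j ?f u"
  proof -
    have "v \<in> keys (word_bdry u)" using v(1) keys_cls unfolding sj_bdry_cls by blast
    then show ?thesis unfolding sj_wt_def
      by (intro variations_subseq_Cons subseq_restrict_word keys_word_bdry_subseq)
  qed
  also have iu: "i \<in> set u" using su ij by simp
  then have "sj_wt i j ?f u = variations (restrict_word i j u)" by (rule sj_wt_first_occs)
  finally have *: "be_wt i j ?f W' + 1 \<le> variations (restrict_word i j u)" .
  have "restrict_word i j u \<noteq> []" using iu by (auto simp: restrict_word_def filter_empty_conv)
  then have "hd (restrict_word i j ?f) = hd (restrict_word i j u)" by (rule hd_restrict_first_occs)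
  then show ?case
    using * restrict_word_perm_hd[OF Suc.prems(3) f ij] unfolding W be_wt_Cons sj_wt_eq[OF iu] by simp
qed

lemma variations_constant: "set c \<subseteq> {y} \<Longrightarrow> variations (a # c) \<le> 1"
  by (induction c rule: induct_list012) auto

text \<open>The letter \<open>x\<close> in front is free because the induction replaces it by the
  letter just read. Each change in the word is charged to a change among the leading letters of the
  restricted vertices, except for one possible last change.\<close>

lemma trw_variations:
  assumes "family A W" "i \<in> A" "j \<in> A" "u \<in> keys (trw W)"
  shows "variations (x # restrict_word i j u)
    \<le> variations (x # map (\<lambda>w. hd (restrict_word i j w)) W) + 1"
  using assms
proof (induction W arbitrary: A u x rule: trw.induct)
  case (2 ws)
  then show ?case by (auto simp: family_Cons)
next
  case (3 a w ws)
  let ?f = "\<lambda>w. hd (restrict_word i j w)"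
  have fam: "family A ws" using 3(3) by (simp add: family_Cons)
  from 3(6) obtain v where u: "u = a # v"
    and v: "v \<in> keys (trw (map (removeAll a) ((a # w) # ws))) \<or> v \<in> keys (trw ws)"
    unfolding trw.simps(3)
    using keys_add[of "pre a (trw (map (removeAll a) ((a # w) # ws)))" "pre a (trw ws)"]
      keys_pre[of a "trw (map (removeAll a) ((a # w) # ws))"] keys_pre[of a "trw ws"] by blast
  show ?case
  proof (cases "a = i \<or> a = j")
    case False
    then have ru: "restrict_word i j u = restrict_word i j v" by (simp add: u restrict_word_Cons)
    have rem: "restrict_word i j (removeAll a w) = restrict_word i j w" for w
      using False by (induction w) (auto simp: restrict_word_Cons)
    from v show ?thesis
    proof
      assume *: "v \<in> keys (trw (map (removeAll a) ((a # w) # ws)))"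
      have "variations (x # restrict_word i j v)
          \<le> variations (x # map ?f (map (removeAll a) ((a # w) # ws))) + 1"
        by (rule 3(1)[OF family_remove[OF 3(3)] _ _ *]) (use False 3(4,5) in auto)
      also have "map ?f (map (removeAll a) ((a # w) # ws)) = map ?f ((a # w) # ws)"
        unfolding map_map o_def rem ..
      finally show ?thesis unfolding ru .
    next
      assume "v \<in> keys (trw ws)"
      then have "variations (x # restrict_word i j v) \<le> variations (x # map ?f ws) + 1"
        by (rule 3(2)[OF fam 3(4,5)])
      also have "\<dots> \<le> variations (x # map ?f ((a # w) # ws)) + 1"
        using variations_insert[of x "map ?f ws" "?f (a # w)"] by simp
      finally show ?thesis unfolding ru .
    qed
  next
    case True
    then have ru: "restrict_word i j u = a # restrict_word i j v" and fa: "?f (a # w) = a"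
      by (auto simp: u restrict_word_Cons)
    have "variations (a # restrict_word i j v) \<le> variations (a # map ?f ws) + 1"
      using v
    proof
      \<comment> \<open>Once \<open>a\<close> is written inside a row it never returns, so only the
        other letter of the pair remains. This is the single change that the \<open>+ 1\<close>
        allows.\<close>
      assume *: "v \<in> keys (trw (map (removeAll a) ((a # w) # ws)))"
      have "a \<notin> set v" using keys_trw[OF family_remove[OF 3(3)] *] by blast
      then have "set (restrict_word i j v) \<subseteq> {if a = i then j else i}"
        using True by (auto simp: restrict_word_def)
      then have "variations (a # restrict_word i j v) \<le> 1" by (rule variations_constant)
      then show ?thesis by simp
    next
      assume "v \<in> keys (trw ws)"
      then show ?thesis by (rule 3(2)[OF fam 3(4,5)])
    qed
    then show ?thesis unfolding ru list.map fa by simp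
  qed
qed simp

lemma red_wt:
  assumes "W \<in> be_simplices r d" "u \<in> keys (red r (frag_of W))"
    and "i \<in> {1..r}" "j \<in> {1..r}"
  shows "sj_wt i j s u \<le> be_wt i j s W + 1"
proof -
  have "u \<in> keys (trw W)" using assms(2) keys_cls by auto
  then have "sj_wt i j s u \<le> variations (map hd (restrict_word i j s # map (restrict_word i j) W)) + 1"
    using trw_variations[OF be_simplices_family[OF assms(1)] assms(3,4), of u "hd (restrict_word i j s)"]
    by (simp add: sj_wt_def o_def)
  also have "\<dots> \<le> be_wt i j s W + 1"
    unfolding be_wt_def by (intro add_right_mono variations_map_le)
  finally show ?thesis .
qed

text \<open>The three summands of the coned chain are estimated separately, with the first vertex of
  \<open>W\<close> in front: the loss of 1 in \<open>red_wt\<close> is regained in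
  \<open>sec_wt\<close>, \<open>W\<close> itself is trivial, and faces are subsequences. The new
  vertex equals the one in front and thus adds nothing.\<close>

lemma homotopy_red_wt:
  assumes "W \<in> be_simplices r d" "W' \<in> keys (homotopy_red r d (frag_of W))"
    and ij: "i \<in> {1..r}" "j \<in> {1..r}" "i \<noteq> j" and "\<sigma> \<in> perms r"
  shows "be_wt i j \<sigma> W' \<le> be_wt i j \<sigma> W"
  using assms(1,2,6)
proof (induction d arbitrary: W W' \<sigma>)
  case (Suc d)
  have Wne: "W \<noteq> []" and hd: "hd W \<in> perms r"
    using Suc.prems(1) by (cases W; auto simp: be_simplices_iff)+
  let ?s = "hd W" and ?S = "sec r (Suc d) (red r (frag_of W))"
  let ?Y = "?S - frag_of W - homotopy_red r d (be_bdry W)"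
  from Suc.prems(2) have "W' \<in> keys (cone ?s ?Y)" by (simp only: homotopy_red.simps frag_extend_of)
  then obtain X where X: "X \<in> keys ?Y" and W': "W' = ?s # X"
    using keys_frag_extend[of "\<lambda>W. be_class (?s # W)" ?Y] keys_be_class
    unfolding cone_def by blast
  from X consider "X \<in> keys ?S" | "X = W" | "X \<in> keys (homotopy_red r d (be_bdry W))"
    using keys_diff[of "?S - frag_of W" "homotopy_red r d (be_bdry W)"] keys_diff[of ?S "frag_of W"]
    by (auto simp del: red_simps sec.simps)
  then have "be_wt i j ?s X \<le> be_wt i j ?s W"
  proof cases
    case 1
    then obtain u where u: "u \<in> keys (red r (frag_of W))" "X \<in> keys (sec r (Suc d) (frag_of u))"
      unfolding sec_extend[of r "Suc d" "red r (frag_of W)"]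
      using keys_frag_extend[of "\<lambda>u. sec r (Suc d) (frag_of u)" "red r (frag_of W)"] by blast
    have "u \<in> surjections r (Suc d)"
      using u(1) red_chains[of "frag_of W" r "Suc d"] Suc.prems(1) by auto
    from sec_wt[OF this u(2) ij hd] red_wt[OF Suc.prems(1) u(1) ij(1,2), of ?s]
    show ?thesis by simp
  next
    case 3
    have ext: "homotopy_red r d (be_bdry W) = frag_extend (\<lambda>V. homotopy_red r d (frag_of V)) (be_bdry W)"
      by (cases d) simp_all
    from 3 obtain V where V: "V \<in> keys (be_bdry W)" "X \<in> keys (homotopy_red r d (frag_of V))"
      unfolding ext using keys_frag_extend[of "\<lambda>V. homotopy_red r d (frag_of V)" "be_bdry W"] by blast
    have "V \<in> be_simplices r d" using V(1) keys_be_bdry_chains[OF Suc.prems(1)] by blast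
    from Suc.IH[OF this V(2) hd] have "be_wt i j ?s X \<le> be_wt i j ?s V" .
    also have "keys (be_bdry W) \<subseteq> {V. subseq (map (restrict_word i j) V) (map (restrict_word i j) W)}"
      unfolding be_bdry_def
    proof (intro keys_sum_subset keys_cmul_subset)
      fix m
      show "keys (be_class (delete_nth m W)) \<subseteq> {V. subseq (map (restrict_word i j) V) (map (restrict_word i j) W)}"
        using keys_be_class[of "delete_nth m W"] by (auto simp: subseq_map subseq_delete_nth)
    qed
    then have "be_wt i j ?s V \<le> be_wt i j ?s W"
      unfolding be_wt_def using V(1) by (intro variations_subseq_Cons) blast
    finally show ?thesis .
  qed simp
  moreover have "be_wt i j \<sigma> W = (if restrict_word i j \<sigma> \<noteq> restrict_word i j ?s then 1 else 0) + be_wt i j ?s W"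
    using Wne by (cases W) (simp_all add: be_wt_def)
  ultimately show ?case unfolding W' be_wt_Cons by simp
qed simp

section \<open>Transport of the operad axioms\<close>

text \<open>Equivariance of \<open>perm_comp\<close>, applied to identity sequences, shows that
  \<open>block_perm\<close> maps one arrangement of \<open>{1..r + s - 1}\<close> to another. It is
  therefore onto this finite set, hence bijective.\<close>

lemma block_perm_permutes:
  assumes "1 \<le> k" "k \<le> r" "1 \<le> s" "\<sigma> permutes {1..r}" "\<tau> permutes {1..s}"
  shows "block_perm s k \<sigma> \<tau> permutes {1..r + s - 1}"
proof (rule bij_imp_permutes)
  let ?u = "[1..<Suc r]" and ?v = "[1..<Suc s]" and ?b = "block_perm s k \<sigma> \<tau>"
  have uv: "?u \<in> perms r" "?v \<in> perms s" by (auto simp: perms_iff)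
  have k: "1 \<le> \<sigma> k" "\<sigma> k \<le> r" using permutes_in_image[OF assms(4), of k] assms(1,2) by auto
  have "map ?b (perm_comp k ?u ?v) = perm_comp (\<sigma> k) (map \<sigma> ?u) (map \<tau> ?v)"
    using permutes_inj[OF assms(4)] by (intro perm_comp_equivariant[symmetric]) auto
  also have "\<dots> \<in> perms (r + s - 1)"
    using map_permutes_perms[OF assms(4) uv(1)] map_permutes_perms[OF assms(5) uv(2)]
    by (intro perm_comp_perms k assms(3))
  finally have "?b ` {1..r + s - 1} = {1..r + s - 1}"
    using perm_comp_perms[OF assms(1-3) uv] by (simp add: perms_iff)
  then show "bij_betw ?b {1..r + s - 1} {1..r + s - 1}"
    by (simp add: bij_betw_def eq_card_imp_inj_on)
  fix x assume "x \<notin> {1..r + s - 1}"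
  then consider "x = 0" | "x \<ge> r + s" using assms(1-3) by fastforce
  then show "?b x = x"
  proof cases
    case 1
    have "\<sigma> 0 = 0" by (rule permutes_not_in[OF assms(4)]) simp
    then show ?thesis using 1 assms(1) by (simp add: block_perm_def Let_def)
  next
    case 2
    have "\<sigma> (x - s + 1) = x - s + 1"
      by (rule permutes_not_in[OF assms(4)]) (use 2 in auto)
    then show ?thesis using 2 k assms(1-3) by (simp add: block_perm_def Let_def)
  qed
qed

text \<open>Arguments in \<open>Q\<close> lift to \<open>P\<close> in each degree, and every
  operation of \<open>Q\<close> on images is the image of the operation of \<open>P\<close>. So the
  axioms of \<open>Q\<close> are images of those of \<open>P\<close>.\<close>

lemma dg_operad_transport:
  fixes P :: "'a::ab_group_add operad_data" and Q :: "'b::ab_group_add operad_data"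
  assumes P: "dg_operad P"
    and f_add: "\<And>r x y. f r (x + y) = f r x + f r y"
    and onto: "\<And>r d. 1 \<le> r \<Longrightarrow> chains Q r d = f r ` chains P r d"
    and f_bdry: "\<And>r d x. 1 \<le> r \<Longrightarrow> x \<in> chains P r d \<Longrightarrow> bdry Q r (f r x) = f r (bdry P r x)"
    and f_act: "\<And>r d \<sigma> x. 1 \<le> r \<Longrightarrow> \<sigma> permutes {1..r} \<Longrightarrow> x \<in> chains P r d
      \<Longrightarrow> act Q r \<sigma> (f r x) = f r (act P r \<sigma> x)"
    and f_pcomp: "\<And>r s k d e x y. \<lbrakk>1 \<le> k; k \<le> r; 1 \<le> s; x \<in> chains P r d; y \<in> chains P s e\<rbrakk>
      \<Longrightarrow> pcomp Q r s k (f r x) (f s y) = f (r + s - 1) (pcomp P r s k x y)"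
    and f_unit: "opunit Q = f 1 (opunit P)"
  shows "dg_operad Q"
proof -
  interpret P: dg_operad P by (rule P)
  have f_0: "f r 0 = 0" for r using f_add[of r 0 0] by simp
  have f_minus: "f r (- x) = - f r x" for r x
    using f_add[of r x "- x"] f_0 by (simp add: eq_neg_iff_add_eq_0 add.commute)
  have f_signed: "f r (signed m x) = signed m (f r x)" for r m x
    by (simp add: signed_def f_minus)
  have lift: "\<exists>x'\<in>chains P r d. x = f r x'" if "1 \<le> r" "x \<in> chains Q r d" for r d x
    using that onto by auto
  have mem: "f r x \<in> chains Q r d" if "1 \<le> r" "x \<in> chains P r d" for r d x
    using that onto by auto
  show ?thesis
  proof
    fix r d assume r: "(1::nat) \<le> r"
    show "0 \<in> chains Q r d" using mem[OF r P.zero_chain[OF r]] f_0 by simp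
    fix x y assume x: "x \<in> chains Q r d"
    then obtain x' where x': "x' \<in> chains P r d" "x = f r x'" using lift[OF r] by blast
    show "- x \<in> chains Q r d" using mem[OF r P.minus_chain[OF r x'(1)]] x'(2) f_minus by simp
    \<comment> \<open>In degree 0 no chain group contains the boundary by \<open>bdry_chain\<close>;
      it is known to be 0 instead, and this case is treated separately.\<close>
    have bx: "bdry P r x' = 0 \<or> (\<exists>d'. bdry P r x' \<in> chains P r d')"
      using P.bdry_chain[OF r] P.bdry_degree_0[OF r] x'(1) by (cases d) auto
    then have "bdry Q r (f r (bdry P r x')) = 0"
    proof
      assume "bdry P r x' = 0"
      then show ?thesis
        using f_bdry[OF r P.zero_chain[OF r]] P.bdry_bdry[OF r x'(1)] by (simp add: f_0)
    next
      assume "\<exists>d'. bdry P r x' \<in> chains P r d'"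
      then show ?thesis using f_bdry[OF r] P.bdry_bdry[OF r x'(1)] by (auto simp: f_0)
    qed
    then show "bdry Q r (bdry Q r x) = 0" unfolding x'(2) f_bdry[OF r x'(1)] .
    show "act Q r id x = x" unfolding x'(2)
      using f_act[OF r permutes_id x'(1)] P.act_id[OF r x'(1)] by simp
    {
      assume y: "y \<in> chains Q r d"
      then obtain y' where y': "y' \<in> chains P r d" "y = f r y'" using lift[OF r] by blast
      show "x + y \<in> chains Q r d"
        using mem[OF r P.add_chain[OF r x'(1) y'(1)]] unfolding x'(2) y'(2) f_add .
      show "bdry Q r (x + y) = bdry Q r x + bdry Q r y"
        unfolding x'(2) y'(2) f_add[symmetric] f_bdry[OF r P.add_chain[OF r x'(1) y'(1)]]
          f_bdry[OF r x'(1)] f_bdry[OF r y'(1)] P.bdry_add[OF r x'(1) y'(1)] ..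
      fix \<sigma> assume \<sigma>: "\<sigma> permutes {1..r}"
      show "act Q r \<sigma> (x + y) = act Q r \<sigma> x + act Q r \<sigma> y"
        unfolding x'(2) y'(2) f_add[symmetric] f_act[OF r \<sigma> P.add_chain[OF r x'(1) y'(1)]]
          f_act[OF r \<sigma> x'(1)] f_act[OF r \<sigma> y'(1)] P.act_add[OF r \<sigma> x'(1) y'(1)] ..
    }
    fix \<sigma> assume \<sigma>: "\<sigma> permutes {1..r}"
    note ax = P.act_chain[OF r \<sigma> x'(1)]
    show "act Q r \<sigma> x \<in> chains Q r d"
      using mem[OF r ax] unfolding x'(2) f_act[OF r \<sigma> x'(1)] .
    have "act Q r \<sigma> (f r (bdry P r x')) = f r (act P r \<sigma> (bdry P r x'))"
      using bx
    proof
      assume "bdry P r x' = 0"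
      then show ?thesis using f_act[OF r \<sigma> P.zero_chain[OF r]] by simp
    qed (use f_act[OF r \<sigma>] in auto)
    then show "bdry Q r (act Q r \<sigma> x) = act Q r \<sigma> (bdry Q r x)"
      unfolding x'(2) f_act[OF r \<sigma> x'(1)] f_bdry[OF r ax] f_bdry[OF r x'(1)] P.act_bdry[OF r \<sigma> x'(1)] ..
    fix \<tau> assume \<tau>: "\<tau> permutes {1..r}"
    show "act Q r \<sigma> (act Q r \<tau> x) = act Q r (\<sigma> \<circ> \<tau>) x"
      unfolding x'(2) f_act[OF r \<tau> x'(1)] f_act[OF r \<sigma> P.act_chain[OF r \<tau> x'(1)]]
        f_act[OF r permutes_compose[OF \<tau> \<sigma>] x'(1)] P.act_act[OF r \<sigma> \<tau> x'(1)] ..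
  next
    fix r d x assume r: "(1::nat) \<le> r" and x: "x \<in> chains Q r (Suc d)"
    then obtain x' where x': "x' \<in> chains P r (Suc d)" "x = f r x'" using lift by blast
    show "bdry Q r x \<in> chains Q r d"
      using mem[OF r P.bdry_chain[OF r x'(1)]] unfolding x'(2) f_bdry[OF r x'(1)] .
  next
    fix r x assume r: "(1::nat) \<le> r" and x: "x \<in> chains Q r 0"
    then obtain x' where x': "x' \<in> chains P r 0" "x = f r x'" using lift by blast
    show "bdry Q r x = 0"
      unfolding x'(2) f_bdry[OF r x'(1)] P.bdry_degree_0[OF r x'(1)] f_0 ..
  next
    fix k r s d e x y
    assume k: "(1::nat) \<le> k" "k \<le> r" "1 \<le> s" and x: "x \<in> chains Q r d" and y: "y \<in> chains Q s e"
    have r: "1 \<le> r" and rs: "1 \<le> r + s - 1" using k by auto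
    obtain x' where x': "x' \<in> chains P r d" "x = f r x'" using lift[OF r x] by blast
    obtain y' where y': "y' \<in> chains P s e" "y = f s y'" using lift[OF k(3) y] by blast
    note pc = P.pcomp_chain[OF k x'(1) y'(1)]
    show "pcomp Q r s k x y \<in> chains Q (r + s - 1) (d + e)"
      using mem[OF rs pc] unfolding x'(2) y'(2) f_pcomp[OF k x'(1) y'(1)] .
    have bx: "pcomp Q r s k (f r (bdry P r x')) (f s y') = f (r + s - 1) (pcomp P r s k (bdry P r x') y')"
    proof (cases d)
      case 0
      then show ?thesis
        using f_pcomp[OF k P.zero_chain[OF r] y'(1)] P.bdry_degree_0[OF r] x'(1) by simp
    next
      case (Suc d')
      then show ?thesis using f_pcomp[OF k P.bdry_chain[OF r] y'(1)] x'(1) by blast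
    qed
    have byy: "pcomp Q r s k (f r x') (f s (bdry P s y')) = f (r + s - 1) (pcomp P r s k x' (bdry P s y'))"
    proof (cases e)
      case 0
      then show ?thesis
        using f_pcomp[OF k x'(1) P.zero_chain[OF k(3)]] P.bdry_degree_0[OF k(3)] y'(1) by simp
    next
      case (Suc e')
      then show ?thesis using f_pcomp[OF k x'(1) P.bdry_chain[OF k(3)]] y'(1) by blast
    qed
    show "bdry Q (r + s - 1) (pcomp Q r s k x y)
      = pcomp Q r s k (bdry Q r x) y + signed d (pcomp Q r s k x (bdry Q s y))"
      unfolding x'(2) y'(2) f_pcomp[OF k x'(1) y'(1)] f_bdry[OF rs pc] f_bdry[OF r x'(1)]
        f_bdry[OF k(3) y'(1)] bx byy P.bdry_pcomp[OF k x'(1) y'(1)] f_add f_signed ..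
    {
      fix \<sigma> \<tau> assume st: "\<sigma> permutes {1..r}" "\<tau> permutes {1..s}"
      have sk: "1 \<le> \<sigma> k" "\<sigma> k \<le> r" using permutes_in_image[OF st(1), of k] k by auto
      show "pcomp Q r s (\<sigma> k) (act Q r \<sigma> x) (act Q s \<tau> y)
        = act Q (r + s - 1) (block_perm s k \<sigma> \<tau>) (pcomp Q r s k x y)"
        unfolding x'(2) y'(2) f_act[OF r st(1) x'(1)] f_act[OF k(3) st(2) y'(1)]
          f_pcomp[OF sk k(3) P.act_chain[OF r st(1) x'(1)] P.act_chain[OF k(3) st(2) y'(1)]]
          f_pcomp[OF k x'(1) y'(1)] f_act[OF rs block_perm_permutes[OF k st] pc]
          P.act_pcomp[OF k st x'(1) y'(1)] ..
    }
    {
      fix x2 assume "x2 \<in> chains Q r d"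
      then obtain x2' where x2': "x2' \<in> chains P r d" "x2 = f r x2'" using lift[OF r] by blast
      show "pcomp Q r s k (x + x2) y = pcomp Q r s k x y + pcomp Q r s k x2 y"
        unfolding x'(2) x2'(2) y'(2) f_add[symmetric] f_pcomp[OF k P.add_chain[OF r x'(1) x2'(1)] y'(1)]
          f_pcomp[OF k x'(1) y'(1)] f_pcomp[OF k x2'(1) y'(1)]
          P.pcomp_add_left[OF k x'(1) x2'(1) y'(1)] ..
    }
    fix y2 assume "y2 \<in> chains Q s e"
    then obtain y2' where y2': "y2' \<in> chains P s e" "y2 = f s y2'" using lift[OF k(3)] by blast
    show "pcomp Q r s k x (y + y2) = pcomp Q r s k x y + pcomp Q r s k x y2"
      unfolding x'(2) y'(2) y2'(2) f_add[symmetric] f_pcomp[OF k x'(1) P.add_chain[OF k(3) y'(1) y2'(1)]]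
        f_pcomp[OF k x'(1) y'(1)] f_pcomp[OF k x'(1) y2'(1)]
        P.pcomp_add_right[OF k x'(1) y'(1) y2'(1)] ..
  next
    fix k l r s t d e g x y z
    assume k: "(1::nat) \<le> k" "k \<le> r" and l: "1 \<le> l" "l \<le> s" and t: "1 \<le> t"
      and x: "x \<in> chains Q r d" and y: "y \<in> chains Q s e" and z: "z \<in> chains Q t g"
    have r: "1 \<le> r" and s: "1 \<le> s" using k l by auto
    obtain x' where x': "x' \<in> chains P r d" "x = f r x'" using lift[OF r x] by blast
    obtain y' where y': "y' \<in> chains P s e" "y = f s y'" using lift[OF s y] by blast
    obtain z' where z': "z' \<in> chains P t g" "z = f t z'" using lift[OF t z] by blast
    have kl: "1 \<le> k + l - 1" "k + l - 1 \<le> r + s - 1" and st: "1 \<le> s + t - 1"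
      and eq: "r + (s + t - 1) - 1 = r + s - 1 + t - 1" using k l t by auto
    show "pcomp Q (r + s - 1) t (k + l - 1) (pcomp Q r s k x y) z
      = pcomp Q r (s + t - 1) k x (pcomp Q s t l y z)"
      unfolding x'(2) y'(2) z'(2) f_pcomp[OF k s x'(1) y'(1)] f_pcomp[OF l t y'(1) z'(1)]
        f_pcomp[OF kl t P.pcomp_chain[OF k s x'(1) y'(1)] z'(1)]
        f_pcomp[OF k st x'(1) P.pcomp_chain[OF l t y'(1) z'(1)]]
        P.pcomp_sequential[OF k l t x'(1) y'(1) z'(1)] eq ..
  next
    fix i k r s t d e g x y z
    assume ik: "(1::nat) \<le> i" "i < k" "k \<le> r" and s: "1 \<le> s" and t: "1 \<le> t"
      and x: "x \<in> chains Q r d" and y: "y \<in> chains Q s e" and z: "z \<in> chains Q t g"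
    have r: "1 \<le> r" and k: "1 \<le> k" and i: "i \<le> r" using ik by auto
    obtain x' where x': "x' \<in> chains P r d" "x = f r x'" using lift[OF r x] by blast
    obtain y' where y': "y' \<in> chains P s e" "y = f s y'" using lift[OF s y] by blast
    obtain z' where z': "z' \<in> chains P t g" "z = f t z'" using lift[OF t z] by blast
    have i': "i \<le> r + s - 1" and k': "1 \<le> k + t - 1" "k + t - 1 \<le> r + t - 1"
      and eq: "r + t - 1 + s - 1 = r + s - 1 + t - 1" using ik s t by auto
    show "pcomp Q (r + s - 1) t i (pcomp Q r s k x y) z
      = signed (e * g) (pcomp Q (r + t - 1) s (k + t - 1) (pcomp Q r t i x z) y)"
      unfolding x'(2) y'(2) z'(2) f_pcomp[OF k ik(3) s x'(1) y'(1)] f_pcomp[OF ik(1) i t x'(1) z'(1)]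
        f_pcomp[OF ik(1) i' t P.pcomp_chain[OF k ik(3) s x'(1) y'(1)] z'(1)]
        f_pcomp[OF k' s P.pcomp_chain[OF ik(1) i t x'(1) z'(1)] y'(1)]
        P.pcomp_parallel[OF ik s t x'(1) y'(1) z'(1)] eq f_signed ..
  next
    show "opunit Q \<in> chains Q 1 0" unfolding f_unit by (rule mem[OF _ P.unit_chain]) simp
  next
    fix s e y assume s: "(1::nat) \<le> s" and y: "y \<in> chains Q s e"
    then obtain y' where y': "y' \<in> chains P s e" "y = f s y'" using lift by blast
    have "pcomp Q 1 s 1 (f 1 (opunit P)) (f s y') = f (1 + s - 1) (pcomp P 1 s 1 (opunit P) y')"
      by (rule f_pcomp[OF _ _ s P.unit_chain y'(1)]) simp_all
    then show "pcomp Q 1 s 1 (opunit Q) y = y"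
      unfolding y'(2) f_unit P.unit_left[OF s y'(1)] by simp
  next
    fix k r d x assume k: "(1::nat) \<le> k" "k \<le> r" and x: "x \<in> chains Q r d"
    then obtain x' where x': "x' \<in> chains P r d" "x = f r x'" using lift[of r x d] by auto
    have "pcomp Q r 1 k (f r x') (f 1 (opunit P)) = f (r + 1 - 1) (pcomp P r 1 k x' (opunit P))"
      by (rule f_pcomp[OF k _ x'(1) P.unit_chain]) simp
    then show "pcomp Q r 1 k x (opunit Q) = x"
      unfolding x'(2) f_unit P.unit_right[OF k x'(1)] by simp
  qed
qed

section \<open>Isomorphisms in homology\<close>

text \<open>Cosets of the cycle group in additive notation, which frees the homology computations
  from the monoid records.\<close>

definition tset :: "'a::ab_group_add set \<Rightarrow> 'a \<Rightarrow> 'a set" where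
  "tset B a = (\<lambda>b. b + a) ` B"

lemma r_coset_cycle_group: "B #>\<^bsub>cycle_group P r d\<^esub> a = tset B a"
  by (auto simp: r_coset_def cycle_group_def tset_def)

lemma carrier_cycle_group: "carrier (cycle_group P r d) = {x \<in> chains P r d. bdry P r x = 0}"
  by (simp add: cycle_group_def)

lemma set_mult_cycle_group: "X <#>\<^bsub>cycle_group P r d\<^esub> Y = (\<Union>x\<in>X. \<Union>y\<in>Y. {x + y})"
  by (auto simp: set_mult_def cycle_group_def)

definition additive_subgroup :: "'a::ab_group_add set \<Rightarrow> bool" where
  "additive_subgroup B \<longleftrightarrow> 0 \<in> B \<and> (\<forall>x\<in>B. \<forall>y\<in>B. x - y \<in> B)"

lemma additive_subgroupD:
  assumes "additive_subgroup B"
  shows "0 \<in> B" "x \<in> B \<Longrightarrow> y \<in> B \<Longrightarrow> x - y \<in> B" "x \<in> B \<Longrightarrow> y \<in> B \<Longrightarrow> x + y \<in> B"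
proof -
  show 0: "0 \<in> B" and diff: "x \<in> B \<Longrightarrow> y \<in> B \<Longrightarrow> x - y \<in> B" for x y
    using assms by (auto simp: additive_subgroup_def)
  show "x \<in> B \<Longrightarrow> y \<in> B \<Longrightarrow> x + y \<in> B"
    using diff[of x "0 - y"] diff[of 0 y] 0 by simp
qed

lemma tset_eq_iff:
  assumes "additive_subgroup B"
  shows "tset B a = tset B c \<longleftrightarrow> a - c \<in> B"
proof
  assume "tset B a = tset B c"
  moreover have "a \<in> tset B a" unfolding tset_def
    by (rule image_eqI[of _ _ 0]) (simp_all add: additive_subgroupD(1)[OF assms])
  ultimately show "a - c \<in> B" by (auto simp: tset_def)
next
  assume ac: "a - c \<in> B"
  have "b + a = (b + (a - c)) + c" "b + c = (b - (a - c)) + a" for b by simp_all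
  then show "tset B a = tset B c"
    unfolding tset_def using additive_subgroupD(2,3)[OF assms _ ac] by blast
qed

lemma tset_mult:
  assumes "additive_subgroup B"
  shows "(\<Union>x\<in>tset B a. \<Union>y\<in>tset B c. {x + y}) = tset B (a + c)"
proof -
  have "(b + a) + (b' + c) = (b + b') + (a + c)" "b + (a + c) = (b + a) + (0 + c)" for b b'
    by (simp_all add: algebra_simps)
  then show ?thesis
    unfolding tset_def using additive_subgroupD(1,3)[OF assms] by (auto simp: image_iff)
qed

lemma (in dg_operad) additive_subgroup_boundaries:
  assumes r: "1 \<le> r"
  shows "additive_subgroup (boundaries P r d)"
proof -
  have b0: "bdry P r 0 = 0"
    using bdry_add[OF r zero_chain[OF r] zero_chain[OF r]] by simp
  have diff: "bdry P r x - bdry P r y = bdry P r (x - y)"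
    if "x \<in> chains P r (Suc d)" "y \<in> chains P r (Suc d)" for x y
  proof -
    have "bdry P r (x + - y) = bdry P r x + bdry P r (- y)"
      by (rule bdry_add[OF r that(1) minus_chain[OF r that(2)]])
    moreover have "bdry P r (y + - y) = bdry P r y + bdry P r (- y)"
      by (rule bdry_add[OF r that(2) minus_chain[OF r that(2)]])
    ultimately show ?thesis using b0 by (simp add: eq_neg_iff_add_eq_0 algebra_simps)
  qed
  have sub: "x - y \<in> chains P r (Suc d)"
    if "x \<in> chains P r (Suc d)" "y \<in> chains P r (Suc d)" for x y
    using add_chain[OF r that(1) minus_chain[OF r that(2)]] by simp
  show ?thesis
    unfolding additive_subgroup_def boundaries_def
    using b0 zero_chain[OF r] diff sub by (auto intro!: image_eqI)
qed

text \<open>Surjectivity is asked for on cycles and not just on classes, because the section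
  provides an exact preimage of every cycle.\<close>

lemma (in dg_operad_morphism) homology_map_isoI:
  assumes r: "1 \<le> r"
    and surj: "\<And>y. \<lbrakk>y \<in> chains Q r d; bdry Q r y = 0\<rbrakk> \<Longrightarrow> \<exists>z\<in>chains P r d. bdry P r z = 0 \<and> f r z = y"
    and inj: "\<And>z. \<lbrakk>z \<in> chains P r d; bdry P r z = 0; f r z \<in> boundaries Q r d\<rbrakk> \<Longrightarrow> z \<in> boundaries P r d"
  shows "homology_map Q f r d \<in> iso (homology P r d) (homology Q r d)"
proof -
  let ?B = "boundaries P r d" and ?C = "boundaries Q r d" and ?h = "homology_map Q f r d"
  define Z where "Z = {x \<in> chains P r d. bdry P r x = 0}"
  define Y where "Y = {x \<in> chains Q r d. bdry Q r x = 0}"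
  note B = source.additive_subgroup_boundaries[OF r, of d] and C = target.additive_subgroup_boundaries[OF r, of d]
  have carP: "carrier (homology P r d) = tset ?B ` Z" and carQ: "carrier (homology Q r d) = tset ?C ` Y"
    by (auto simp: homology_def FactGroup_def RCOSETS_def r_coset_cycle_group Z_def Y_def carrier_cycle_group)
  have multP: "x \<otimes>\<^bsub>homology P r d\<^esub> y = (\<Union>a\<in>x. \<Union>b\<in>y. {a + b})" for x y
    by (simp add: homology_def FactGroup_def set_mult_cycle_group)
  have multQ: "x \<otimes>\<^bsub>homology Q r d\<^esub> y = (\<Union>a\<in>x. \<Union>b\<in>y. {a + b})" for x y
    by (simp add: homology_def FactGroup_def set_mult_cycle_group)
  have f0: "f r 0 = 0" using map_add[OF r source.zero_chain[OF r] source.zero_chain[OF r]] by simp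
  have b0: "bdry P r 0 = 0"
    using source.bdry_add[OF r source.zero_chain[OF r] source.zero_chain[OF r]] by simp
  have fB: "f r b \<in> ?C" "b \<in> chains P r d" if "b \<in> ?B" for b
  proof -
    from that obtain x where x: "x \<in> chains P r (Suc d)" "b = bdry P r x" by (auto simp: boundaries_def)
    then show "b \<in> chains P r d" using source.bdry_chain[OF r] by simp
    show "f r b \<in> ?C" unfolding x(2) map_bdry[OF r x(1)] boundaries_def
      using map_chain[OF r x(1)] by (rule imageI)
  qed
  have fZ: "f r z \<in> Y" if "z \<in> Z" for z
    using that map_chain[OF r] map_bdry[OF r, of z d] by (auto simp: Z_def Y_def f0)
  have Zadd: "x + y \<in> Z" if "x \<in> Z" "y \<in> Z" for x y
    using that source.add_chain[OF r] source.bdry_add[OF r, of x d y] by (auto simp: Z_def)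
  have Zminus: "- y \<in> Z" if "y \<in> Z" for y
  proof -
    have y: "y \<in> chains P r d" "bdry P r y = 0" using that by (auto simp: Z_def)
    then have "bdry P r (y + - y) = bdry P r y + bdry P r (- y)"
      by (intro source.bdry_add[OF r _ source.minus_chain[OF r]])
    then show ?thesis using y source.minus_chain[OF r y(1)] b0 by (simp add: Z_def)
  qed
  have key: "?h (tset ?B z) = tset ?C (f r z)" if z: "z \<in> Z" for z
  proof -
    have "tset ?C (f r (b + z)) = tset ?C (f r z)" if "b \<in> ?B" for b
      using fB[OF that] z map_add[OF r fB(2)[OF that], of z]
      by (simp add: tset_eq_iff[OF C] Z_def)
    moreover have "?B \<noteq> {}" using additive_subgroupD(1)[OF B] by blast
    ultimately show ?thesis
      unfolding homology_map_def r_coset_cycle_group by (simp add: tset_def[of ?B])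
  qed
  have "?h \<in> hom (homology P r d) (homology Q r d)"
  proof (rule homI)
    show "?h x \<in> carrier (homology Q r d)" if "x \<in> carrier (homology P r d)" for x
      using that key fZ by (auto simp: carP carQ)
    fix x y assume "x \<in> carrier (homology P r d)" "y \<in> carrier (homology P r d)"
    then obtain a c where ac: "a \<in> Z" "c \<in> Z" "x = tset ?B a" "y = tset ?B c" by (auto simp: carP)
    have fac: "f r (a + c) = f r a + f r c" using ac map_add[OF r, of a d c] by (simp add: Z_def)
    show "?h (x \<otimes>\<^bsub>homology P r d\<^esub> y) = ?h x \<otimes>\<^bsub>homology Q r d\<^esub> ?h y"
      unfolding multP multQ ac(3,4) tset_mult[OF B] key[OF Zadd[OF ac(1,2)]] key[OF ac(1)] key[OF ac(2)]
        tset_mult[OF C] fac ..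
  qed
  moreover have "bij_betw ?h (carrier (homology P r d)) (carrier (homology Q r d))"
    unfolding bij_betw_def
  proof
    show "inj_on ?h (carrier (homology P r d))"
    proof (rule inj_onI)
      fix x y assume "x \<in> carrier (homology P r d)" "y \<in> carrier (homology P r d)" and eq: "?h x = ?h y"
      then obtain a c where ac: "a \<in> Z" "c \<in> Z" "x = tset ?B a" "y = tset ?B c" by (auto simp: carP)
      have amc: "a + - c \<in> Z" by (rule Zadd[OF ac(1) Zminus[OF ac(2)]])
      have "f r a = f r (a + - c) + f r c"
        using map_add[OF r, of "a + - c" d c] amc ac(2) by (simp add: Z_def)
      moreover have "f r a - f r c \<in> ?C"
        using eq unfolding ac(3,4) key[OF ac(1)] key[OF ac(2)] tset_eq_iff[OF C] .
      ultimately have "f r (a + - c) \<in> ?C" by simp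
      then have "a + - c \<in> ?B" using amc by (intro inj) (auto simp: Z_def)
      then show "x = y" unfolding ac(3,4) tset_eq_iff[OF B] by simp
    qed
    show "?h ` carrier (homology P r d) = carrier (homology Q r d)"
    proof
      show "?h ` carrier (homology P r d) \<subseteq> carrier (homology Q r d)"
        using key fZ by (auto simp: carP carQ)
      show "carrier (homology Q r d) \<subseteq> ?h ` carrier (homology P r d)"
      proof
        fix x assume "x \<in> carrier (homology Q r d)"
        then obtain y where y: "y \<in> Y" "x = tset ?C y" by (auto simp: carQ)
        then obtain z where z: "z \<in> Z" "f r z = y" using surj[of y] by (auto simp: Y_def Z_def)
        show "x \<in> ?h ` carrier (homology P r d)"
          unfolding carP y(2) z(2)[symmetric] key[OF z(1), symmetric] using z(1) by (intro imageI)
      qed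
    qed
  qed
  ultimately show ?thesis by (simp add: iso_def)
qed

section \<open>The filtered surjection operad\<close>

definition sj_fil :: "enat \<Rightarrow> nat \<Rightarrow> nat \<Rightarrow> nat list set" where
  "sj_fil n r d = {u \<in> surjections r d.
      \<forall>i j. 1 \<le> i \<and> i < j \<and> j \<le> r \<longrightarrow> enat (variations (restrict_word i j u)) \<le> n}"

lemma sj_fil_subset: "sj_fil n r d \<subseteq> surjections r d"
  by (auto simp: sj_fil_def)

lemma sj_filD:
  assumes "u \<in> sj_fil n r d" "i \<in> {1..r}" "j \<in> {1..r}" "i \<noteq> j"
  shows "enat (variations (restrict_word i j u)) \<le> n"
proof (cases "i < j")
  case True
  then show ?thesis using assms by (simp add: sj_fil_def)
next
  case False
  then have "enat (variations (restrict_word j i u)) \<le> n"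
    using assms by (auto simp: sj_fil_def)
  then show ?thesis by (simp add: restrict_word_commute)
qed

lemma sj_filtration_simps:
  "chains (sj_filtration n) = (\<lambda>r d. {c. keys c \<subseteq> sj_fil n r d})"
  "bdry (sj_filtration n) = (\<lambda>r. frag_extend (sj_bdry r))"
  "act (sj_filtration n) = sj_map"
  "pcomp (sj_filtration n) = (\<lambda>r s k. bilin (sj_pcomp r s k))"
  "opunit (sj_filtration n) = frag_of [1]"
  by (simp_all add: sj_filtration_def surjection_operad_def sj_fil_def sj_map_def bilin_def fun_eq_iff)

text \<open>The strict bound on simplices absorbs the \<open>+ 1\<close> of \<open>red_wt\<close>;
  with the first vertex of \<open>W\<close> in front, the weight of \<open>W\<close> is its plain
  number of variations.\<close>

lemma red_fil:
  assumes "keys x \<subseteq> be_fil n r d"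
  shows "keys (red r x) \<subseteq> sj_fil n r d"
  unfolding red_def
proof (rule keys_extend_subset)
  fix W assume "W \<in> keys x"
  then have W: "W \<in> be_fil n r d" using assms by blast
  then have WS: "W \<in> be_simplices r d" using be_fil_subset by blast
  then have Wne: "W \<noteq> []" by (auto simp: be_simplices_iff)
  show "keys (cls r (trw W)) \<subseteq> sj_fil n r d"
  proof
    fix u assume u: "u \<in> keys (cls r (trw W))"
    then have uS: "u \<in> surjections r d" using red_chains[of "frag_of W" r d] WS by auto
    have "enat (variations (restrict_word i j u)) \<le> n" if ij: "1 \<le> i" "i < j" "j \<le> r" for i j
    proof -
      have "variations (restrict_word i j u) \<le> sj_wt i j (hd W) u"
        unfolding sj_wt_def by (rule variations_Cons_mono)
      also have "\<dots> \<le> be_wt i j (hd W) W + 1"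
        by (rule red_wt[OF WS]) (use u ij in auto)
      also have "\<dots> = Suc (be_var W i j)" by (simp add: be_wt_hd[OF Wne])
      finally have "enat (variations (restrict_word i j u)) \<le> enat (Suc (be_var W i j))" by simp
      also have "\<dots> = eSuc (enat (be_var W i j))" by (simp add: eSuc_enat)
      also have "\<dots> \<le> n"
        using be_filD[OF W, of i j] ij by (intro ileI1) auto
      finally show ?thesis .
    qed
    then show "u \<in> sj_fil n r d" using uS by (simp add: sj_fil_def)
  qed
qed

lemma sec_fil:
  assumes "keys x \<subseteq> sj_fil n r d"
  shows "keys (sec r d x) \<subseteq> be_fil n r d"
  unfolding sec_extend[of r d x]
proof (rule keys_extend_subset)
  fix u assume "u \<in> keys x"
  then have u: "u \<in> sj_fil n r d" using assms by blast
  then have uS: "u \<in> surjections r d" using sj_fil_subset by blast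
  then have su: "set u = {1..r}" by (simp add: surjections_def)
  show "keys (sec r d (frag_of u)) \<subseteq> be_fil n r d"
  proof
    fix W assume W: "W \<in> keys (sec r d (frag_of u))"
    have "W \<in> be_simplices r d" using W sec_chains[of "frag_of u" r d] uS by auto
    then show "W \<in> be_fil n r d"
    proof (rule be_filI)
      fix i j assume ij: "i \<in> {1..r}" "j \<in> {1..r}" "i \<noteq> j"
      have "be_var W i j + 1 \<le> be_wt i j (first_occs u) W + 1"
        using be_var_le_wt by simp
      also have "\<dots> \<le> sj_wt i j (first_occs u) u"
        by (rule sec_wt[OF uS W ij first_occs_perms[OF su]])
      also have "\<dots> = variations (restrict_word i j u)"
        by (rule sj_wt_first_occs) (use su ij in simp)
      finally have "enat (be_var W i j) < enat (variations (restrict_word i j u))" by simp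
      also have "\<dots> \<le> n" by (rule sj_filD[OF u ij])
      finally show "enat (be_var W i j) < n" .
    qed
  qed
qed

lemma homotopy_red_fil:
  assumes "keys x \<subseteq> be_fil n r d"
  shows "keys (homotopy_red r d x) \<subseteq> be_fil n r (Suc d)"
proof -
  have ext: "homotopy_red r d x = frag_extend (\<lambda>W. homotopy_red r d (frag_of W)) x"
    by (cases d) simp_all
  show ?thesis unfolding ext
  proof (rule keys_extend_subset)
    fix W assume "W \<in> keys x"
    then have W: "W \<in> be_fil n r d" using assms by blast
    then have WS: "W \<in> be_simplices r d" using be_fil_subset by blast
    then have Wne: "W \<noteq> []" and hd: "hd W \<in> perms r" by (cases W; auto simp: be_simplices_iff)+
    show "keys (homotopy_red r d (frag_of W)) \<subseteq> be_fil n r (Suc d)"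
    proof
      fix W' assume W': "W' \<in> keys (homotopy_red r d (frag_of W))"
      have "W' \<in> be_simplices r (Suc d)"
        using W' homotopy_red_chains[of "frag_of W" r d] WS by auto
      then show "W' \<in> be_fil n r (Suc d)"
      proof (rule be_fil_mono[OF W])
        fix i j assume ij: "i \<in> {1..r}" "j \<in> {1..r}" "i \<noteq> j"
        have "be_var W' i j \<le> be_wt i j (hd W) W'" by (rule be_var_le_wt)
        also have "\<dots> \<le> be_wt i j (hd W) W" by (rule homotopy_red_wt[OF WS W' ij hd])
        also have "\<dots> = be_var W i j" by (rule be_wt_hd[OF Wne])
        finally show "be_var W' i j \<le> be_var W i j" .
      qed
    qed
  qed
qed

lemma sj_fil_chains: "keys x \<subseteq> sj_fil n r d \<Longrightarrow> x \<in> sj_chains r d"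
  using sj_fil_subset by blast

text \<open>The section preserves the filtration, so each stage of the surjection operad is the
  image of the same stage upstairs. This allows the operad axioms to be transported stage by
  stage.\<close>

lemma sj_chains_onto: "{c. keys c \<subseteq> sj_fil n r d} = red r ` {c. keys c \<subseteq> be_fil n r d}"
proof
  show "{c :: nat list \<Rightarrow>\<^sub>0 int. keys c \<subseteq> sj_fil n r d} \<subseteq> red r ` {c. keys c \<subseteq> be_fil n r d}"
  proof
    fix x :: "nat list \<Rightarrow>\<^sub>0 int" assume "x \<in> {c. keys c \<subseteq> sj_fil n r d}"
    then have "keys x \<subseteq> sj_fil n r d" by simp
    then show "x \<in> red r ` {c. keys c \<subseteq> be_fil n r d}"
      using red_sec[OF sj_fil_chains, symmetric] sec_fil by blast
  qed
qed (use red_fil in blast)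

lemma red_unit: "red 1 (frag_of [[1]]) = frag_of [1]"
  by (simp add: trw_singleton sj_class_def del: trw.simps)

lemma dg_operad_sj_filtration: "dg_operad (sj_filtration n)"
proof (rule dg_operad_transport[OF dg_operad_be_filtration[of n], where f = red];
    (unfold be_filtration_simps sj_filtration_simps)?)
  show "red r (x + y) = red r x + red r y" for r x y by (rule red_add)
  show "{c. keys c \<subseteq> sj_fil n r d} = red r ` {c. keys c \<subseteq> be_fil n r d}" for r d
    by (rule sj_chains_onto)
  show "frag_extend (sj_bdry r) (red r x) = red r (frag_extend be_bdry x)"
    if "x \<in> {c. keys c \<subseteq> be_fil n r d}" for r d x
    by (rule red_bdry[OF be_fil_chains[OF that]])
  show "sj_map r \<sigma> (red r x) = red r (be_map (map \<sigma>) x)"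
    if "\<sigma> permutes {1..r}" "x \<in> {c. keys c \<subseteq> be_fil n r d}" for r d \<sigma> x
    by (rule red_be_map[OF that(1) be_fil_chains[OF that(2)], symmetric])
  show "bilin (sj_pcomp r s k) (red r x) (red s y) = red (r + s - 1) (ez k x y)"
    if "1 \<le> k" "k \<le> r" "1 \<le> s" "x \<in> {c. keys c \<subseteq> be_fil n r d}" "y \<in> {c. keys c \<subseteq> be_fil n s e}"
    for r s k d e x y
    by (rule red_pcomp[OF that(1-3) be_fil_chains[OF that(4)] be_fil_chains[OF that(5)], symmetric])
  show "frag_of [1] = red 1 (frag_of [[1]])" by (rule red_unit[symmetric])
qed

lemma dg_operad_morphism_table_reduction:
  "dg_operad_morphism (be_filtration n) (sj_filtration n) table_reduction"
proof (intro dg_operad_morphism.intro dg_operad_be_filtration dg_operad_sj_filtration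
    dg_operad_morphism_axioms.intro)
  interpret P: dg_operad "be_filtration n" by (rule dg_operad_be_filtration)
  have TR: "table_reduction r x = red r x" if "1 \<le> r" "x \<in> chains (be_filtration n) r d" for r d x
    by (rule table_reduction_red[OF that(1) be_fil_chains[of x n r d]]) (use that(2) in simp)
  fix r d and x y assume r: "(1::nat) \<le> r" and x: "x \<in> chains (be_filtration n) r d"
  have xb: "x \<in> be_chains r d" using x be_fil_chains by auto
  show "table_reduction r x \<in> chains (sj_filtration n) r d"
    unfolding TR[OF r x] sj_filtration_simps using x red_fil by simp
  show "table_reduction r (x + y) = table_reduction r x + table_reduction r y"
    by (simp add: table_reduction_def frag_extend_add)
  show "table_reduction r (bdry (be_filtration n) r x) = bdry (sj_filtration n) r (table_reduction r x)"
  proof (cases d)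
    case 0
    then have "bdry (be_filtration n) r x = 0" using P.bdry_degree_0[OF r] x by simp
    then show ?thesis
      unfolding TR[OF r x] using red_bdry[OF xb] by (simp add: sj_filtration_simps table_reduction_def)
  next
    case (Suc d')
    have "bdry (be_filtration n) r x \<in> chains (be_filtration n) r d'"
      using P.bdry_chain[OF r] x Suc by simp
    then show ?thesis
      unfolding TR[OF r x] using TR[OF r] red_bdry[OF xb] by (simp add: sj_filtration_simps)
  qed
  show "table_reduction r (act (be_filtration n) r \<sigma> x) = act (sj_filtration n) r \<sigma> (table_reduction r x)"
    if \<sigma>: "\<sigma> permutes {1..r}" for \<sigma>
    unfolding TR[OF r x] TR[OF r P.act_chain[OF r \<sigma> x]] using red_be_map[OF \<sigma> xb]
    by (simp add: sj_filtration_simps)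
next
  interpret P: dg_operad "be_filtration n" by (rule dg_operad_be_filtration)
  have TR: "table_reduction r x = red r x" if "1 \<le> r" "x \<in> chains (be_filtration n) r d" for r d x
    by (rule table_reduction_red[OF that(1) be_fil_chains[of x n r d]]) (use that(2) in simp)
  fix k r s d e and x y
  assume k: "(1::nat) \<le> k" "k \<le> r" "1 \<le> s"
    and x: "x \<in> chains (be_filtration n) r d" and y: "y \<in> chains (be_filtration n) s e"
  have b: "x \<in> be_chains r d" "y \<in> be_chains s e" using x y be_fil_chains by auto
  have r: "1 \<le> r" "1 \<le> r + s - 1" using k by auto
  show "table_reduction (r + s - 1) (pcomp (be_filtration n) r s k x y)
    = pcomp (sj_filtration n) r s k (table_reduction r x) (table_reduction s y)"
    unfolding TR[OF r(1) x] TR[OF k(3) y] TR[OF r(2) P.pcomp_chain[OF k x y]]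
    using red_pcomp[OF k b] by (simp add: sj_filtration_simps)
next
  interpret P: dg_operad "be_filtration n" by (rule dg_operad_be_filtration)
  have "opunit (be_filtration n) \<in> be_chains 1 0"
    using P.unit_chain be_fil_chains[of _ n 1 0] unfolding be_filtration_simps by blast
  then have "table_reduction 1 (opunit (be_filtration n)) = red 1 (opunit (be_filtration n))"
    by (intro table_reduction_red) simp
  then show "table_reduction 1 (opunit (be_filtration n)) = opunit (sj_filtration n)"
    using red_unit by (simp only: sj_filtration_simps be_filtration_simps)
qed

theorem mainTheorem3:
  fixes n :: enat
  assumes "1 \<le> n"
  shows "operad_quasi_isomorphism (be_filtration n) (sj_filtration n) table_reduction"
proof (intro operad_quasi_isomorphism.intro dg_operad_morphism_table_reduction
    operad_quasi_isomorphism_axioms.intro)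
  fix r d assume r: "(1::nat) \<le> r"
  interpret dg_operad_morphism "be_filtration n" "sj_filtration n" table_reduction
    by (rule dg_operad_morphism_table_reduction)
  show "homology_map (sj_filtration n) table_reduction r d
      \<in> iso (homology (be_filtration n) r d) (homology (sj_filtration n) r d)"
  proof (rule homology_map_isoI[OF r])
    fix y assume "y \<in> chains (sj_filtration n) r d" and by0: "bdry (sj_filtration n) r y = 0"
    then have y: "keys y \<subseteq> sj_fil n r d" by (simp add: sj_filtration_simps)
    let ?z = "sec r d y"
    have z: "keys ?z \<subseteq> be_fil n r d" by (rule sec_fil[OF y])
    have "frag_extend be_bdry ?z = 0"
    proof (cases d)
      case 0
      then show ?thesis using source.bdry_degree_0[OF r, of ?z] z by simp
    next
      case (Suc d')
      then have "frag_extend be_bdry ?z = sec r d' (frag_extend (sj_bdry r) y)"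
        using sec_bdry[of y r d'] sj_fil_chains[OF y] by (simp del: sec.simps)
      then show ?thesis using by0 by (simp add: sj_filtration_simps)
    qed
    moreover have "table_reduction r ?z = y"
      using table_reduction_red[OF r, of ?z d] red_sec[OF sj_fil_chains[OF y]] z be_fil_chains[of ?z] by simp
    ultimately show "\<exists>z\<in>chains (be_filtration n) r d. bdry (be_filtration n) r z = 0 \<and> table_reduction r z = y"
      using z by (intro bexI[of _ ?z]) simp_all
  next
    fix z assume "z \<in> chains (be_filtration n) r d" and bz: "bdry (be_filtration n) r z = 0"
      and "table_reduction r z \<in> boundaries (sj_filtration n) r d"
    then have z: "keys z \<subseteq> be_fil n r d" by simp
    then have zb: "z \<in> be_chains r d" using be_fil_chains[of z] by simp
    obtain y where y: "keys y \<subseteq> sj_fil n r (Suc d)" and "table_reduction r z = frag_extend (sj_bdry r) y"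
      using \<open>table_reduction r z \<in> _\<close> by (auto simp: boundaries_def sj_filtration_simps)
    then have eq: "red r z = frag_extend (sj_bdry r) y" using table_reduction_red[OF r zb] by simp
    have "frag_extend be_bdry (homotopy_red r d z) = sec r d (red r z) - z"
      using homotopy_red_bdry[OF zb] bz by simp
    moreover have "frag_extend be_bdry (sec r (Suc d) y) = sec r d (red r z)"
      unfolding eq by (rule sec_bdry[OF sj_fil_chains[OF y]])
    \<comment> \<open>For the cycle \<open>z\<close> the boundary of the homotopy is S TR z - z, and
      that of S y is S TR z because TR z is the boundary of \<open>y\<close>. The difference bounds
      \<open>z\<close>.\<close>
    ultimately have "z = frag_extend be_bdry (sec r (Suc d) y - homotopy_red r d z)"
      by (simp add: frag_extend_diff del: sec.simps)
    moreover have "keys (sec r (Suc d) y - homotopy_red r d z) \<subseteq> be_fil n r (Suc d)"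
      by (intro keys_diff_subset sec_fil[OF y] homotopy_red_fil[OF z])
    ultimately show "z \<in> boundaries (be_filtration n) r d"
      unfolding boundaries_def be_filtration_simps by blast
  qed
qed

end
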